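(* Let $\mathcal{S}$ be a complete divisorial fan on $\mathbb{P}^1$ with respect to the lattice $L=\mathbb{Z}^d$, let $T=(\mathbb{C}^* )^d$, and let $X=X(\mathcal{S})$ be the corresponding complete complexity-one $T$-variety. Let $E_T^N=(\mathbb{A}^N\setminus\{0\})^d$ and let $T$ act diagonally on $X\times E_T^N$. Let $Y_C=X(\mathcal{S}_{Y_C})$, where $\mathcal{S}_{Y_C}=\{\rho(\mathfrak{D}\times\sigma_I)\mid\mathfrak{D}\in\mathcal{S},\ \sigma_I\in\Sigma_E\}$. For $\mathfrak{D}\in\mathcal{S}$ and $\sigma_I\in\Sigma_E$ consider the morphism of pp-divisors $\mathfrak{D}\times\sigma_I\to\rho(\mathfrak{D}\times\sigma_I)$ given by the triple $(i,\rho,1)$, where $i$ is the identity morphism of $\mathbb{P}^1$ and $1$ is the unit plurifunction. Then the map $q: X\times E_T^N\to Y_C$ induced by these morphisms of pp-divisors is a geometric quotient (for the action of $T$).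
   Context: Cones and the map $\rho$: fix positive integers $d,N$; $L=\mathbb{Z}^d$ is the cocharacter lattice of $T$, $L_E=\mathbb{Z}^{Nd}=(\mathbb{Z}^N)^d$ that of the dense torus $T_E$ of the toric variety $E_T^N$; $T$ acts on $E_T^N$ by letting $t=(t_1,\dots,t_d)$ scale the $j$-th factor $\mathbb{A}^N\setminus\{0\}$ by $t_j$. For $1\le i\le N$ let $\sigma^i\subset\mathbb{Q}^N$ be the cone generated by all standard basis vectors except $e_i$; for $I=(i_1,\dots,i_d)\in\{1,\dots,N\}^d$ let $\sigma_I=\sigma^{i_1}\times\cdots\times\sigma^{i_d}\subset\mathbb{Q}^{Nd}$; $\Sigma_E$, the fan of $E_T^N$, consists of the $\sigma_I$ and their faces (an arbitrary element of $\Sigma_E$ is also denoted $\sigma_I$). Let $J:L\to L_E$ send $a=(a_1,\dots,a_d)$ to the vector whose $j$-th block in $\mathbb{Z}^N$ is $(a_j,\dots,a_j)$. Define $\rho: L\oplus L_E\to L_E$, $\rho(a,b)=b-J(a)$, extended linearly to $\mathbb{Q}$; its kernel is $\{(a,J(a))\}$, the cocharacter lattice of the diagonal $T\subset T\times T_E$. Polyhedral divisors on a smooth curve $Y$ (for a lattice $L$ with dual $M$, torus $T=\operatorname{Spec}\mathbb{C}[M]$): a polyhedral divisor with pointed tail cone $\delta\subset L_{\mathbb{Q}}$ is a formal sum $\mathfrak{D}=\sum_{p\in Y}\Delta_p\otimes p$, where each $\Delta_p$ is either empty or a polyhedron in $L_{\mathbb{Q}}$ with tail cone $\{v \mid v+\Delta_p\subseteq\Delta_p\}=\delta$,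 and all but finitely many $\Delta_p$ equal $\delta$. $\operatorname{Loc}(\mathfrak{D})=Y\setminus\{p \mid \Delta_p=\emptyset\}$. For $u\in\delta^\vee$ put $\mathfrak{D}(u)=\sum_{p\in \operatorname{Loc}(\mathfrak{D})}\min_{v\in\Delta_p}\langle u,v\rangle\, p$. $\mathfrak{D}$ is a pp-divisor if $\mathfrak{D}(u)$ is semiample on $\operatorname{Loc}(\mathfrak{D})$ for all $u\in\delta^\vee$ and big for $u$ in the relative interior of $\delta^\vee$. Its affine $T$-variety is $X(\mathfrak{D})=\operatorname{Spec}\bigoplus_{u\in\delta^\vee\cap M}\Gamma(\operatorname{Loc}(\mathfrak{D}),\mathcal{O}(\mathfrak{D}(u)))$ ($\mathcal{O}$ of a $\mathbb{Q}$-divisor means $\mathcal{O}$ of its round-down). Intersection is coefficientwise; for pp-divisors $\mathfrak{D}'\subset\mathfrak{D}$ (coefficientwise inclusion) there is an induced dominant morphism $X(\mathfrak{D}')\to X(\mathfrak{D})$, and $\mathfrak{D}'$ is a face of $\mathfrak{D}$ if this is an open embedding. A divisorial fan is a finite set $\mathcal{S}$ of pp-divisors on $Y$ closed under intersection, with $\mathfrak{D}\cap\mathfrak{D}'$ a face of both members; $X(\mathcal{S})$ is glued from the $X(\mathfrak{D})$ along the $X(\mathfrak{D}\cap\mathfrak{D}')$. $\mathcal{S}$ is complete if $X(\mathcal{S})$ is complete, equivalently $Y$ is complete and at every $p$ the nonempty coefficients of the elements of $\mathcal{S}$ form a complete polyhedral subdivision of $L_{\mathbb{Q}}$. Products: for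 $\mathfrak{D}=\sum\Delta_p\otimes p\in\mathcal{S}$ put $\mathfrak{D}\times\sigma_I=\sum(\Delta_p\times\sigma_I)\otimes p$ (lattice $L\oplus L_E$) and $\rho(\mathfrak{D}\times\sigma_I)=\sum\rho(\Delta_p\times\sigma_I)\otimes p$ (lattice $L_E$), with $\emptyset\times\sigma_I=\emptyset$. The $X(\mathfrak{D}\times\sigma_I)=X(\mathfrak{D})\times U_{\sigma_I}$ form an open cover of $X\times E_T^N$ ($U_{\sigma_I}$ the affine toric chart), and $\mathcal{S}_{Y_C}$ is a complete divisorial fan on $\mathbb{P}^1$. Induced map: writing $\delta$ for the tail cone of $\mathfrak{D}$, the morphism $(i,\rho,1)$ induces $q_{\mathfrak{D}\times\sigma_I}:X(\mathfrak{D}\times\sigma_I)\to X(\rho(\mathfrak{D}\times\sigma_I))$, dual to the ring homomorphism $\bigoplus_{u\in\rho(\delta\times\sigma_I)^\vee}\Gamma(\operatorname{Loc}(\mathfrak{D}),\mathcal{O}(\rho(\mathfrak{D}\times\sigma_I)(u)))\to\bigoplus_{v\in(\delta\times\sigma_I)^\vee}\Gamma(\operatorname{Loc}(\mathfrak{D}),\mathcal{O}((\mathfrak{D}\times\sigma_I)(v)))$ (sums over lattice points) mapping the degree-$u$ part identically to the degree-$(u\circ\rho)$ part, these divisors being equal; $q$ is glued from the $q_{\mathfrak{D}\times\sigma_I}$. *)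

theory Defs
  imports
    "HOL-Analysis.Analysis"
    "HOL-Computational_Algebra.Computational_Algebra"
    "HOL-Library.Poly_Mapping"
begin

section \<open>Complex varieties as spaces with functions\<close>

text \<open>
  Varieties over the complex numbers are rendered classically: the set of closed points with
  its Zariski topology and its sheaf of regular functions.  A regular function on an open set
  \<open>U\<close> is represented by any total function with the right values on \<open>U\<close>; the values outside
  \<open>U\<close> are irrelevant.
\<close>

record 'x fspace =
  zariski :: "'x topology"
  reg :: "'x set \<Rightarrow> ('x \<Rightarrow> complex) set"

abbreviation points :: "'x fspace \<Rightarrow> 'x set" where
  "points X \<equiv> topspace (zariski X)"

definition fs_morphism :: "'x fspace \<Rightarrow> 'y fspace \<Rightarrow> ('x \<Rightarrow> 'y) \<Rightarrow> bool" where
  "fs_morphism X Y f \<longleftrightarrow>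
     continuous_map (zariski X) (zariski Y) f \<and>
     (\<forall>V \<phi>. openin (zariski Y) V \<longrightarrow> \<phi> \<in> reg Y V \<longrightarrow> \<phi> \<circ> f \<in> reg X {x \<in> points X. f x \<in> V})"

definition open_embedding :: "'x fspace \<Rightarrow> 'y fspace \<Rightarrow> ('x \<Rightarrow> 'y) \<Rightarrow> bool" where
  "open_embedding X Y f \<longleftrightarrow>
     fs_morphism X Y f \<and> inj_on f (points X) \<and> open_map (zariski X) (zariski Y) f \<and>
     (\<forall>U \<phi>. openin (zariski X) U \<longrightarrow> (\<phi> \<in> reg Y (f ` U) \<longleftrightarrow> \<phi> \<circ> f \<in> reg X U))"

definition fs_isomorphism :: "'x fspace \<Rightarrow> 'y fspace \<Rightarrow> ('x \<Rightarrow> 'y) \<Rightarrow> bool" where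
  "fs_isomorphism X Y f \<longleftrightarrow> open_embedding X Y f \<and> f ` points X = points Y"

definition open_subspace :: "'x fspace \<Rightarrow> 'x set \<Rightarrow> 'x fspace" where
  "open_subspace X U = \<lparr>zariski = subtopology (zariski X) U, reg = reg X\<rparr>"

text \<open>
  \<open>principal_space P R\<close> is the space with functions determined by an algebra \<open>R\<close> of functions
  on \<open>P\<close>: the non-vanishing loci of elements of \<open>R\<close> are a basis of the topology, and regular
  functions are locally fractions of elements of \<open>R\<close>.
\<close>

definition principal_space :: "'x set \<Rightarrow> ('x \<Rightarrow> complex) set \<Rightarrow> 'x fspace" where
  "principal_space P R =
    (let Z = topology_generated_by ((\<lambda>f. {x \<in> P. f x \<noteq> 0}) ` R)
     in \<lparr>zariski = Z,
         reg = (\<lambda>U. {\<phi>. \<forall>x\<in>U. \<exists>W. openin Z W \<and> x \<in> W \<and> W \<subseteq> U \<and>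
                      (\<exists>f\<in>R. \<exists>g\<in>R. \<forall>y\<in>W. g y \<noteq> 0 \<and> \<phi> y = f y / g y)})\<rparr>)"

inductive_set polyfun :: "'k set \<Rightarrow> (('k \<Rightarrow> complex) \<Rightarrow> complex) set" for I :: "'k set" where
  const: "(\<lambda>x. c) \<in> polyfun I"
| coord: "i \<in> I \<Longrightarrow> (\<lambda>x. x i) \<in> polyfun I"
| add: "f \<in> polyfun I \<Longrightarrow> g \<in> polyfun I \<Longrightarrow> (\<lambda>x. f x + g x) \<in> polyfun I"
| mult: "f \<in> polyfun I \<Longrightarrow> g \<in> polyfun I \<Longrightarrow> (\<lambda>x. f x * g x) \<in> polyfun I"

definition closed_in_affine_space ::
    "'k set \<Rightarrow> (('k \<Rightarrow> complex) \<Rightarrow> complex) set \<Rightarrow> ('k \<Rightarrow> complex) fspace" where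
  "closed_in_affine_space I F =
     principal_space {x \<in> extensional I. \<forall>f\<in>F. f x = 0} (polyfun I)"

definition affine_variety :: "'x fspace \<Rightarrow> bool" where
  "affine_variety X \<longleftrightarrow>
     (\<exists>(n::nat) F h. F \<subseteq> polyfun {..<n} \<and> fs_isomorphism X (closed_in_affine_space {..<n} F) h)"

definition sheaf_of_functions :: "'x fspace \<Rightarrow> bool" where
  "sheaf_of_functions X \<longleftrightarrow>
     (\<forall>U \<phi> \<psi>. openin (zariski X) U \<longrightarrow> (\<forall>x\<in>U. \<phi> x = \<psi> x) \<longrightarrow> \<phi> \<in> reg X U \<longrightarrow> \<psi> \<in> reg X U) \<and>
     (\<forall>U V \<phi>. openin (zariski X) U \<longrightarrow> openin (zariski X) V \<longrightarrow> V \<subseteq> U \<longrightarrow>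
        \<phi> \<in> reg X U \<longrightarrow> \<phi> \<in> reg X V) \<and>
     (\<forall>\<U> \<phi>. (\<forall>U\<in>\<U>. openin (zariski X) U \<and> \<phi> \<in> reg X U) \<longrightarrow> \<phi> \<in> reg X (\<Union>\<U>))"

definition prevariety :: "'x fspace \<Rightarrow> bool" where
  "prevariety X \<longleftrightarrow>
     sheaf_of_functions X \<and>
     (\<exists>\<U>. finite \<U> \<and> \<Union>\<U> = points X \<and>
        (\<forall>U\<in>\<U>. openin (zariski X) U \<and> affine_variety (open_subspace X U)))"

text \<open>
  The product: on \<open>U \<times> V\<close> with \<open>U\<close>, \<open>V\<close> open one has the functions
  \<open>\<Sum>i. f\<^sub>i \<otimes> g\<^sub>i\<close>; their non-vanishing loci are a basis of the topology (finer than the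
  product topology), and regular functions are locally fractions of them.
\<close>

definition tensor_functions ::
    "'x fspace \<Rightarrow> 'y fspace \<Rightarrow> 'x set \<Rightarrow> 'y set \<Rightarrow> ('x \<times> 'y \<Rightarrow> complex) set" where
  "tensor_functions X Y U V =
     {h. \<exists>(n::nat) f g. (\<forall>i<n. f i \<in> reg X U \<and> g i \<in> reg Y V) \<and>
           h = (\<lambda>(x, y). \<Sum>i<n. f i x * g i y)}"

definition fs_prod :: "'x fspace \<Rightarrow> 'y fspace \<Rightarrow> ('x \<times> 'y) fspace" where
  "fs_prod X Y =
    (let Z = topology_generated_by
               {{z \<in> U \<times> V. h z \<noteq> 0} | U V h.
                  openin (zariski X) U \<and> openin (zariski Y) V \<and> h \<in> tensor_functions X Y U V}
     in \<lparr>zariski = Z,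
         reg = (\<lambda>S. {\<phi>. \<forall>z\<in>S. \<exists>W U V. openin Z W \<and> z \<in> W \<and> W \<subseteq> S \<and> W \<subseteq> U \<times> V \<and>
                      openin (zariski X) U \<and> openin (zariski Y) V \<and>
                      (\<exists>h\<in>tensor_functions X Y U V. \<exists>k\<in>tensor_functions X Y U V.
                         \<forall>w\<in>W. k w \<noteq> 0 \<and> \<phi> w = h w / k w)})\<rparr>)"

definition separated :: "'x fspace \<Rightarrow> bool" where
  "separated X \<longleftrightarrow> closedin (zariski (fs_prod X X)) ((\<lambda>x. (x, x)) ` points X)"

text \<open>
  Test spaces for universal closedness may be taken with points in \<^typ>\<open>complex\<close>: a complex
  prevariety has at most continuum many points, so it is isomorphic to one of this kind.
\<close>

definition complete_variety :: "'x fspace \<Rightarrow> bool" where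
  "complete_variety X \<longleftrightarrow>
     prevariety X \<and> separated X \<and>
     (\<forall>Z :: complex fspace. prevariety Z \<longrightarrow>
        closed_map (zariski (fs_prod X Z)) (zariski Z) snd)"

text \<open>
  Gluing spaces \<open>F j\<close>, \<open>j \<in> J\<close>: quotient of the disjoint union by the equivalence relation
  generated by the identifications \<open>R\<close>.
\<close>

definition glue_class :: "(('j \<times> 'x) \<times> ('j \<times> 'x)) set \<Rightarrow> 'j \<Rightarrow> 'x \<Rightarrow> ('j \<times> 'x) set" where
  "glue_class R j x = ((R \<union> R\<inverse>)\<^sup>*) `` {(j, x)}"

definition glue ::
    "'j set \<Rightarrow> ('j \<Rightarrow> 'x fspace) \<Rightarrow> (('j \<times> 'x) \<times> ('j \<times> 'x)) set \<Rightarrow> ('j \<times> 'x) set fspace" where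
  "glue J F R =
     \<lparr>zariski = topology (\<lambda>U.
        U \<subseteq> (\<Union>j\<in>J. glue_class R j ` points (F j)) \<and>
        (\<forall>j\<in>J. openin (zariski (F j)) {x \<in> points (F j). glue_class R j x \<in> U})),
      reg = (\<lambda>U. {\<phi>. \<forall>j\<in>J. \<phi> \<circ> glue_class R j
                        \<in> reg (F j) {x \<in> points (F j). glue_class R j x \<in> U}})\<rparr>"

text \<open>
  Geometric quotient in the sense of Mumford (Geometric Invariant Theory, Definition 0.6), for
  an action \<open>act\<close> of the group of points \<open>G\<close>: \<open>q\<close> is a surjective morphism whose fibres are
  exactly the orbits, it is submersive, and the regular functions on \<open>V\<close> are the invariant
  regular functions on the preimage of \<open>V\<close>.
\<close>

definition geometric_quotient ::
    "'g set \<Rightarrow> ('g \<Rightarrow> 'x \<Rightarrow> 'x) \<Rightarrow> 'x fspace \<Rightarrow> 'y fspace \<Rightarrow> ('x \<Rightarrow> 'y) \<Rightarrow> bool" where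
  "geometric_quotient G act X Y q \<longleftrightarrow>
     fs_morphism X Y q \<and>
     q ` points X = points Y \<and>
     (\<forall>x\<in>points X. {x' \<in> points X. q x' = q x} = (\<lambda>g. act g x) ` G) \<and>
     quotient_map (zariski X) (zariski Y) q \<and>
     (\<forall>V \<psi>. openin (zariski Y) V \<longrightarrow> \<psi> \<in> reg X {x \<in> points X. q x \<in> V} \<longrightarrow>
        (\<forall>g\<in>G. \<forall>x\<in>points X. q x \<in> V \<longrightarrow> \<psi> (act g x) = \<psi> x) \<longrightarrow>
        (\<exists>\<phi>\<in>reg Y V. \<forall>x\<in>points X. q x \<in> V \<longrightarrow> \<psi> x = \<phi> (q x)))"


section \<open>The projective line and rational divisors on it\<close>

datatype proj_line = Fin complex | Infty

type_synonym ratfun = "complex poly fract"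

definition const_fun :: "complex \<Rightarrow> ratfun" where
  "const_fun c = to_fract [:c:]"

text \<open>Order of vanishing at a point; only meaningful for nonzero rational functions.\<close>

fun poly_ord_at :: "proj_line \<Rightarrow> complex poly \<Rightarrow> int" where
  "poly_ord_at (Fin a) g = int (order a g)"
| "poly_ord_at Infty g = - int (degree g)"

definition ord_at :: "proj_line \<Rightarrow> ratfun \<Rightarrow> int" where
  "ord_at p f = (THE n. \<exists>g h. g \<noteq> 0 \<and> h \<noteq> 0 \<and> f = Fract g h \<and>
                        n = poly_ord_at p g - poly_ord_at p h)"

text \<open>The value at \<open>p\<close> of a rational function that is regular at \<open>p\<close>.\<close>

definition value_at :: "ratfun \<Rightarrow> proj_line \<Rightarrow> complex" where
  "value_at f p = (THE c. f = const_fun c \<or> ord_at p (f - const_fun c) > 0)"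

definition P1 :: "proj_line fspace" where
  "P1 = \<lparr>zariski = topology (\<lambda>U. U = {} \<or> finite (- U)),
         reg = (\<lambda>U. {\<phi>. \<exists>f. \<forall>p\<in>U. (f = 0 \<or> ord_at p f \<ge> 0) \<and> \<phi> p = value_at f p})\<rparr>"

text \<open>
  Divisors with rational coefficients on an open set \<open>U\<close> are functions \<open>E\<close> on points, with only
  the values on \<open>U\<close> relevant.  \<open>sections U E\<close> is \<open>\<Gamma>(U, \<O>(\<lfloor>E\<rfloor>))\<close>.
\<close>

definition sections :: "proj_line set \<Rightarrow> (proj_line \<Rightarrow> rat) \<Rightarrow> ratfun set" where
  "sections U E = {f. f = 0 \<or> (\<forall>p\<in>U. ord_at p f + \<lfloor>E p\<rfloor> \<ge> 0)}"

definition integral_on :: "proj_line set \<Rightarrow> (proj_line \<Rightarrow> rat) \<Rightarrow> bool" where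
  "integral_on U E \<longleftrightarrow> (\<forall>p\<in>U. E p \<in> \<int>)"

text \<open>The locus in \<open>U\<close> where \<open>f\<close>, as a section of \<open>\<O>(E)\<close> with \<open>E\<close> integral, does not vanish.\<close>

definition nonvanishing :: "proj_line set \<Rightarrow> (proj_line \<Rightarrow> rat) \<Rightarrow> ratfun \<Rightarrow> proj_line set" where
  "nonvanishing U E f = {p \<in> U. f \<noteq> 0 \<and> ord_at p f + \<lfloor>E p\<rfloor> = 0}"

text \<open>Some multiple is integral and base point free.\<close>

definition semiample :: "proj_line set \<Rightarrow> (proj_line \<Rightarrow> rat) \<Rightarrow> bool" where
  "semiample U E \<longleftrightarrow>
     (\<exists>m::nat. m > 0 \<and> integral_on U (\<lambda>p. of_nat m * E p) \<and>
        (\<forall>p\<in>U. \<exists>f\<in>sections U (\<lambda>p. of_nat m * E p).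
            p \<in> nonvanishing U (\<lambda>p. of_nat m * E p) f))"

text \<open>
  Bigness in the sense of Altmann and Hausen, which also makes sense on a non-complete base:
  some multiple is integral and has a nonzero section with affine non-vanishing locus.
\<close>

definition big :: "proj_line set \<Rightarrow> (proj_line \<Rightarrow> rat) \<Rightarrow> bool" where
  "big U E \<longleftrightarrow>
     (\<exists>m::nat. m > 0 \<and> integral_on U (\<lambda>p. of_nat m * E p) \<and>
        (\<exists>f\<in>sections U (\<lambda>p. of_nat m * E p). f \<noteq> 0 \<and>
            affine_variety (open_subspace P1 (nonvanishing U (\<lambda>p. of_nat m * E p) f))))"


section \<open>Rational polyhedra and cones\<close>

text \<open>
  A lattice with basis indexed by \<^typ>\<open>'i\<close> is \<^typ>\<open>int ^ 'i\<close>, with rational span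
  \<^typ>\<open>rat ^ 'i\<close>; the dual lattice is identified with the same type by the dual basis.
\<close>

definition pairing :: "'r::comm_ring_1 ^ 'i \<Rightarrow> 'r ^ 'i::finite \<Rightarrow> 'r" where
  "pairing u v = (\<Sum>i\<in>UNIV. u $ i * v $ i)"

definition rat_vec :: "int ^ 'i \<Rightarrow> rat ^ 'i::finite" where
  "rat_vec u = (\<chi> i. of_int (u $ i))"

definition dual_cone :: "(rat ^ 'i) set \<Rightarrow> (rat ^ 'i::finite) set" where
  "dual_cone C = {u. \<forall>v\<in>C. pairing u v \<ge> 0}"

definition polyhedron_rat :: "(rat ^ 'i::finite) set \<Rightarrow> bool" where
  "polyhedron_rat P \<longleftrightarrow> (\<exists>F. finite F \<and> P = {v. \<forall>(u, c)\<in>F. pairing u v \<ge> c})"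

text \<open>Finite intersections of half spaces \<open>{v. pairing u v \<ge> 0}\<close> containing no line.\<close>

definition pointed_cone :: "(rat ^ 'i::finite) set \<Rightarrow> bool" where
  "pointed_cone C \<longleftrightarrow> (\<exists>F. finite F \<and> C = dual_cone F) \<and> (\<forall>v\<in>C. - v \<in> C \<longrightarrow> v = 0)"

definition tail_cone :: "(rat ^ 'i::finite) set \<Rightarrow> (rat ^ 'i) set" where
  "tail_cone P = {v. (\<lambda>w. v + w) ` P \<subseteq> P}"

text \<open>
  \<open>u \<in> C\<close> has a neighbourhood, inside the linear span \<open>{a - b. a, b \<in> C}\<close>, contained in \<open>C\<close>.
\<close>

definition cone_rel_interior :: "(rat ^ 'i::finite) set \<Rightarrow> (rat ^ 'i) set" where
  "cone_rel_interior C =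
     {u \<in> C. \<exists>\<epsilon>>0. \<forall>a\<in>C. \<forall>b\<in>C. (\<forall>i. \<bar>a $ i - b $ i\<bar> < \<epsilon>) \<longrightarrow> u + (a - b) \<in> C}"

definition cone_generated :: "(rat ^ 'i::finite) set \<Rightarrow> (rat ^ 'i) set" where
  "cone_generated B = {\<Sum>b\<in>B. c b *s b | c. \<forall>b\<in>B. c b \<ge> 0}"

definition cone_face :: "(rat ^ 'i::finite) set \<Rightarrow> (rat ^ 'i) set \<Rightarrow> bool" where
  "cone_face \<tau> \<sigma> \<longleftrightarrow> (\<exists>u\<in>dual_cone \<sigma>. \<tau> = {v \<in> \<sigma>. pairing u v = 0})"


section \<open>Polyhedral divisors on the projective line\<close>

type_synonym 'i pdiv = "proj_line \<Rightarrow> (rat ^ 'i) set"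

definition polyhedral_divisor :: "'i::finite pdiv \<Rightarrow> bool" where
  "polyhedral_divisor D \<longleftrightarrow>
     (\<exists>\<delta>. pointed_cone \<delta> \<and> finite {p. D p \<noteq> \<delta>} \<and>
        (\<forall>p. D p = {} \<or> (polyhedron_rat (D p) \<and> tail_cone (D p) = \<delta>)))"

definition tail :: "'i::finite pdiv \<Rightarrow> (rat ^ 'i) set" where
  "tail D = (THE \<delta>. finite {p. D p \<noteq> \<delta>})"

definition Loc :: "'i::finite pdiv \<Rightarrow> proj_line set" where
  "Loc D = {p. D p \<noteq> {}}"

text \<open>The divisor \<open>D(u)\<close> on \<open>Loc D\<close>; the minimum is attained for \<open>u\<close> in the dual of the tail cone.\<close>

definition pdiv_eval :: "'i::finite pdiv \<Rightarrow> rat ^ 'i \<Rightarrow> proj_line \<Rightarrow> rat" where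
  "pdiv_eval D u p = (LEAST c. c \<in> pairing u ` D p)"

definition pp_divisor :: "'i::finite pdiv \<Rightarrow> bool" where
  "pp_divisor D \<longleftrightarrow>
     polyhedral_divisor D \<and>
     (\<forall>u\<in>dual_cone (tail D). semiample (Loc D) (pdiv_eval D u)) \<and>
     (\<forall>u\<in>cone_rel_interior (dual_cone (tail D)). big (Loc D) (pdiv_eval D u))"

text \<open>
  The group ring \<open>K[M]\<close> over the function field \<open>K\<close>; the monomial \<open>f \<chi>\<^sup>u\<close> is
  \<^term>\<open>Poly_Mapping.single u f\<close>.  All algebras below are subalgebras of such rings.
\<close>

type_synonym 'i group_ring = "(int ^ 'i) \<Rightarrow>\<^sub>0 ratfun"

definition pp_algebra :: "'i::finite pdiv \<Rightarrow> 'i group_ring set" where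
  "pp_algebra D =
     {a. \<forall>u\<in>Poly_Mapping.keys a. rat_vec u \<in> dual_cone (tail D) \<and>
           Poly_Mapping.lookup a u \<in> sections (Loc D) (pdiv_eval D (rat_vec u))}"

text \<open>
  Closed points of the spectrum of a subalgebra \<open>A\<close>: algebra homomorphisms to the complex
  numbers, made extensional.
\<close>

definition alg_points :: "'i::finite group_ring set \<Rightarrow> ('i group_ring \<Rightarrow> complex) set" where
  "alg_points A =
     {x \<in> extensional A.
        (\<forall>c. x (Poly_Mapping.single 0 (const_fun c)) = c) \<and>
        (\<forall>a\<in>A. \<forall>b\<in>A. x (a + b) = x a + x b \<and> x (a * b) = x a * x b)}"

definition Spec :: "'i::finite group_ring set \<Rightarrow> ('i group_ring \<Rightarrow> complex) fspace" where
  "Spec A = principal_space (alg_points A) ((\<lambda>a x. x a) ` A)"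

definition X_aff :: "'i::finite pdiv \<Rightarrow> ('i group_ring \<Rightarrow> complex) fspace" where
  "X_aff D = Spec (pp_algebra D)"

definition pdiv_subset :: "'i::finite pdiv \<Rightarrow> 'i pdiv \<Rightarrow> bool" where
  "pdiv_subset D' D \<longleftrightarrow> (\<forall>p. D' p \<subseteq> D p)"

definition pdiv_inter :: "'i::finite pdiv \<Rightarrow> 'i pdiv \<Rightarrow> 'i pdiv" where
  "pdiv_inter D D' = (\<lambda>p. D p \<inter> D' p)"

text \<open>
  For \<open>D' \<subseteq> D\<close> the algebra of \<open>D\<close> is contained in that of \<open>D'\<close>, so the induced morphism
  restricts homomorphisms.
\<close>

definition pp_map :: "'i::finite pdiv \<Rightarrow> ('i group_ring \<Rightarrow> complex) \<Rightarrow> ('i group_ring \<Rightarrow> complex)" where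
  "pp_map D z = restrict z (pp_algebra D)"

definition pp_face :: "'i::finite pdiv \<Rightarrow> 'i pdiv \<Rightarrow> bool" where
  "pp_face D' D \<longleftrightarrow> pdiv_subset D' D \<and> open_embedding (X_aff D') (X_aff D) (pp_map D)"

definition divisorial_fan :: "'i::finite pdiv set \<Rightarrow> bool" where
  "divisorial_fan S \<longleftrightarrow>
     finite S \<and> (\<forall>D\<in>S. pp_divisor D) \<and>
     (\<forall>D\<in>S. \<forall>D'\<in>S. pdiv_inter D D' \<in> S \<and>
        pp_face (pdiv_inter D D') D \<and> pp_face (pdiv_inter D D') D')"

definition fan_overlap ::
    "'i::finite pdiv set \<Rightarrow>
       (('i pdiv \<times> ('i group_ring \<Rightarrow> complex)) \<times> ('i pdiv \<times> ('i group_ring \<Rightarrow> complex))) set" where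
  "fan_overlap S =
     {((D, pp_map D z), (D', pp_map D' z)) | D D' z.
        D \<in> S \<and> D' \<in> S \<and> z \<in> points (X_aff (pdiv_inter D D'))}"

abbreviation fan_class ::
    "'i::finite pdiv set \<Rightarrow> 'i pdiv \<Rightarrow> ('i group_ring \<Rightarrow> complex)
       \<Rightarrow> ('i pdiv \<times> ('i group_ring \<Rightarrow> complex)) set" where
  "fan_class S \<equiv> glue_class (fan_overlap S)"

definition X_fan ::
    "'i::finite pdiv set \<Rightarrow> ('i pdiv \<times> ('i group_ring \<Rightarrow> complex)) set fspace" where
  "X_fan S = glue S X_aff (fan_overlap S)"

definition complete_fan :: "'i::finite pdiv set \<Rightarrow> bool" where
  "complete_fan S \<longleftrightarrow> complete_variety (X_fan S)"


section \<open>Torus actions\<close>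

definition torus :: "('i \<Rightarrow> complex) set" where
  "torus = {t. \<forall>i. t i \<noteq> 0}"

text \<open>
  Value of the character \<open>\<chi>\<^sup>u\<close>; vanishing coordinates are allowed where the exponent is
  nonnegative (and \<open>0 powi 0 = 1\<close>).
\<close>

definition character :: "('i::finite \<Rightarrow> complex) \<Rightarrow> int ^ 'i \<Rightarrow> complex" where
  "character t u = (\<Prod>i\<in>UNIV. t i powi (u $ i))"

text \<open>The degree \<open>u\<close> part of the algebra has weight \<open>u\<close>: \<open>(t \<cdot> x)(f \<chi>\<^sup>u) = \<chi>\<^sup>u(t) x(f \<chi>\<^sup>u)\<close>.\<close>

definition aff_act ::
    "'i::finite pdiv \<Rightarrow> ('i \<Rightarrow> complex) \<Rightarrow> ('i group_ring \<Rightarrow> complex) \<Rightarrow> ('i group_ring \<Rightarrow> complex)" where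
  "aff_act D t x =
     (\<lambda>a\<in>pp_algebra D. x (\<Sum>u\<in>Poly_Mapping.keys a.
        Poly_Mapping.single u (const_fun (character t u) * Poly_Mapping.lookup a u)))"

definition fan_act ::
    "('i::finite \<Rightarrow> complex) \<Rightarrow> ('i pdiv \<times> ('i group_ring \<Rightarrow> complex)) set
       \<Rightarrow> ('i pdiv \<times> ('i group_ring \<Rightarrow> complex)) set" where
  "fan_act t c = (\<lambda>(D, x). (D, aff_act D t x)) ` c"


section \<open>The space \<open>E\<close> and its fan\<close>

text \<open>
  Here \<open>d = CARD('d)\<close>, \<open>N = CARD('n)\<close>; the coordinate \<open>k\<close> of the block \<open>j\<close> has index \<open>(j, k)\<close>.
\<close>

definition E_space :: "('d::finite \<times> 'n::finite \<Rightarrow> complex) fspace" where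
  "E_space = open_subspace (closed_in_affine_space UNIV {}) {e. \<forall>j. \<exists>k. e (j, k) \<noteq> 0}"

definition E_act ::
    "('d::finite \<Rightarrow> complex) \<Rightarrow> ('d \<times> 'n::finite \<Rightarrow> complex) \<Rightarrow> ('d \<times> 'n \<Rightarrow> complex)" where
  "E_act t e = (\<lambda>(j, k). t j * e (j, k))"

definition sigma_block :: "'n::finite \<Rightarrow> (rat ^ 'n) set" where
  "sigma_block i = cone_generated {axis k 1 | k. k \<noteq> i}"

definition sigma_max :: "('d::finite \<Rightarrow> 'n::finite) \<Rightarrow> (rat ^ ('d \<times> 'n)) set" where
  "sigma_max I = {v. \<forall>j. (\<chi> k. v $ (j, k)) \<in> sigma_block (I j)}"

definition Sigma_E :: "(rat ^ ('d::finite \<times> 'n::finite)) set set" where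
  "Sigma_E = {\<tau>. \<exists>I. cone_face \<tau> (sigma_max I)}"

text \<open>
  The affine toric chart of a cone of the fan: all members of the fan are generated by standard
  basis vectors, and the coordinates belonging to the other basis vectors are invertible.
\<close>

definition toric_chart ::
    "(rat ^ ('d::finite \<times> 'n::finite)) set \<Rightarrow> ('d \<times> 'n \<Rightarrow> complex) set" where
  "toric_chart \<sigma> = {e \<in> points E_space. \<forall>i. axis i 1 \<notin> \<sigma> \<longrightarrow> e i \<noteq> 0}"


section \<open>The divisorial fan of the quotient and the quotient map\<close>

text \<open>The direct sum of the lattices of \<open>T\<close> and \<open>T\<^sub>E\<close> has index type \<^typ>\<open>'d + 'd \<times> 'n\<close>.\<close>

definition fst_part :: "'r ^ ('d::finite + 'e::finite) \<Rightarrow> 'r ^ 'd" where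
  "fst_part w = (\<chi> j. w $ Inl j)"

definition snd_part :: "'r ^ ('d::finite + 'e::finite) \<Rightarrow> 'r ^ 'e" where
  "snd_part w = (\<chi> i. w $ Inr i)"

definition J_map :: "'r ^ 'd::finite \<Rightarrow> 'r ^ ('d \<times> 'n::finite)" where
  "J_map a = (\<chi> i. a $ fst i)"

definition rho :: "'r::ab_group_add ^ ('d::finite + 'd \<times> 'n::finite) \<Rightarrow> 'r ^ ('d \<times> 'n)" where
  "rho w = snd_part w - J_map (fst_part w)"

text \<open>The linear form \<open>u \<circ> \<rho>\<close>, in coordinates with respect to the dual basis.\<close>

definition rho_dual :: "int ^ ('d::finite \<times> 'n::finite) \<Rightarrow> int ^ ('d + 'd \<times> 'n)" where
  "rho_dual u = (\<chi> i. pairing u (rho (axis i 1)))"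

lemma pairing_rho_dual: "pairing (rho_dual u) w = pairing u (rho w)"
proof -
  have axis_sum: "w = (\<Sum>i\<in>UNIV. w $ i *s axis i 1)"
    by (simp add: vec_eq_iff axis_def if_distrib sum.delta cong: if_cong)
  have rho_sum: "rho (\<Sum>i\<in>A. w $ i *s axis i 1) = (\<Sum>i\<in>A. w $ i *s rho (axis i 1))"
    if "finite A" for A
    using that
    by (simp add: vec_eq_iff rho_def fst_part_def snd_part_def J_map_def
        sum_subtractf algebra_simps)
  have "pairing u (rho w) = pairing u (\<Sum>i\<in>UNIV. w $ i *s rho (axis i 1))"
    using axis_sum rho_sum[of UNIV] by simp
  also have "\<dots> = (\<Sum>k\<in>UNIV. \<Sum>i\<in>UNIV. u $ k * (w $ i * rho (axis i 1) $ k))"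
    by (simp add: pairing_def sum_distrib_left)
  also have "\<dots> = (\<Sum>i\<in>UNIV. \<Sum>k\<in>UNIV. u $ k * (w $ i * rho (axis i 1) $ k))"
    by (rule sum.swap)
  also have "\<dots> = pairing (rho_dual u) w"
    by (simp add: pairing_def rho_dual_def sum_distrib_left sum_distrib_right algebra_simps)
  finally show ?thesis by simp
qed

definition pdiv_times ::
    "'d::finite pdiv \<Rightarrow> (rat ^ ('d \<times> 'n::finite)) set \<Rightarrow> ('d + 'd \<times> 'n) pdiv" where
  "pdiv_times D \<sigma> = (\<lambda>p. {w. fst_part w \<in> D p \<and> snd_part w \<in> \<sigma>})"

definition rho_pdiv :: "('d::finite + 'd \<times> 'n::finite) pdiv \<Rightarrow> ('d \<times> 'n) pdiv" where
  "rho_pdiv D = (\<lambda>p. rho ` D p)"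

definition S_YC :: "'d::finite pdiv set \<Rightarrow> ('d \<times> 'n::finite) pdiv set" where
  "S_YC S = {rho_pdiv (pdiv_times D \<sigma>) | D \<sigma>. D \<in> S \<and> \<sigma> \<in> Sigma_E}"

text \<open>
  The identification of \<open>X(D) \<times> U\<^sub>\<sigma>\<close> with \<open>X(D \<times> \<sigma>)\<close>: the point \<open>(x, e)\<close> becomes the
  homomorphism sending \<open>f \<chi>\<^sup>(\<^sup>u\<^sup>,\<^sup>v\<^sup>)\<close> to \<open>x(f \<chi>\<^sup>u) \<chi>\<^sup>v(e)\<close>.
\<close>

definition pair_point ::
    "'d::finite pdiv \<Rightarrow> (rat ^ ('d \<times> 'n::finite)) set \<Rightarrow> ('d group_ring \<Rightarrow> complex)
       \<Rightarrow> ('d \<times> 'n \<Rightarrow> complex) \<Rightarrow> (('d + 'd \<times> 'n) group_ring \<Rightarrow> complex)" where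
  "pair_point D \<sigma> x e =
     (\<lambda>a\<in>pp_algebra (pdiv_times D \<sigma>). \<Sum>w\<in>Poly_Mapping.keys a.
        x (Poly_Mapping.single (fst_part w) (Poly_Mapping.lookup a w)) * character e (snd_part w))"

text \<open>
  The ring homomorphism \<open>f \<chi>\<^sup>u \<mapsto> f \<chi>\<^sup>u\<^sup>\<circ>\<^sup>\<rho>\<close> and the morphism \<open>q\<close> dual to it from
  \<open>X(D')\<close> to \<open>X(\<rho>(D'))\<close>, for \<open>D'\<close> of the form \<open>D \<times> \<sigma>\<close>.
\<close>

definition rho_hom ::
    "('d::finite \<times> 'n::finite) group_ring \<Rightarrow> ('d + 'd \<times> 'n) group_ring" where
  "rho_hom a = (\<Sum>u\<in>Poly_Mapping.keys a.
                  Poly_Mapping.single (rho_dual u) (Poly_Mapping.lookup a u))"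

definition q_aff ::
    "('d::finite + 'd \<times> 'n::finite) pdiv \<Rightarrow> (('d + 'd \<times> 'n) group_ring \<Rightarrow> complex)
       \<Rightarrow> (('d \<times> 'n) group_ring \<Rightarrow> complex)" where
  "q_aff D' y = (\<lambda>a\<in>pp_algebra (rho_pdiv D'). y (rho_hom a))"

definition q_chart ::
    "'d::finite pdiv set \<Rightarrow> 'd pdiv \<Rightarrow> (rat ^ ('d \<times> 'n::finite)) set
       \<Rightarrow> ('d group_ring \<Rightarrow> complex) \<Rightarrow> ('d \<times> 'n \<Rightarrow> complex)
       \<Rightarrow> (('d \<times> 'n) pdiv \<times> (('d \<times> 'n) group_ring \<Rightarrow> complex)) set" where
  "q_chart S D \<sigma> x e =
     fan_class (S_YC S) (rho_pdiv (pdiv_times D \<sigma>)) (q_aff (pdiv_times D \<sigma>) (pair_point D \<sigma> x e))"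

definition q_map ::
    "'d::finite pdiv set \<Rightarrow>
       ('d pdiv \<times> ('d group_ring \<Rightarrow> complex)) set \<times> ('d \<times> 'n::finite \<Rightarrow> complex)
       \<Rightarrow> (('d \<times> 'n) pdiv \<times> (('d \<times> 'n) group_ring \<Rightarrow> complex)) set" where
  "q_map S = (\<lambda>(c, e). THE y. \<exists>D\<in>S. \<exists>\<sigma>\<in>Sigma_E. \<exists>x\<in>points (X_aff D).
      c = fan_class S D x \<and> e \<in> toric_chart \<sigma> \<and> y = q_chart S D \<sigma> x e)"

definition diagonal_act ::
    "('d::finite \<Rightarrow> complex)
       \<Rightarrow> ('d pdiv \<times> ('d group_ring \<Rightarrow> complex)) set \<times> ('d \<times> 'n::finite \<Rightarrow> complex)
       \<Rightarrow> ('d pdiv \<times> ('d group_ring \<Rightarrow> complex)) set \<times> ('d \<times> 'n \<Rightarrow> complex)" where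
  "diagonal_act t = (\<lambda>(c, e). (fan_act t c, E_act t e))"

end

(*
  The projection E -> (P^(N-1))^d is a Zariski-locally trivial principal T-bundle, and over the
  chart of a cone of the fan of E the quotient map has a slice: normalise one invertible
  coordinate in each block to 1.  In terms of algebras, rho is injective on the support of L x
  Sigma_E, so the quotient fan is again closed under intersection, and its charts are
  X(D) x (slice).  Hence the affine quotient maps are surjective with T-orbits as fibres, and
  invariant functions and open sets descend by restriction to the slice.

  The global point is that the charts of X(S) embed.  Every chart contains the same generic
  points, so its algebra is reduced; along a face, an element of the bigger algebra is therefore a
  fraction of elements of the smaller one as an identity in the group ring.  Following such
  identities along a chain of overlaps shows that charts are injective and open and that
  coordinate functions of a chart are regular on X(S).  Overlaps of quotient charts lift to
  overlaps in X x E up to the action of T, which identifies the fibres of q.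
*)
theory Submission
  imports Defs
begin

section \<open>Spaces with functions\<close>

text \<open>The gluing relation is merely the equivalence relation generated by pairwise overlaps,
  so a chain through other charts might a priori identify two points of one chart. A function of one
  chart is in general not a function of the next, hence it cannot be compared directly along such a
  chain. An identity f = a * g in the common group ring can be, since it means the same in every
  chart; this is why equality of functions is upgraded to equality of group ring elements.

  The slice has its origin in the splitting of u \<circ> \<rho> into \<open>Jdual u\<close> on L and
  u on L_E. A functional that is nonnegative on \<sigma> has minimum 0 there, attained at the apex.
  Therefore the degree u part for \<rho>(D \<times> \<sigma>) is the degree \<open>Jdual u\<close>
  part for D as soon as u is nonnegative on the rays of \<sigma>. A section of \<open>Jdual\<close>
  then splits every such monomial into a function on X(D) times a monomial on the slice.

  Only attained minima of linear forms enter the algebras. The locale \<open>min_pdiv\<close>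
  isolates this property because it passes from D to \<rho>(D \<times> \<sigma>) at once, whereas
  projections of polyhedra would call for elimination arguments.\<close>

abbreviation "single \<equiv> Poly_Mapping.single"
abbreviation "lookup \<equiv> Poly_Mapping.lookup"
abbreviation "keys \<equiv> Poly_Mapping.keys"

abbreviation aff_points :: "'i::finite pdiv \<Rightarrow> ('i group_ring \<Rightarrow> complex) set" where
  "aff_points D \<equiv> alg_points (pp_algebra D)"

abbreviation proper_support :: "('d \<times> 'n) set \<Rightarrow> bool" where
  "proper_support F \<equiv> \<forall>j. \<exists>k. (j, k) \<notin> F"

text \<open>\<open>topology_generated_by\<close> starts from a subbasis. If the family already
  refines intersections of two members around each point, the finite intersections are absorbed and
  openness becomes a pointwise condition.\<close>

lemma openin_topology_generated_by_base:
  assumes base: "\<And>A B x. A \<in> \<B> \<Longrightarrow> B \<in> \<B> \<Longrightarrow> x \<in> A \<Longrightarrow> x \<in> B \<Longrightarrow> \<exists>C\<in>\<B>. x \<in> C \<and> C \<subseteq> A \<inter> B"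
  shows "openin (topology_generated_by \<B>) U \<longleftrightarrow> (\<forall>x\<in>U. \<exists>B\<in>\<B>. x \<in> B \<and> B \<subseteq> U)"
proof
  assume "openin (topology_generated_by \<B>) U"
  then have "generate_topology_on \<B> U"
    by (simp add: openin_topology_generated_by_iff)
  then show "\<forall>x\<in>U. \<exists>B\<in>\<B>. x \<in> B \<and> B \<subseteq> U"
  proof induction
    case (Int a b)
    show ?case
    proof
      fix x assume x: "x \<in> a \<inter> b"
      then obtain A where A: "A \<in> \<B>" "x \<in> A" "A \<subseteq> a" using Int by blast
      obtain B where B: "B \<in> \<B>" "x \<in> B" "B \<subseteq> b" using Int x by blast
      show "\<exists>B\<in>\<B>. x \<in> B \<and> B \<subseteq> a \<inter> b"
        using base[OF A(1) B(1) A(2) B(2)] A(3) B(3) by blast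
    qed
  next
    case (UN K)
    show ?case
    proof
      fix x assume "x \<in> \<Union>K"
      then obtain k where k: "k \<in> K" "x \<in> k" by blast
      obtain B where B: "B \<in> \<B>" "x \<in> B" "B \<subseteq> k" using bspec[OF UN.IH[OF k(1)] k(2)] by (elim bexE conjE)
      have "B \<subseteq> \<Union>K" using B(3) k(1) by auto
      with B show "\<exists>B\<in>\<B>. x \<in> B \<and> B \<subseteq> \<Union>K" by (intro bexI[of _ B] conjI)
    qed
  next
    case (Basis s)
    then show ?case by blast
  qed simp
next
  assume U: "\<forall>x\<in>U. \<exists>B\<in>\<B>. x \<in> B \<and> B \<subseteq> U"
  have "\<exists>T. openin (topology_generated_by \<B>) T \<and> x \<in> T \<and> T \<subseteq> U" if x: "x \<in> U" for x
  proof -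
    obtain B where "B \<in> \<B>" "x \<in> B" "B \<subseteq> U" using U x by blast
    then show ?thesis using topology_generated_by_Basis[of B \<B>] by metis
  qed
  then show "openin (topology_generated_by \<B>) U"
    using openin_subopen[of "topology_generated_by \<B>" U] by metis
qed

text \<open>Functions are total but only their values on P matter, so closure is required up to
  agreement on P. Evaluations at elements of an algebra satisfy no more than this: x (a + b) = x a +
  x b holds for points x, not for arbitrary functions x.\<close>

locale function_algebra =
  fixes P :: "'x set" and R :: "('x \<Rightarrow> complex) set"
  assumes const: "\<exists>f\<in>R. \<forall>x\<in>P. f x = c"
    and add: "f \<in> R \<Longrightarrow> g \<in> R \<Longrightarrow> \<exists>h\<in>R. \<forall>x\<in>P. h x = f x + g x"
    and mult: "f \<in> R \<Longrightarrow> g \<in> R \<Longrightarrow> \<exists>h\<in>R. \<forall>x\<in>P. h x = f x * g x"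
begin

abbreviation "X \<equiv> principal_space P R"

lemma openin_iff:
  "openin (zariski X) U \<longleftrightarrow>
     (\<forall>x\<in>U. x \<in> P \<and> (\<exists>f\<in>R. f x \<noteq> 0 \<and> (\<forall>y\<in>P. f y \<noteq> 0 \<longrightarrow> y \<in> U)))"
proof -
  have "openin (zariski X) U \<longleftrightarrow>
      (\<forall>x\<in>U. \<exists>B\<in>(\<lambda>f. {x \<in> P. f x \<noteq> 0}) ` R. x \<in> B \<and> B \<subseteq> U)"
    unfolding principal_space_def Let_def fspace.simps
  proof (rule openin_topology_generated_by_base)
    fix A B x
    assume "A \<in> (\<lambda>f. {x \<in> P. f x \<noteq> 0}) ` R" "B \<in> (\<lambda>f. {x \<in> P. f x \<noteq> 0}) ` R"
      and x: "x \<in> A" "x \<in> B"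
    then obtain f g where fg: "f \<in> R" "g \<in> R"
      and AB: "A = {x \<in> P. f x \<noteq> 0}" "B = {x \<in> P. g x \<noteq> 0}" by blast
    obtain h where "h \<in> R" "\<forall>x\<in>P. h x = f x * g x"
      using mult[OF fg] by blast
    with x show "\<exists>C\<in>(\<lambda>f. {x \<in> P. f x \<noteq> 0}) ` R. x \<in> C \<and> C \<subseteq> A \<inter> B"
      unfolding AB by (intro bexI[of _ "{x \<in> P. h x \<noteq> 0}"]) auto
  qed
  also have "\<dots> \<longleftrightarrow> (\<forall>x\<in>U. x \<in> P \<and> (\<exists>f\<in>R. f x \<noteq> 0 \<and> (\<forall>y\<in>P. f y \<noteq> 0 \<longrightarrow> y \<in> U)))"
    unfolding bex_simps subset_iff mem_Collect_eq by blast
  finally show ?thesis .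
qed

lemma points_eq: "points X = P"
proof
  show "points X \<subseteq> P"
    using openin_topspace[of "zariski X"] unfolding openin_iff by blast
  have "openin (zariski X) P"
    unfolding openin_iff
  proof
    fix x assume x: "x \<in> P"
    obtain f where f: "f \<in> R" "\<forall>x\<in>P. f x = 1" using const by metis
    show "x \<in> P \<and> (\<exists>f\<in>R. f x \<noteq> 0 \<and> (\<forall>y\<in>P. f y \<noteq> 0 \<longrightarrow> y \<in> P))"
      by (intro conjI bexI[OF _ f(1)]) (use x f in auto)
  qed
  then show "P \<subseteq> points X" by (rule openin_subset)
qed

text \<open>Neighbourhood and denominator are merged: multiplying numerator and denominator by a
  function whose nonvanishing locus lies inside the neighbourhood lets the denominator alone cut it
  out.\<close>

lemma reg_iff:
  "\<phi> \<in> reg X U \<longleftrightarrow>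
     (\<forall>x\<in>U. x \<in> P \<and> (\<exists>f\<in>R. \<exists>g\<in>R. g x \<noteq> 0 \<and> (\<forall>y\<in>P. g y \<noteq> 0 \<longrightarrow> y \<in> U \<and> \<phi> y = f y / g y)))"
  (is "?L \<longleftrightarrow> (\<forall>x\<in>U. ?Q x)")
proof
  assume L: ?L
  show "\<forall>x\<in>U. ?Q x"
  proof
    fix x assume "x \<in> U"
    with L obtain W f g where W: "openin (zariski X) W" "x \<in> W" "W \<subseteq> U"
      and fg: "f \<in> R" "g \<in> R" "\<forall>y\<in>W. g y \<noteq> 0 \<and> \<phi> y = f y / g y"
      unfolding principal_space_def Let_def by auto
    then obtain s where s: "x \<in> P" "s \<in> R" "s x \<noteq> 0" "\<forall>y\<in>P. s y \<noteq> 0 \<longrightarrow> y \<in> W"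
      unfolding openin_iff by blast
    obtain f' where f': "f' \<in> R" "\<forall>y\<in>P. f' y = f y * s y" using mult[OF fg(1) s(2)] by blast
    obtain g' where g': "g' \<in> R" "\<forall>y\<in>P. g' y = g y * s y" using mult[OF fg(2) s(2)] by blast
    have "g' x \<noteq> 0 \<and> (\<forall>y\<in>P. g' y \<noteq> 0 \<longrightarrow> y \<in> U \<and> \<phi> y = f' y / g' y)"
      using f' g' s fg W by auto
    then show "?Q x" using f'(1) g'(1) s(1) by blast
  qed
next
  assume R: "\<forall>x\<in>U. ?Q x"
  have "\<exists>W. openin (zariski X) W \<and> x \<in> W \<and> W \<subseteq> U \<and>
          (\<exists>f\<in>R. \<exists>g\<in>R. \<forall>y\<in>W. g y \<noteq> 0 \<and> \<phi> y = f y / g y)" if "x \<in> U" for x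
  proof -
    from bspec[OF R that] obtain f g where fg: "x \<in> P" "f \<in> R" "g \<in> R" "g x \<noteq> 0"
      "\<forall>y\<in>P. g y \<noteq> 0 \<longrightarrow> y \<in> U \<and> \<phi> y = f y / g y" by (elim conjE bexE)
    have "openin (zariski X) {y \<in> P. g y \<noteq> 0}"
      unfolding openin_iff using fg(3) by fast
    moreover have "\<forall>y\<in>{y \<in> P. g y \<noteq> 0}. g y \<noteq> 0 \<and> \<phi> y = f y / g y"
      using fg(5) by simp
    moreover have "{y \<in> P. g y \<noteq> 0} \<subseteq> U" using fg(5) by fast
    moreover have "x \<in> {y \<in> P. g y \<noteq> 0}" using fg(1,4) by simp
    ultimately show ?thesis
      by (intro exI[of _ "{y \<in> P. g y \<noteq> 0}"] conjI bexI[OF _ fg(2)] bexI[of _ g] fg(3))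
  qed
  then show ?L unfolding principal_space_def Let_def by simp
qed

lemma regE:
  assumes "\<phi> \<in> reg X U" "x \<in> U"
  obtains f g where "x \<in> P" "f \<in> R" "g \<in> R" "g x \<noteq> 0"
    "\<forall>y\<in>P. g y \<noteq> 0 \<longrightarrow> y \<in> U" "\<forall>y\<in>P. g y \<noteq> 0 \<longrightarrow> \<phi> y = f y / g y"
proof -
  from bspec[OF assms(1)[unfolded reg_iff] assms(2)] obtain f g where
    "x \<in> P" "f \<in> R" "g \<in> R" "g x \<noteq> 0" "\<forall>y\<in>P. g y \<noteq> 0 \<longrightarrow> y \<in> U \<and> \<phi> y = f y / g y"
    by (elim conjE bexE)
  then show ?thesis using that[of f g] by simp
qed

lemma regI:
  assumes "\<And>x. x \<in> U \<Longrightarrow> \<exists>f g. x \<in> P \<and> f \<in> R \<and> g \<in> R \<and> g x \<noteq> 0 \<and>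
     (\<forall>y\<in>P. g y \<noteq> 0 \<longrightarrow> y \<in> U \<and> \<phi> y = f y / g y)"
  shows "\<phi> \<in> reg X U"
  unfolding reg_iff
proof
  fix x assume "x \<in> U"
  from assms[OF this] obtain f g where "x \<in> P" "f \<in> R" "g \<in> R" "g x \<noteq> 0"
    "\<forall>y\<in>P. g y \<noteq> 0 \<longrightarrow> y \<in> U \<and> \<phi> y = f y / g y" by (elim exE conjE)
  then show "x \<in> P \<and> (\<exists>f\<in>R. \<exists>g\<in>R. g x \<noteq> 0 \<and> (\<forall>y\<in>P. g y \<noteq> 0 \<longrightarrow> y \<in> U \<and> \<phi> y = f y / g y))"
    by (intro conjI bexI[where x = f] bexI[where x = g]) 
qed

lemma openinE:
  assumes "openin (zariski X) U" "x \<in> U"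
  obtains s where "x \<in> P" "s \<in> R" "s x \<noteq> 0" "\<forall>y\<in>P. s y \<noteq> 0 \<longrightarrow> y \<in> U"
  using bspec[OF assms(1)[unfolded openin_iff] assms(2)] that by metis

lemma openin_nonvanishing: "s \<in> R \<Longrightarrow> openin (zariski X) {y \<in> P. s y \<noteq> 0}"
  unfolding openin_iff by fast

lemma reg_const:
  assumes U: "openin (zariski X) U"
  shows "(\<lambda>x. c) \<in> reg X U"
proof (rule regI)
  fix x assume "x \<in> U"
  from U \<open>x \<in> U\<close> obtain s where s: "x \<in> P" "s \<in> R" "s x \<noteq> 0" "\<forall>y\<in>P. s y \<noteq> 0 \<longrightarrow> y \<in> U"
    by (rule openinE)
  obtain k where k: "k \<in> R" "\<forall>x\<in>P. k x = c" using const by metis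
  obtain f where f: "f \<in> R" "\<forall>x\<in>P. f x = k x * s x" using mult[OF k(1) s(2)] by metis
  show "\<exists>f g. x \<in> P \<and> f \<in> R \<and> g \<in> R \<and> g x \<noteq> 0 \<and> (\<forall>y\<in>P. g y \<noteq> 0 \<longrightarrow> y \<in> U \<and> c = f y / g y)"
    by (rule exI[of _ f], rule exI[of _ s]) (use s k f in simp)
qed

lemma reg_add:
  assumes "\<phi> \<in> reg X U" "\<psi> \<in> reg X U"
  shows "(\<lambda>x. \<phi> x + \<psi> x) \<in> reg X U"
proof (rule regI)
  fix x assume x: "x \<in> U"
  from assms(1) x obtain f g where fg: "x \<in> P" "f \<in> R" "g \<in> R" "g x \<noteq> 0"
    "\<forall>y\<in>P. g y \<noteq> 0 \<longrightarrow> y \<in> U" "\<forall>y\<in>P. g y \<noteq> 0 \<longrightarrow> \<phi> y = f y / g y"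
    by (rule regE)
  from assms(2) x obtain f' g' where fg': "x \<in> P" "f' \<in> R" "g' \<in> R" "g' x \<noteq> 0"
    "\<forall>y\<in>P. g' y \<noteq> 0 \<longrightarrow> y \<in> U" "\<forall>y\<in>P. g' y \<noteq> 0 \<longrightarrow> \<psi> y = f' y / g' y"
    by (rule regE)
  obtain a where a: "a \<in> R" "\<forall>x\<in>P. a x = f x * g' x" using mult[OF fg(2) fg'(3)] by metis
  obtain b where b: "b \<in> R" "\<forall>x\<in>P. b x = f' x * g x" using mult[OF fg'(2) fg(3)] by metis
  obtain c where c: "c \<in> R" "\<forall>x\<in>P. c x = g x * g' x" using mult[OF fg(3) fg'(3)] by metis
  obtain d where d: "d \<in> R" "\<forall>x\<in>P. d x = a x + b x" using add[OF a(1) b(1)] by metis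
  have "y \<in> U \<and> \<phi> y + \<psi> y = d y / c y" if y: "y \<in> P" "c y \<noteq> 0" for y
  proof -
    have nz: "g y \<noteq> 0" "g' y \<noteq> 0" using c y by auto
    show ?thesis using fg(5)[rule_format, OF y(1) nz(1)] fg(6)[rule_format, OF y(1) nz(1)] fg'(6)[rule_format, OF y(1) nz(2)] nz a b c d y(1)
      by (simp add: add_frac_eq)
  qed
  then show "\<exists>f g. x \<in> P \<and> f \<in> R \<and> g \<in> R \<and> g x \<noteq> 0 \<and> (\<forall>y\<in>P. g y \<noteq> 0 \<longrightarrow> y \<in> U \<and> \<phi> y + \<psi> y = f y / g y)"
    by (intro exI[of _ d] exI[of _ c]) (use fg(1,4) fg'(4) c d in simp)
qed

lemma reg_mult:
  assumes "\<phi> \<in> reg X U" "\<psi> \<in> reg X U"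
  shows "(\<lambda>x. \<phi> x * \<psi> x) \<in> reg X U"
proof (rule regI)
  fix x assume x: "x \<in> U"
  from assms(1) x obtain f g where fg: "x \<in> P" "f \<in> R" "g \<in> R" "g x \<noteq> 0"
    "\<forall>y\<in>P. g y \<noteq> 0 \<longrightarrow> y \<in> U" "\<forall>y\<in>P. g y \<noteq> 0 \<longrightarrow> \<phi> y = f y / g y"
    by (rule regE)
  from assms(2) x obtain f' g' where fg': "x \<in> P" "f' \<in> R" "g' \<in> R" "g' x \<noteq> 0"
    "\<forall>y\<in>P. g' y \<noteq> 0 \<longrightarrow> y \<in> U" "\<forall>y\<in>P. g' y \<noteq> 0 \<longrightarrow> \<psi> y = f' y / g' y"
    by (rule regE)
  obtain a where a: "a \<in> R" "\<forall>x\<in>P. a x = f x * f' x" using mult[OF fg(2) fg'(2)] by metis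
  obtain c where c: "c \<in> R" "\<forall>x\<in>P. c x = g x * g' x" using mult[OF fg(3) fg'(3)] by metis
  have "y \<in> U \<and> \<phi> y * \<psi> y = a y / c y" if y: "y \<in> P" "c y \<noteq> 0" for y
  proof -
    have nz: "g y \<noteq> 0" "g' y \<noteq> 0" using c y by auto
    show ?thesis using fg(5)[rule_format, OF y(1) nz(1)] fg(6)[rule_format, OF y(1) nz(1)] fg'(6)[rule_format, OF y(1) nz(2)] nz a c y(1)
      by simp
  qed
  then show "\<exists>f g. x \<in> P \<and> f \<in> R \<and> g \<in> R \<and> g x \<noteq> 0 \<and> (\<forall>y\<in>P. g y \<noteq> 0 \<longrightarrow> y \<in> U \<and> \<phi> y * \<psi> y = f y / g y)"
    by (intro exI[of _ a] exI[of _ c]) (use fg(1,4) fg'(4) a c in simp)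
qed

lemma reg_sum:
  assumes "openin (zariski X) U" "finite I"
    and "\<And>i. i \<in> I \<Longrightarrow> \<phi> i \<in> reg X U"
  shows "(\<lambda>x. \<Sum>i\<in>I. \<phi> i x) \<in> reg X U"
  using assms(2,3)
  by (induction I rule: finite_induct) (simp_all add: reg_const[OF assms(1)] reg_add)

text \<open>Regular functions on the product are local quotients of tensors, and tensors pull back
  to regular functions rather than to members of R; this lemma turns quotients of regular functions
  into regular functions again.\<close>

lemma reg_divide_local:
  assumes "\<And>x. x \<in> S \<Longrightarrow> \<exists>U \<phi> \<psi>. x \<in> U \<and> U \<subseteq> S \<and>
      \<phi> \<in> reg X U \<and> \<psi> \<in> reg X U \<and>
      (\<forall>y\<in>U. \<psi> y \<noteq> 0 \<and> \<theta> y = \<phi> y / \<psi> y)"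
  shows "\<theta> \<in> reg X S"
proof (rule regI)
  fix x assume "x \<in> S"
  from assms[OF this] obtain U \<phi> \<psi> where x: "x \<in> U" "U \<subseteq> S"
    and reg: "\<phi> \<in> reg X U" "\<psi> \<in> reg X U"
    and quot: "\<forall>y\<in>U. \<psi> y \<noteq> 0 \<and> \<theta> y = \<phi> y / \<psi> y" by (elim exE conjE)
  from reg(1) x(1) obtain f g where fg: "x \<in> P" "f \<in> R" "g \<in> R" "g x \<noteq> 0"
    "\<forall>y\<in>P. g y \<noteq> 0 \<longrightarrow> y \<in> U" "\<forall>y\<in>P. g y \<noteq> 0 \<longrightarrow> \<phi> y = f y / g y"
    by (rule regE)
  from reg(2) x(1) obtain f' g' where fg': "x \<in> P" "f' \<in> R" "g' \<in> R" "g' x \<noteq> 0"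
    "\<forall>y\<in>P. g' y \<noteq> 0 \<longrightarrow> y \<in> U" "\<forall>y\<in>P. g' y \<noteq> 0 \<longrightarrow> \<psi> y = f' y / g' y"
    by (rule regE)
  obtain a where a: "a \<in> R" "\<forall>x\<in>P. a x = f x * g' x" using mult[OF fg(2) fg'(3)] by metis
  obtain b where b: "b \<in> R" "\<forall>x\<in>P. b x = g x * f' x" using mult[OF fg(3) fg'(2)] by metis
  \<comment> \<open>Clearing denominators gives f * g' over g * f'. The extra factor
    \<open>g'\<close> makes nonvanishing of the denominator force \<open>g'\<close> to be nonzero,
    so that the fraction for \<psi> is valid there.\<close>
  obtain c where c: "c \<in> R" "\<forall>x\<in>P. c x = b x * g' x" using mult[OF b(1) fg'(3)] by metis
  obtain d where d: "d \<in> R" "\<forall>x\<in>P. d x = a x * g' x" using mult[OF a(1) fg'(3)] by metis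
  have cx: "c x \<noteq> 0"
  proof -
    have "\<psi> x = f' x / g' x" "\<psi> x \<noteq> 0" using fg'(6)[rule_format, OF fg'(1,4)] x quot by auto
    then show ?thesis using b c fg(1,4) fg'(4) by simp
  qed
  have "y \<in> S \<and> \<theta> y = d y / c y" if y: "y \<in> P" "c y \<noteq> 0" for y
  proof -
    have nz: "g y \<noteq> 0" "f' y \<noteq> 0" "g' y \<noteq> 0" using b c y by auto
    have "y \<in> U" "\<phi> y = f y / g y" "\<psi> y = f' y / g' y"
      using fg(5)[rule_format, OF y(1) nz(1)] fg(6)[rule_format, OF y(1) nz(1)] fg'(6)[rule_format, OF y(1) nz(3)] by auto
    then have "y \<in> S" "\<theta> y = (f y / g y) / (f' y / g' y)" using quot x by auto
    moreover have "d y = f y * g' y * g' y" "c y = g y * f' y * g' y" using a b c d y(1) by auto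
    ultimately show ?thesis using nz by simp
  qed
  then show "\<exists>f g. x \<in> P \<and> f \<in> R \<and> g \<in> R \<and> g x \<noteq> 0 \<and> (\<forall>y\<in>P. g y \<noteq> 0 \<longrightarrow> y \<in> S \<and> \<theta> y = f y / g y)"
    using fg(1) cx c(1) d(1) by metis
qed

lemma reg_cong:
  assumes eq: "\<And>x. x \<in> U \<Longrightarrow> \<phi> x = \<psi> x" and reg: "\<phi> \<in> reg X U"
  shows "\<psi> \<in> reg X U"
proof (rule regI)
  fix x assume x: "x \<in> U"
  from reg x obtain f g where fg: "x \<in> P" "f \<in> R" "g \<in> R" "g x \<noteq> 0"
    "\<forall>y\<in>P. g y \<noteq> 0 \<longrightarrow> y \<in> U" "\<forall>y\<in>P. g y \<noteq> 0 \<longrightarrow> \<phi> y = f y / g y"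
    by (rule regE)
  have "y \<in> U \<and> \<psi> y = f y / g y" if y: "y \<in> P" "g y \<noteq> 0" for y
  proof -
    have "y \<in> U" using fg(5) y by blast
    moreover have "\<phi> y = f y / g y" using fg(6) y by blast
    ultimately show ?thesis using eq[of y] by simp
  qed
  with fg(1-4) show "\<exists>f g. x \<in> P \<and> f \<in> R \<and> g \<in> R \<and> g x \<noteq> 0 \<and> (\<forall>y\<in>P. g y \<noteq> 0 \<longrightarrow> y \<in> U \<and> \<psi> y = f y / g y)"
    by metis
qed

lemma reg_subset:
  assumes "openin (zariski X) V" "V \<subseteq> U" "\<phi> \<in> reg X U"
  shows "\<phi> \<in> reg X V"
proof (rule regI)
  fix x assume x: "x \<in> V"
  then have xU: "x \<in> U" using assms(2) by blast
  from assms(3) xU obtain f g where fg: "x \<in> P" "f \<in> R" "g \<in> R" "g x \<noteq> 0"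
    "\<forall>y\<in>P. g y \<noteq> 0 \<longrightarrow> y \<in> U" "\<forall>y\<in>P. g y \<noteq> 0 \<longrightarrow> \<phi> y = f y / g y"
    by (rule regE)
  from assms(1) x obtain s where s: "x \<in> P" "s \<in> R" "s x \<noteq> 0" "\<forall>y\<in>P. s y \<noteq> 0 \<longrightarrow> y \<in> V"
    by (rule openinE)
  obtain f' where f': "f' \<in> R" "\<forall>y\<in>P. f' y = f y * s y" using mult[OF fg(2) s(2)] by metis
  obtain g' where g': "g' \<in> R" "\<forall>y\<in>P. g' y = g y * s y" using mult[OF fg(3) s(2)] by metis
  show "\<exists>f g. x \<in> P \<and> f \<in> R \<and> g \<in> R \<and> g x \<noteq> 0 \<and> (\<forall>y\<in>P. g y \<noteq> 0 \<longrightarrow> y \<in> V \<and> \<phi> y = f y / g y)"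
    by (intro exI[of _ f'] exI[of _ g']) (use fg(1,4,6) s(3,4) f' g' in simp)
qed

text \<open>Continuity of a map between such spaces is checked on the generating algebra alone; the
  slice maps below are given exactly in this form.\<close>

lemma openin_pullback:
  assumes "function_algebra Q T" and s: "\<And>x. x \<in> P \<Longrightarrow> s x \<in> Q"
    and comp: "\<And>f. f \<in> T \<Longrightarrow> \<exists>h\<in>R. \<forall>x\<in>P. h x = f (s x)"
    and V: "openin (zariski (principal_space Q T)) V"
  shows "openin (zariski X) {x \<in> P. s x \<in> V}"
proof -
  interpret Q: function_algebra Q T by fact
  have "\<exists>f\<in>R. f x \<noteq> 0 \<and> (\<forall>y\<in>P. f y \<noteq> 0 \<longrightarrow> y \<in> {x \<in> P. s x \<in> V})" if x: "x \<in> P" "s x \<in> V" for x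
  proof -
    from V x(2) obtain f where f: "s x \<in> Q" "f \<in> T" "f (s x) \<noteq> 0" "\<forall>y\<in>Q. f y \<noteq> 0 \<longrightarrow> y \<in> V"
      by (rule Q.openinE)
    from comp[OF f(2)] obtain h where "h \<in> R" "\<forall>x\<in>P. h x = f (s x)" by metis
    with f s x show ?thesis by (intro bexI[of _ h]) auto
  qed
  then show ?thesis unfolding openin_iff by simp
qed

lemma reg_pullback:
  assumes "function_algebra Q T" and s: "\<And>x. x \<in> P \<Longrightarrow> s x \<in> Q"
    and comp: "\<And>f. f \<in> T \<Longrightarrow> \<exists>h\<in>R. \<forall>x\<in>P. h x = f (s x)"
    and V: "\<phi> \<in> reg (principal_space Q T) V"
  shows "(\<lambda>x. \<phi> (s x)) \<in> reg X {x \<in> P. s x \<in> V}"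
proof (rule regI)
  interpret Q: function_algebra Q T by fact
  fix x assume "x \<in> {x \<in> P. s x \<in> V}"
  then have x: "x \<in> P" "s x \<in> V" by auto
  from V x(2) obtain f g where f: "s x \<in> Q" "f \<in> T" "g \<in> T" "g (s x) \<noteq> 0"
    "\<forall>y\<in>Q. g y \<noteq> 0 \<longrightarrow> y \<in> V" "\<forall>y\<in>Q. g y \<noteq> 0 \<longrightarrow> \<phi> y = f y / g y"
    by (rule Q.regE)
  from comp[OF f(2)] obtain h where h: "h \<in> R" "\<forall>x\<in>P. h x = f (s x)" by metis
  from comp[OF f(3)] obtain k where k: "k \<in> R" "\<forall>x\<in>P. k x = g (s x)" by metis
  show "\<exists>f g. x \<in> P \<and> f \<in> R \<and> g \<in> R \<and> g x \<noteq> 0 \<and>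
      (\<forall>y\<in>P. g y \<noteq> 0 \<longrightarrow> y \<in> {x \<in> P. s x \<in> V} \<and> \<phi> (s y) = f y / g y)"
    by (intro exI[of _ h] exI[of _ k]) (use x f s h k in simp)
qed

lemma reg_of:
  assumes "f \<in> R" and U: "openin (zariski X) U"
  shows "f \<in> reg X U"
proof (rule regI)
  fix x assume "x \<in> U"
  from U \<open>x \<in> U\<close> obtain s where s: "x \<in> P" "s \<in> R" "s x \<noteq> 0" "\<forall>y\<in>P. s y \<noteq> 0 \<longrightarrow> y \<in> U"
    by (rule openinE)
  obtain h where "h \<in> R" "\<forall>x\<in>P. h x = f x * s x" using mult[OF assms(1) s(2)] by metis
  then show "\<exists>f' g. x \<in> P \<and> f' \<in> R \<and> g \<in> R \<and> g x \<noteq> 0 \<and> (\<forall>y\<in>P. g y \<noteq> 0 \<longrightarrow> y \<in> U \<and> f y = f' y / g y)"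
    using s by (intro exI[of _ h] exI[of _ s]) simp
qed

lemma reg_prod:
  assumes "openin (zariski X) U" "finite I"
    and "\<And>i. i \<in> I \<Longrightarrow> \<phi> i \<in> reg X U"
  shows "(\<lambda>x. \<Prod>i\<in>I. \<phi> i x) \<in> reg X U"
  using assms(2,3)
  by (induction I rule: finite_induct) (simp_all add: reg_const[OF assms(1)] reg_mult)

lemma openin_reg_nonvanishing:
  assumes "\<phi> \<in> reg X U"
  shows "openin (zariski X) {x \<in> U. \<phi> x \<noteq> 0}"
  unfolding openin_iff
proof
  fix x assume "x \<in> {x \<in> U. \<phi> x \<noteq> 0}"
  then have x: "x \<in> U" "\<phi> x \<noteq> 0" by auto
  from assms x(1) obtain f g where fg: "x \<in> P" "f \<in> R" "g \<in> R" "g x \<noteq> 0"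
    "\<forall>y\<in>P. g y \<noteq> 0 \<longrightarrow> y \<in> U" "\<forall>y\<in>P. g y \<noteq> 0 \<longrightarrow> \<phi> y = f y / g y" by (rule regE)
  obtain h where h: "h \<in> R" "\<forall>x\<in>P. h x = f x * g x" using mult[OF fg(2,3)] by metis
  show "x \<in> P \<and> (\<exists>f\<in>R. f x \<noteq> 0 \<and> (\<forall>y\<in>P. f y \<noteq> 0 \<longrightarrow> y \<in> {x \<in> U. \<phi> x \<noteq> 0}))"
    using fg x(2) h by (intro conjI bexI[OF _ h(1)]) auto
qed

lemma reg_inverse:
  assumes "\<phi> \<in> reg X U" "\<And>x. x \<in> U \<Longrightarrow> \<phi> x \<noteq> 0"
    and U: "openin (zariski X) U"
  shows "(\<lambda>x. inverse (\<phi> x)) \<in> reg X U"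
proof (rule reg_divide_local)
  fix x assume "x \<in> U"
  then show "\<exists>U' \<phi>' \<psi>. x \<in> U' \<and> U' \<subseteq> U \<and> \<phi>' \<in> reg X U' \<and>
      \<psi> \<in> reg X U' \<and> (\<forall>y\<in>U'. \<psi> y \<noteq> 0 \<and> inverse (\<phi> y) = \<phi>' y / \<psi> y)"
    using assms(1,2) reg_const[OF U, of 1]
    by (intro exI[of _ U] exI[of _ "\<lambda>x. 1"] exI[of _ \<phi>]) (simp add: inverse_eq_divide)
qed

end

lemma function_algebra_polyfun: "function_algebra P (polyfun I)"
  by unfold_locales (auto intro: polyfun.intros)

section \<open>Glued spaces and products\<close>

lemma istopology_glue:
  "istopology (\<lambda>U. U \<subseteq> (\<Union>j\<in>J. glue_class R j ` points (F j)) \<and>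
     (\<forall>j\<in>J. openin (zariski (F j)) {x \<in> points (F j). glue_class R j x \<in> U}))"
proof -
  have int: "{x \<in> points (F j). glue_class R j x \<in> U \<inter> V} =
     {x \<in> points (F j). glue_class R j x \<in> U} \<inter> {x \<in> points (F j). glue_class R j x \<in> V}" for j U V
    by blast
  have un: "{x \<in> points (F j). glue_class R j x \<in> \<Union>K} =
     (\<Union>U\<in>K. {x \<in> points (F j). glue_class R j x \<in> U})" for j K
    by blast
  show ?thesis
    unfolding istopology_def
  proof (intro conjI allI impI ballI)
    fix U V j
    assume "U \<subseteq> (\<Union>j\<in>J. glue_class R j ` points (F j)) \<and>
        (\<forall>j\<in>J. openin (zariski (F j)) {x \<in> points (F j). glue_class R j x \<in> U})"
      and "V \<subseteq> (\<Union>j\<in>J. glue_class R j ` points (F j)) \<and>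
        (\<forall>j\<in>J. openin (zariski (F j)) {x \<in> points (F j). glue_class R j x \<in> V})"
    then show "U \<inter> V \<subseteq> (\<Union>j\<in>J. glue_class R j ` points (F j))"
      and "j \<in> J \<Longrightarrow> openin (zariski (F j)) {x \<in> points (F j). glue_class R j x \<in> U \<inter> V}"
      unfolding int by (auto intro: openin_Int)
  next
    fix K j
    assume "\<forall>U\<in>K. U \<subseteq> (\<Union>j\<in>J. glue_class R j ` points (F j)) \<and>
        (\<forall>j\<in>J. openin (zariski (F j)) {x \<in> points (F j). glue_class R j x \<in> U})"
    then show "\<Union>K \<subseteq> (\<Union>j\<in>J. glue_class R j ` points (F j))"
      and "j \<in> J \<Longrightarrow> openin (zariski (F j)) {x \<in> points (F j). glue_class R j x \<in> \<Union>K}"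
      unfolding un by (simp add: Sup_least, intro openin_Union) auto
  qed
qed

lemma openin_glue:
  "openin (zariski (glue J F R)) U \<longleftrightarrow>
     U \<subseteq> (\<Union>j\<in>J. glue_class R j ` points (F j)) \<and>
     (\<forall>j\<in>J. openin (zariski (F j)) {x \<in> points (F j). glue_class R j x \<in> U})"
  unfolding glue_def fspace.simps topology_inverse'[OF istopology_glue] ..

lemma points_glue: "points (glue J F R) = (\<Union>j\<in>J. glue_class R j ` points (F j))"
proof
  show "points (glue J F R) \<subseteq> (\<Union>j\<in>J. glue_class R j ` points (F j))"
    using openin_topspace[of "zariski (glue J F R)"] unfolding openin_glue by blast
  have "{x \<in> points (F j). glue_class R j x \<in> (\<Union>j\<in>J. glue_class R j ` points (F j))} = points (F j)"
    if "j \<in> J" for j using that by blast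
  then have "openin (zariski (glue J F R)) (\<Union>j\<in>J. glue_class R j ` points (F j))"
    unfolding openin_glue by simp
  then show "(\<Union>j\<in>J. glue_class R j ` points (F j)) \<subseteq> points (glue J F R)"
    by (rule openin_subset)
qed

lemma reg_glue:
  "\<phi> \<in> reg (glue J F R) U \<longleftrightarrow>
     (\<forall>j\<in>J. \<phi> \<circ> glue_class R j \<in> reg (F j) {x \<in> points (F j). glue_class R j x \<in> U})"
  by (simp add: glue_def)

lemma glue_class_eqI:
  assumes "(a, b) \<in> (R \<union> R\<inverse>)\<^sup>*"
  shows "glue_class R (fst a) (snd a) = glue_class R (fst b) (snd b)"
proof -
  have "sym ((R \<union> R\<inverse>)\<^sup>*)" by (simp add: sym_Un_converse sym_rtrancl)
  then have "(b, a) \<in> (R \<union> R\<inverse>)\<^sup>*" using assms by (auto dest: symD)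
  then show ?thesis
    using assms unfolding glue_class_def by (auto dest: rtrancl_trans)
qed

lemma glue_class_eqD:
  assumes "glue_class R j x = glue_class R k y"
  shows "((j, x), (k, y)) \<in> (R \<union> R\<inverse>)\<^sup>*"
  using assms unfolding glue_class_def by blast

text \<open>The topology is generated by nonvanishing loci of tensors; the whole product is one of
  them because the tensor 1 \<otimes> 1 vanishes nowhere.\<close>

lemma points_fs_prod:
  assumes "(\<lambda>x. 1) \<in> reg X (points X)" "(\<lambda>y. 1) \<in> reg Y (points Y)"
  shows "points (fs_prod X Y) = points X \<times> points Y"
proof -
  have "(\<lambda>(x, y). 1) \<in> tensor_functions X Y (points X) (points Y)"
    unfolding tensor_functions_def using assms
    by (intro CollectI exI[of _ 1] exI[of _ "\<lambda>i x. 1"] exI[of _ "\<lambda>i y. 1"]) auto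
  then have "\<exists>U V h. points X \<times> points Y = {z \<in> U \<times> V. h z \<noteq> 0} \<and> openin (zariski X) U \<and>
      openin (zariski Y) V \<and> h \<in> tensor_functions X Y U V"
    by (intro exI[of _ "points X"] exI[of _ "points Y"] exI[of _ "\<lambda>(x, y). 1"]) auto
  then have "points X \<times> points Y \<subseteq> points (fs_prod X Y)"
    unfolding fs_prod_def Let_def fspace.simps topology_generated_by_topspace by blast
  moreover have "points (fs_prod X Y) \<subseteq> points X \<times> points Y"
    unfolding fs_prod_def Let_def fspace.simps topology_generated_by_topspace
    by (auto dest: openin_subset)
  ultimately show ?thesis by blast
qed

lemma openin_fs_prod_basis:
  assumes "openin (zariski X) U" "openin (zariski Y) V" "h \<in> tensor_functions X Y U V"
  shows "openin (zariski (fs_prod X Y)) {z \<in> U \<times> V. h z \<noteq> 0}"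
  unfolding fs_prod_def Let_def fspace.simps
  by (rule topology_generated_by_Basis) (use assms in blast)

lemma reg_fs_prod:
  "\<phi> \<in> reg (fs_prod X Y) S \<longleftrightarrow>
     (\<forall>z\<in>S. \<exists>W U V. openin (zariski (fs_prod X Y)) W \<and> z \<in> W \<and> W \<subseteq> S \<and> W \<subseteq> U \<times> V \<and>
        openin (zariski X) U \<and> openin (zariski Y) V \<and>
        (\<exists>h\<in>tensor_functions X Y U V. \<exists>k\<in>tensor_functions X Y U V.
           \<forall>w\<in>W. k w \<noteq> 0 \<and> \<phi> w = h w / k w))"
  unfolding fs_prod_def Let_def by simp

lemma tensor_functionsI:
  assumes "finite K" "\<And>i. i \<in> K \<Longrightarrow> f i \<in> reg X U" "\<And>i. i \<in> K \<Longrightarrow> g i \<in> reg Y V"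
  shows "(\<lambda>(x, y). \<Sum>i\<in>K. f i x * g i y) \<in> tensor_functions X Y U V"
proof -
  obtain b where b: "bij_betw b {..<card K} K"
    using assms(1) by (metis atLeast0LessThan ex_bij_betw_nat_finite)
  have eq: "(\<lambda>(x, y). \<Sum>i\<in>K. f i x * g i y) = (\<lambda>(x, y). \<Sum>i<card K. f (b i) x * g (b i) y)"
    by (subst sum.reindex_bij_betw[OF b, symmetric]) (rule refl)
  have "\<forall>i<card K. f (b i) \<in> reg X U \<and> g (b i) \<in> reg Y V"
    using assms(2,3) bij_betwE[OF b] by simp
  then show ?thesis
    unfolding eq tensor_functions_def
    by (intro CollectI exI[of _ "card K"] exI[of _ "\<lambda>i. f (b i)"] exI[of _ "\<lambda>i. g (b i)"] conjI refl)
qed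

section \<open>Polyhedra\<close>

lemma pairing_add_right: "pairing u (v + w) = pairing u v + pairing u w"
  by (simp add: pairing_def algebra_simps sum.distrib)

lemma pairing_add_left: "pairing (u + u') w = pairing u w + pairing u' w"
  by (simp add: pairing_def algebra_simps sum.distrib)

lemma pairing_scale_right: "pairing u (c *s v) = c * pairing u v"
  by (simp add: pairing_def sum_distrib_left algebra_simps)

lemma pairing_diff_right: "pairing u (v - w) = pairing u v - pairing u w"
  by (simp add: pairing_def algebra_simps sum_subtractf)

lemma pairing_zero [simp]: "pairing 0 v = 0" "pairing u 0 = 0"
  by (simp_all add: pairing_def)

text \<open>
  A point that is not yet optimal in the face cut out by its tight constraints can be pushed
  along that face until a further constraint becomes tight.
\<close>

lemma polyhedron_push:
  fixes F :: "((rat ^ 'i::finite) \<times> rat) set"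
  assumes F: "finite F" and v: "\<forall>(a, c)\<in>F. pairing a v \<ge> c"
    and w: "\<forall>(a, c)\<in>F. pairing a v = c \<longrightarrow> pairing a w = 0" "pairing u w < 0"
    and rec: "\<And>w. \<forall>(a, c)\<in>F. pairing a w \<ge> 0 \<Longrightarrow> pairing u w \<ge> 0"
  shows "\<exists>v'. (\<forall>(a, c)\<in>F. pairing a v' \<ge> c) \<and> pairing u v' \<le> pairing u v \<and>
      card {(a, c)\<in>F. pairing a v = c} < card {(a, c)\<in>F. pairing a v' = c}"
proof -
  let ?N = "{(a, c)\<in>F. pairing a w < 0}"
  let ?r = "\<lambda>(a, c). (pairing a v - c) / (- pairing a w)"
  have N: "finite ?N" using F by (rule finite_subset[rotated]) auto
  \<comment> \<open>Otherwise w would be a recession direction on which u is negative.\<close>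
  have "?N \<noteq> {}" using rec[of w] w(2) by (force simp: not_le)
  then have Min: "Min (?r ` ?N) \<in> ?r ` ?N" using N by (intro Min_in) auto
  \<comment> \<open>The largest step along w that violates no constraint.\<close>
  define s where "s = Min (?r ` ?N)"
  obtain a0 c0 where a0: "(a0, c0) \<in> F" "pairing a0 w < 0" "s = (pairing a0 v - c0) / (- pairing a0 w)"
    using Min unfolding s_def[symmetric] by auto
  have s_le: "s \<le> (pairing a v - c) / (- pairing a w)" if "(a, c) \<in> F" "pairing a w < 0" for a c
  proof -
    have "?r (a, c) \<in> ?r ` ?N" using that by (intro imageI) auto
    then have "s \<le> ?r (a, c)" unfolding s_def using N by (intro Min_le) auto
    then show ?thesis by simp
  qed
  have s0: "s \<ge> 0" using a0 v by (auto simp: divide_nonneg_neg intro!: divide_nonneg_pos)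
  define v' where "v' = v + s *s w"
  have pv': "pairing a v' = pairing a v + s * pairing a w" for a
    by (simp add: v'_def pairing_add_right pairing_scale_right)
  have feas: "pairing a v' \<ge> c" if "(a, c) \<in> F" for a c
  proof (cases "pairing a w < 0")
    case True
    then have "s * (- pairing a w) \<le> pairing a v - c"
      using s_le[OF that True] by (subst (asm) pos_le_divide_eq) auto
    then show ?thesis using pv' by simp
  next
    case False
    then have "s * pairing a w \<ge> 0" using s0 by simp
    then show ?thesis using v that pv'[of a] by force
  qed
  have tight0: "pairing a0 v' = c0" using a0 by (simp add: pv' field_simps)
  have "{(a, c)\<in>F. pairing a v = c} \<subset> {(a, c)\<in>F. pairing a v' = c}"
  proof
    show "{(a, c)\<in>F. pairing a v = c} \<subseteq> {(a, c)\<in>F. pairing a v' = c}"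
      using w(1) by (auto simp: pv')
    have "(a0, c0) \<notin> {(a, c)\<in>F. pairing a v = c}" using w(1) a0 by auto
    then show "{(a, c)\<in>F. pairing a v = c} \<noteq> {(a, c)\<in>F. pairing a v' = c}"
      using tight0 a0(1) by auto
  qed
  then have "card {(a, c)\<in>F. pairing a v = c} < card {(a, c)\<in>F. pairing a v' = c}"
    by (rule psubset_card_mono[rotated]) (rule finite_subset[OF _ F], auto)
  moreover have "pairing u v' \<le> pairing u v"
    using s0 w(2) by (simp add: pv' mult_nonneg_nonpos)
  ultimately show ?thesis using feas by (intro exI[of _ v']) auto
qed

text \<open>Each push makes a further constraint tight, so the pushes end after at most
  \<open>card F\<close> steps. The end point need not be a vertex: what is reached is a face along
  whose directions u is constant.\<close>

lemma polyhedron_reach_vertex: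
  fixes F :: "((rat ^ 'i::finite) \<times> rat) set"
  assumes F: "finite F"
    and rec: "\<And>w. \<forall>(a, c)\<in>F. pairing a w \<ge> 0 \<Longrightarrow> pairing u w \<ge> 0"
    and v: "\<forall>(a, c)\<in>F. pairing a v \<ge> c"
  shows "\<exists>v'. (\<forall>(a, c)\<in>F. pairing a v' \<ge> c) \<and> pairing u v' \<le> pairing u v \<and>
     (\<forall>w. (\<forall>(a, c)\<in>F. pairing a v' = c \<longrightarrow> pairing a w = 0) \<longrightarrow> pairing u w = 0)"
  using v
proof (induction "card F - card {(a, c)\<in>F. pairing a v = c}" arbitrary: v rule: less_induct)
  case less
  show ?case
  proof (cases "\<forall>w. (\<forall>(a, c)\<in>F. pairing a v = c \<longrightarrow> pairing a w = 0) \<longrightarrow> pairing u w = 0")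
    case True
    with less.prems show ?thesis by blast
  next
    case False
    then obtain w0 where w0: "\<forall>(a, c)\<in>F. pairing a v = c \<longrightarrow> pairing a w0 = 0" "pairing u w0 \<noteq> 0"
      by blast
    obtain w where w: "\<forall>(a, c)\<in>F. pairing a v = c \<longrightarrow> pairing a w = 0" "pairing u w < 0"
    proof (cases "pairing u w0 < 0")
      case True
      with w0(1) show ?thesis by (rule that)
    next
      case False
      have "\<forall>(a, c)\<in>F. pairing a v = c \<longrightarrow> pairing a ((-1) *s w0) = 0"
        unfolding pairing_scale_right using w0(1) by auto
      moreover have "pairing u ((-1) *s w0) < 0"
        unfolding pairing_scale_right using w0(2) False by simp
      ultimately show ?thesis by (rule that)
    qed
    from polyhedron_push[OF F less.prems w rec] obtain v' where
      v': "\<forall>(a, c)\<in>F. pairing a v' \<ge> c" "pairing u v' \<le> pairing u v"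
      "card {(a, c)\<in>F. pairing a v = c} < card {(a, c)\<in>F. pairing a v' = c}" by blast
    have "card {(a, c)\<in>F. pairing a v' = c} \<le> card F"
      by (rule card_mono[OF F]) auto
    then have "card F - card {(a, c)\<in>F. pairing a v' = c} < card F - card {(a, c)\<in>F. pairing a v = c}"
      using v'(3) by linarith
    from less.hyps[OF this v'(1)] obtain v'' where
      v'': "\<forall>(a, c)\<in>F. pairing a v'' \<ge> c" "pairing u v'' \<le> pairing u v'"
      "\<forall>w. (\<forall>(a, c)\<in>F. pairing a v'' = c \<longrightarrow> pairing a w = 0) \<longrightarrow> pairing u w = 0" by blast
    have "pairing u v'' \<le> pairing u v" using v''(2) v'(2) by linarith
    with v'' show ?thesis by blast
  qed
qed

lemma linear_form_attains_min:
  fixes F :: "((rat ^ 'i::finite) \<times> rat) set"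
  assumes F: "finite F"
    and rec: "\<And>w. \<forall>(a, c)\<in>F. pairing a w \<ge> 0 \<Longrightarrow> pairing u w \<ge> 0"
    and v0: "\<forall>(a, c)\<in>F. pairing a v0 \<ge> c"
  shows "\<exists>v. (\<forall>(a, c)\<in>F. pairing a v \<ge> c) \<and>
      (\<forall>v'. (\<forall>(a, c)\<in>F. pairing a v' \<ge> c) \<longrightarrow> pairing u v \<le> pairing u v')"
proof -
  define V where "V = {v. (\<forall>(a, c)\<in>F. pairing a v \<ge> c) \<and>
     (\<forall>w. (\<forall>(a, c)\<in>F. pairing a v = c \<longrightarrow> pairing a w = 0) \<longrightarrow> pairing u w = 0)}"
  define T where "T = (\<lambda>v. {(a, c)\<in>F. pairing a v = c})"
  \<comment> \<open>Two end points with the same tight constraints differ by a direction of their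
    common face, where u vanishes.\<close>
  have TV: "pairing u v = pairing u v'" if "v \<in> V" "v' \<in> V" "T v = T v'" for v v'
  proof -
    have "\<forall>(a, c)\<in>F. pairing a v = c \<longrightarrow> pairing a (v' - v) = 0"
      using that(3) unfolding T_def pairing_diff_right by (auto simp: set_eq_iff)
    then have "pairing u (v' - v) = 0" using that(1) unfolding V_def by blast
    then show ?thesis by (simp add: pairing_diff_right)
  qed
  have "finite (T ` V)" by (rule finite_subset[of _ "Pow F"]) (use F in \<open>auto simp: T_def\<close>)
  moreover have "pairing u ` V = (\<lambda>t. pairing u (SOME v. v \<in> V \<and> T v = t)) ` (T ` V)"
  proof -
    have "pairing u v = pairing u (SOME v'. v' \<in> V \<and> T v' = T v)" if "v \<in> V" for v
      using someI[of "\<lambda>v'. v' \<in> V \<and> T v' = T v" v] that by (intro TV) auto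
    then show ?thesis unfolding image_image by (intro image_cong) auto
  qed
  ultimately have fin: "finite (pairing u ` V)" by simp
  have ex: "\<exists>v'\<in>V. pairing u v' \<le> pairing u v" if "\<forall>(a, c)\<in>F. pairing a v \<ge> c" for v
    using polyhedron_reach_vertex[OF F rec that] unfolding V_def by blast
  then have "V \<noteq> {}" using v0 by blast
  then have "Min (pairing u ` V) \<in> pairing u ` V" using fin by (intro Min_in) auto
  then obtain v where v: "v \<in> V" "pairing u v = Min (pairing u ` V)" by auto
  have "pairing u v \<le> pairing u v'" if v': "\<forall>(a, c)\<in>F. pairing a v' \<ge> c" for v'
  proof -
    obtain v'' where "v'' \<in> V" "pairing u v'' \<le> pairing u v'" using ex[OF v'] by blast
    then show ?thesis using fin v(2) by (metis Min_le image_eqI order_trans)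
  qed
  with v(1) show ?thesis unfolding V_def by blast
qed

section \<open>The function field of the projective line\<close>

lemma const_fun_hom [simp]:
  "const_fun 0 = 0" "const_fun 1 = 1"
  "const_fun a + const_fun b = const_fun (a + b)"
  "const_fun a * const_fun b = const_fun (a * b)"
  by (simp_all add: const_fun_def flip: to_fract_add to_fract_mult one_pCons)

lemma const_fun_eq_0_iff [simp]: "const_fun c = 0 \<longleftrightarrow> c = 0"
  by (simp add: const_fun_def)

lemma poly_ord_at_mult:
  assumes "g \<noteq> 0" "h \<noteq> 0"
  shows "poly_ord_at p (g * h) = poly_ord_at p g + poly_ord_at p h"
  using assms by (cases p) (auto simp: order_mult degree_mult_eq)

lemma poly_ord_at_add:
  assumes "g \<noteq> 0" "h \<noteq> 0" "g + h \<noteq> 0"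
  shows "poly_ord_at p (g + h) \<ge> min (poly_ord_at p g) (poly_ord_at p h)"
proof (cases p)
  case (Fin a)
  let ?n = "min (order a g) (order a h)"
  have "[:-a, 1:] ^ ?n dvd g" "[:-a, 1:] ^ ?n dvd h"
    by (simp_all only: order_divides) simp_all
  then have "[:-a, 1:] ^ ?n dvd g + h" by (rule dvd_add)
  then have "?n \<le> order a (g + h)" using assms(3) by (simp only: order_divides) simp
  then show ?thesis by (simp add: Fin)
next
  case Infty
  then show ?thesis using degree_add_le_max[of g h] by simp
qed

lemma ord_at_Fract:
  assumes "g \<noteq> 0" "h \<noteq> 0"
  shows "ord_at p (Fract g h) = poly_ord_at p g - poly_ord_at p h"
  unfolding ord_at_def
proof (rule the_equality)
  show "\<exists>g' h'. g' \<noteq> 0 \<and> h' \<noteq> 0 \<and> Fract g h = Fract g' h' \<and>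
      poly_ord_at p g - poly_ord_at p h = poly_ord_at p g' - poly_ord_at p h'"
    using assms by blast
next
  fix n assume "\<exists>g' h'. g' \<noteq> 0 \<and> h' \<noteq> 0 \<and> Fract g h = Fract g' h' \<and>
      n = poly_ord_at p g' - poly_ord_at p h'"
  then obtain g' h' where gh: "g' \<noteq> 0" "h' \<noteq> 0" "Fract g h = Fract g' h'"
    and n: "n = poly_ord_at p g' - poly_ord_at p h'" by blast
  have "g * h' = g' * h" using gh assms by (simp add: eq_fract)
  then have "poly_ord_at p g + poly_ord_at p h' = poly_ord_at p g' + poly_ord_at p h"
    using assms gh by (metis poly_ord_at_mult)
  then show "n = poly_ord_at p g - poly_ord_at p h" using n by simp
qed

lemma fract_nonzeroE:
  assumes "f \<noteq> (0 :: ratfun)"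
  obtains g h where "f = Fract g h" "g \<noteq> 0" "h \<noteq> 0"
  using assms by (cases f rule: Fract_cases_nonzero) auto

lemma ord_at_mult:
  assumes "f \<noteq> 0" "f' \<noteq> 0"
  shows "ord_at p (f * f') = ord_at p f + ord_at p f'"
proof -
  obtain g h where f: "f = Fract g h" "g \<noteq> 0" "h \<noteq> 0" using assms(1) by (rule fract_nonzeroE)
  obtain g' h' where f': "f' = Fract g' h'" "g' \<noteq> 0" "h' \<noteq> 0" using assms(2) by (rule fract_nonzeroE)
  have "f * f' = Fract (g * g') (h * h')" by (simp add: f f')
  moreover have "ord_at p (Fract (g * g') (h * h')) = poly_ord_at p (g * g') - poly_ord_at p (h * h')"
    using f f' by (intro ord_at_Fract) auto
  ultimately show ?thesis using f f' by (simp add: ord_at_Fract poly_ord_at_mult)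
qed

lemma ord_at_add:
  assumes "f \<noteq> 0" "f' \<noteq> 0" "f + f' \<noteq> 0"
  shows "ord_at p (f + f') \<ge> min (ord_at p f) (ord_at p f')"
proof -
  obtain g h where f: "f = Fract g h" "g \<noteq> 0" "h \<noteq> 0" using assms(1) by (rule fract_nonzeroE)
  obtain g' h' where f': "f' = Fract g' h'" "g' \<noteq> 0" "h' \<noteq> 0" using assms(2) by (rule fract_nonzeroE)
  have sum: "f + f' = Fract (g * h' + g' * h) (h * h')" using f f' by simp
  have nz: "g * h' + g' * h \<noteq> 0" using assms(3) f f' sum by (auto simp: fract_collapse)
  have ord: "ord_at p (f + f') = poly_ord_at p (g * h' + g' * h) - poly_ord_at p (h * h')"
    unfolding sum using nz f f' by (intro ord_at_Fract) auto
  have "poly_ord_at p (g * h' + g' * h) \<ge> min (poly_ord_at p (g * h')) (poly_ord_at p (g' * h))"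
    using nz f f' by (intro poly_ord_at_add) auto
  then show ?thesis unfolding ord using f f' by (simp add: ord_at_Fract poly_ord_at_mult)
qed

lemma ord_at_const: "c \<noteq> 0 \<Longrightarrow> ord_at p (const_fun c) = 0"
proof -
  assume "c \<noteq> 0"
  then have "ord_at p (Fract [:c:] 1) = poly_ord_at p [:c:] - poly_ord_at p 1"
    by (intro ord_at_Fract) auto
  also have "\<dots> = 0" using \<open>c \<noteq> 0\<close> by (cases p) (auto simp: order_root order_0I)
  finally show ?thesis by (simp add: const_fun_def to_fract_def)
qed

lemma sections_add:
  assumes "f \<in> sections U E" "g \<in> sections U E"
  shows "f + g \<in> sections U E"
proof (cases "f = 0 \<or> g = 0 \<or> f + g = 0")
  case True
  then show ?thesis using assms by (auto simp: sections_def)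
next
  case False
  have "ord_at p (f + g) + \<lfloor>E p\<rfloor> \<ge> 0" if "p \<in> U" for p
  proof -
    have "ord_at p f + \<lfloor>E p\<rfloor> \<ge> 0" "ord_at p g + \<lfloor>E p\<rfloor> \<ge> 0"
      using assms False that by (auto simp: sections_def)
    then show ?thesis using ord_at_add[of f g p] False by linarith
  qed
  then show ?thesis by (simp add: sections_def)
qed

text \<open>Orders add under multiplication, while rounding down is superadditive, so the rounded
  bounds add up in the right direction.\<close>

lemma sections_mult:
  assumes "f \<in> sections U E" "g \<in> sections U E'" and "\<And>p. p \<in> U \<Longrightarrow> E p + E' p \<le> E'' p"
  shows "f * g \<in> sections U E''"
proof (cases "f = 0 \<or> g = 0")
  case True
  then show ?thesis by (auto simp: sections_def)
next
  case False
  have "ord_at p (f * g) + \<lfloor>E'' p\<rfloor> \<ge> 0" if "p \<in> U" for p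
  proof -
    have "ord_at p f + \<lfloor>E p\<rfloor> \<ge> 0" "ord_at p g + \<lfloor>E' p\<rfloor> \<ge> 0"
      using assms False that by (auto simp: sections_def)
    moreover have "\<lfloor>E p\<rfloor> + \<lfloor>E' p\<rfloor> \<le> \<lfloor>E'' p\<rfloor>"
      using le_floor_add[of "E p" "E' p"] floor_mono[OF assms(3)[OF that]] by linarith
    ultimately show ?thesis using ord_at_mult[of f g p] False by linarith
  qed
  then show ?thesis by (simp add: sections_def)
qed

lemma sections_mono:
  assumes "f \<in> sections U E" "U' \<subseteq> U" "\<And>p. p \<in> U' \<Longrightarrow> E p \<le> E' p"
  shows "f \<in> sections U' E'"
proof (cases "f = 0")
  case False
  have "ord_at p f + \<lfloor>E' p\<rfloor> \<ge> 0" if "p \<in> U'" for p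
  proof -
    have "ord_at p f + \<lfloor>E p\<rfloor> \<ge> 0" using assms(1,2) that False by (auto simp: sections_def)
    then show ?thesis using floor_mono[OF assms(3)[OF that]] by linarith
  qed
  then show ?thesis by (simp add: sections_def)
qed (simp add: sections_def)

lemma sections_const:
  assumes "\<And>p. p \<in> U \<Longrightarrow> E p \<ge> 0"
  shows "const_fun c \<in> sections U E"
  using assms by (cases "c = 0") (auto simp: sections_def ord_at_const)

lemma infinite_proj_line: "infinite (UNIV :: proj_line set)"
proof
  assume "finite (UNIV :: proj_line set)"
  then have "finite (range Fin)" by (rule finite_subset[rotated]) simp
  then have "finite (UNIV :: complex set)" by (rule finite_imageD) (auto simp: inj_on_def)
  then show False using infinite_UNIV_char_0 by blast
qed

text \<open>Evaluation at a finite point through any fraction whose denominator survives there. In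
  this form the homomorphism laws are those of fractions; these evaluations supply the generic
  points of the charts.\<close>

definition eval_frac :: "complex \<Rightarrow> ratfun \<Rightarrow> complex" where
  "eval_frac z f = (THE c. \<exists>g h. poly h z \<noteq> 0 \<and> f = Fract g h \<and> c = poly g z / poly h z)"

lemma eval_frac_Fract:
  assumes "poly h z \<noteq> 0"
  shows "eval_frac z (Fract g h) = poly g z / poly h z"
  unfolding eval_frac_def
proof (rule the_equality)
  show "\<exists>g' h'. poly h' z \<noteq> 0 \<and> Fract g h = Fract g' h' \<and> poly g z / poly h z = poly g' z / poly h' z"
    using assms by blast
next
  fix c assume "\<exists>g' h'. poly h' z \<noteq> 0 \<and> Fract g h = Fract g' h' \<and> c = poly g' z / poly h' z"
  then obtain g' h' where gh: "poly h' z \<noteq> 0" "Fract g h = Fract g' h'" "c = poly g' z / poly h' z"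
    by blast
  have "h \<noteq> 0" "h' \<noteq> 0" using assms gh by auto
  then have "g * h' = g' * h" using gh by (simp add: eq_fract)
  then have "poly g z * poly h' z = poly g' z * poly h z" by (metis poly_mult)
  then show "c = poly g z / poly h z" using gh(1,3) assms by (simp add: frac_eq_eq)
qed

text \<open>A common power of the linear factor at z is cancelled: without a pole, the denominator
  contains no more such factors than the numerator.\<close>

lemma regular_at_Fin:
  assumes "f = 0 \<or> ord_at (Fin z) f \<ge> 0"
  obtains g h where "f = Fract g h" "poly h z \<noteq> 0"
proof (cases "f = 0")
  case True
  show ?thesis by (rule that[of 0 1]) (auto simp: True fract_collapse)
next
  case False
  then obtain g h where f: "f = Fract g h" "g \<noteq> 0" "h \<noteq> 0" by (rule fract_nonzeroE)
  obtain g' where g': "g = [:-z, 1:] ^ order z g * g'" using order_decomp[OF f(2)] by blast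
  obtain h' where h': "h = [:-z, 1:] ^ order z h * h'" "\<not> [:-z, 1:] dvd h'"
    using order_decomp[OF f(3)] by blast
  have le: "order z h \<le> order z g" using assms False f by (simp add: ord_at_Fract)
  have h'nz: "h' \<noteq> 0" using h'(2) by auto
  have "f = Fract ([:-z, 1:] ^ (order z g - order z h) * g') h'"
  proof -
    have "g * h' = [:-z, 1:] ^ (order z g - order z h) * g' * h"
    proof -
      have "[:-z, 1:] ^ order z g = [:-z, 1:] ^ (order z g - order z h) * [:-z, 1:] ^ order z h"
        using le by (simp add: power_add[symmetric])
      then show ?thesis using g' h'(1) by (metis (no_types, lifting) mult.assoc mult.commute)
    qed
    then show ?thesis unfolding f(1) using f(3) h'nz by (simp add: eq_fract)
  qed
  moreover have "poly h' z \<noteq> 0" using h'(2) by (simp add: poly_eq_0_iff_dvd)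
  ultimately show ?thesis by (rule that)
qed

lemma eval_frac_add:
  assumes "f = 0 \<or> ord_at (Fin z) f \<ge> 0" "g = 0 \<or> ord_at (Fin z) g \<ge> 0"
  shows "eval_frac z (f + g) = eval_frac z f + eval_frac z g"
proof -
  obtain a b where f: "f = Fract a b" "poly b z \<noteq> 0" using assms(1) by (rule regular_at_Fin)
  obtain c d where g: "g = Fract c d" "poly d z \<noteq> 0" using assms(2) by (rule regular_at_Fin)
  have "b \<noteq> 0" "d \<noteq> 0" using f g by auto
  then have "f + g = Fract (a * d + c * b) (b * d)" using f g by simp
  moreover have "poly (b * d) z \<noteq> 0" using f g by simp
  ultimately show ?thesis using f g by (simp add: eval_frac_Fract add_frac_eq)
qed

lemma eval_frac_mult:
  assumes "f = 0 \<or> ord_at (Fin z) f \<ge> 0" "g = 0 \<or> ord_at (Fin z) g \<ge> 0"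
  shows "eval_frac z (f * g) = eval_frac z f * eval_frac z g"
proof -
  obtain a b where f: "f = Fract a b" "poly b z \<noteq> 0" using assms(1) by (rule regular_at_Fin)
  obtain c d where g: "g = Fract c d" "poly d z \<noteq> 0" using assms(2) by (rule regular_at_Fin)
  have "poly (b * d) z \<noteq> 0" using f g by simp
  then show ?thesis using f g by (simp add: eval_frac_Fract)
qed

lemma eval_frac_const: "eval_frac z (const_fun c) = c"
  using eval_frac_Fract[of 1 z "[:c:]"] by (simp add: const_fun_def to_fract_def)

section \<open>Characters\<close>

lemma character_torus_add:
  assumes "t \<in> torus"
  shows "character t (u + v) = character t u * character t v"
  using assms by (simp add: character_def torus_def power_int_add prod.distrib)

lemma character_zero [simp]: "character t 0 = 1"
  by (simp add: character_def)

lemma character_mult: "character (\<lambda>i. s i * t i) u = character s u * character t u"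
  by (simp add: character_def power_int_mult_distrib prod.distrib)

lemma character_nonzero: "t \<in> torus \<Longrightarrow> character t u \<noteq> 0"
  by (simp add: character_def torus_def)

lemma character_separates:
  fixes u v :: "int ^ 'i::finite"
  assumes "u \<noteq> v"
  shows "\<exists>t\<in>torus. character t u \<noteq> character t v"
proof -
  obtain i where i: "u $ i \<noteq> v $ i" using assms by (auto simp: vec_eq_iff)
  define t :: "'i \<Rightarrow> complex" where "t = (\<lambda>j. if j = i then 2 else 1)"
  have ch: "character t w = 2 powi (w $ i)" for w
  proof -
    have "character t w = (\<Prod>j\<in>UNIV. if j = i then 2 powi (w $ i) else 1)"
      unfolding character_def t_def by (intro prod.cong) auto
    then show ?thesis by simp
  qed
  \<comment> \<open>Absolute values reduce the comparison to strict monotonicity of the powers of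
    the real number 2; a root of unity in place of 2 would not separate all exponents.\<close>
  have "norm ((2::complex) powi (u $ i)) \<noteq> norm ((2::complex) powi (v $ i))"
    using i by (auto simp: norm_power_int neq_iff dest: power_int_strict_increasing[of _ _ 2])
  then have "(2::complex) powi (u $ i) \<noteq> 2 powi (v $ i)" by auto
  moreover have "t \<in> torus" by (simp add: torus_def t_def)
  ultimately show ?thesis by (intro bexI[of _ t]) (simp_all only: ch not_False_eq_True)
qed

text \<open>Dedekind's argument: translating a relation by s and subtracting
  \<open>character s v\<close> times the original relation removes the term v and multiplies every
  other coefficient by a difference of characters, which is nonzero at a chosen term for suitable
  s.\<close>

lemma characters_independent:
  fixes K :: "(int ^ 'i::finite) set"
  assumes "finite K" "\<And>t. t \<in> torus \<Longrightarrow> (\<Sum>u\<in>K. c u * character t u) = 0"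
  shows "\<forall>u\<in>K. c u = 0"
  using assms
proof (induction K arbitrary: c rule: finite_induct)
  case (insert v K)
  have "c u = 0" if u: "u \<in> K" for u
  proof -
    have "u \<noteq> v" using u insert.hyps by auto
    then obtain s where s: "s \<in> torus" "character s u \<noteq> character s v"
      using character_separates by blast
    have "(\<Sum>w\<in>K. (c w * (character s w - character s v)) * character t w) = 0" if t: "t \<in> torus" for t
    proof -
      have st: "(\<lambda>i. s i * t i) \<in> torus" using s t by (auto simp: torus_def)
      have "(\<Sum>w\<in>insert v K. c w * character (\<lambda>i. s i * t i) w) -
          character s v * (\<Sum>w\<in>insert v K. c w * character t w) = 0"
        using insert.prems[OF st] insert.prems[OF t] by simp
      then show ?thesis using insert.hyps
        by (simp add: character_mult algebra_simps sum_subtractf sum_distrib_left)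
    qed
    then have "\<forall>w\<in>K. c w * (character s w - character s v) = 0" by (rule insert.IH)
    then show ?thesis using s u by auto
  qed
  moreover have "c v = 0"
  proof -
    have one: "(\<lambda>i. 1) \<in> torus" by (simp add: torus_def)
    have "c v * character (\<lambda>i. 1) v = 0"
      using insert.prems[OF one] insert.hyps calculation by simp
    then show ?thesis using character_nonzero[OF one, of v] by simp
  qed
  ultimately show ?case by auto
qed simp

section \<open>Graded algebras and their points\<close>

lemma sum_single_keys: "(\<Sum>u\<in>keys a. single u (lookup a u)) = a"
proof (rule poly_mapping_eqI)
  fix k
  show "lookup (\<Sum>u\<in>keys a. single u (lookup a u)) k =
      lookup a k"
    by (cases "k \<in> keys a")
      (auto simp: lookup_sum lookup_single when_def in_keys_iff sum.delta)
qed

text \<open>\<open>L u\<close> collects the coefficients allowed in degree u. Negatives come from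
  \<open>mult\<close> with a constant.\<close>

locale graded_algebra =
  fixes L :: "int ^ 'i::finite \<Rightarrow> ratfun set"
  assumes zero: "0 \<in> L u"
    and add: "f \<in> L u \<Longrightarrow> g \<in> L u \<Longrightarrow> f + g \<in> L u"
    and mult: "f \<in> L u \<Longrightarrow> g \<in> L v \<Longrightarrow> f * g \<in> L (u + v)"
    and const: "const_fun c \<in> L 0"
begin

definition carrier :: "'i group_ring set" where
  "carrier = {a. \<forall>u. lookup a u \<in> L u}"

lemma single_in: "single u f \<in> carrier \<longleftrightarrow> f \<in> L u"
  by (auto simp: carrier_def lookup_single when_def zero)

lemma lookup_in: "a \<in> carrier \<Longrightarrow> lookup a u \<in> L u"
  by (simp add: carrier_def)

lemma zero_in: "0 \<in> carrier"
  by (simp add: carrier_def zero)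

lemma add_in: "a \<in> carrier \<Longrightarrow> b \<in> carrier \<Longrightarrow> a + b \<in> carrier"
  by (simp add: carrier_def lookup_add add)

lemma sum_in: "(\<And>i. i \<in> I \<Longrightarrow> a i \<in> carrier) \<Longrightarrow> (\<Sum>i\<in>I. a i) \<in> carrier"
  by (induction I rule: infinite_finite_induct) (auto intro: zero_in add_in)

lemma scale_in: "f \<in> L u \<Longrightarrow> const_fun c * f \<in> L u"
  using mult[OF const, of f u c] by simp

lemma mult_eq_sum:
  "a * b = (\<Sum>u\<in>keys a. \<Sum>v\<in>keys b.
     single (u + v) (lookup a u * lookup b v))"
  for a b :: "'i group_ring"
proof -
  have "a * b = (\<Sum>u\<in>keys a. single u (lookup a u)) *
      (\<Sum>v\<in>keys b. single v (lookup b v))"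
    by (simp add: sum_single_keys)
  then show ?thesis by (simp add: sum_product mult_single)
qed

lemma mult_in: "a \<in> carrier \<Longrightarrow> b \<in> carrier \<Longrightarrow> a * b \<in> carrier"
  unfolding mult_eq_sum by (intro sum_in) (simp add: single_in lookup_in mult)

lemma const_in: "single 0 (const_fun c) \<in> carrier"
  by (simp add: single_in const)

lemma point_add: "x \<in> alg_points carrier \<Longrightarrow> a \<in> carrier \<Longrightarrow> b \<in> carrier \<Longrightarrow> x (a + b) = x a + x b"
  by (simp add: alg_points_def)

lemma point_mult: "x \<in> alg_points carrier \<Longrightarrow> a \<in> carrier \<Longrightarrow> b \<in> carrier \<Longrightarrow> x (a * b) = x a * x b"
  by (simp add: alg_points_def)

lemma point_const: "x \<in> alg_points carrier \<Longrightarrow> x (single 0 (const_fun c)) = c"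
  by (simp add: alg_points_def)

lemma point_zero: "x \<in> alg_points carrier \<Longrightarrow> x 0 = 0"
  using point_const[of x 0] by simp

lemma point_one: "x \<in> alg_points carrier \<Longrightarrow> x 1 = 1"
  using point_const[of x 1] by simp

lemma one_in: "1 \<in> carrier"
  using const_in[of 1] by simp

lemma point_sum:
  assumes "x \<in> alg_points carrier" "\<And>i. i \<in> I \<Longrightarrow> a i \<in> carrier"
  shows "x (\<Sum>i\<in>I. a i) = (\<Sum>i\<in>I. x (a i))"
  using assms(2)
  by (induction I rule: infinite_finite_induct)
    (auto simp: point_zero[OF assms(1)] point_add[OF assms(1)] sum_in)

lemma point_eq_sum:
  assumes "x \<in> alg_points carrier" "a \<in> carrier"
  shows "x a = (\<Sum>u\<in>keys a. x (single u (lookup a u)))"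
proof -
  have "x a = x (\<Sum>u\<in>keys a. single u (lookup a u))"
    by (simp add: sum_single_keys)
  also have "\<dots> = (\<Sum>u\<in>keys a. x (single u (lookup a u)))"
    by (rule point_sum[OF assms(1)]) (simp add: single_in lookup_in[OF assms(2)])
  finally show ?thesis .
qed

lemma point_single_scale:
  assumes "x \<in> alg_points carrier" "f \<in> L u"
  shows "x (single u (const_fun c * f)) = c * x (single u f)"
proof -
  have "x (single 0 (const_fun c) * single u f) = c * x (single u f)"
    using point_mult[OF assms(1) const_in, of "single u f" c] assms
    by (simp add: single_in point_const)
  then show ?thesis by (simp add: mult_single)
qed

lemma point_eqI:
  assumes "x \<in> alg_points carrier" "y \<in> alg_points carrier"
    and "\<And>u f. f \<in> L u \<Longrightarrow> x (single u f) = y (single u f)"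
  shows "x = y"
proof (rule extensionalityI)
  show "x \<in> extensional carrier" "y \<in> extensional carrier" using assms(1,2) by (auto simp: alg_points_def)
  show "x a = y a" if "a \<in> carrier" for a
    using that assms by (simp add: point_eq_sum lookup_in)
qed

text \<open>A point of the spectrum is determined by its values on monomials. All points in this
  development are built from such values: generic points, images under the quotient map, torus
  translates and slices.\<close>

definition hom_ext :: "(int ^ 'i \<Rightarrow> ratfun \<Rightarrow> complex) \<Rightarrow> 'i group_ring \<Rightarrow> complex" where
  "hom_ext m = (\<lambda>a\<in>carrier. \<Sum>u\<in>keys a. m u (lookup a u))"

context
  fixes m
  assumes m_add: "\<And>u f g. f \<in> L u \<Longrightarrow> g \<in> L u \<Longrightarrow> m u (f + g) = m u f + m u g"
    and m_mult: "\<And>u v f g. f \<in> L u \<Longrightarrow> g \<in> L v \<Longrightarrow> m (u + v) (f * g) = m u f * m v g"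
    and m_const: "\<And>c. m 0 (const_fun c) = c"
begin

lemma m_zero: "m u 0 = 0"
  using m_add[of 0 u 0] by (simp add: zero)

lemma hom_ext_eq_sum:
  assumes "a \<in> carrier" "finite K" "keys a \<subseteq> K"
  shows "hom_ext m a = (\<Sum>u\<in>K. m u (lookup a u))"
  unfolding hom_ext_def using assms
  by (simp, intro sum.mono_neutral_left) (auto simp: in_keys_iff m_zero)

lemma hom_ext_single: "f \<in> L u \<Longrightarrow> hom_ext m (single u f) = m u f"
  by (subst hom_ext_eq_sum[of _ "{u}"]) (auto simp: single_in)

lemma hom_ext_add:
  assumes "a \<in> carrier" "b \<in> carrier"
  shows "hom_ext m (a + b) = hom_ext m a + hom_ext m b"
proof -
  let ?K = "keys a \<union> keys b"
  have "hom_ext m (a + b) = (\<Sum>u\<in>?K. m u (lookup (a + b) u))"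
    using assms by (intro hom_ext_eq_sum) (auto simp: add_in Poly_Mapping.keys_add)
  moreover have "hom_ext m a = (\<Sum>u\<in>?K. m u (lookup a u))"
    using assms by (intro hom_ext_eq_sum) auto
  moreover have "hom_ext m b = (\<Sum>u\<in>?K. m u (lookup b u))"
    using assms by (intro hom_ext_eq_sum) auto
  ultimately show ?thesis
    using assms by (simp add: lookup_add m_add lookup_in sum.distrib)
qed

lemma hom_ext_sum:
  assumes "\<And>i. i \<in> I \<Longrightarrow> a i \<in> carrier"
  shows "hom_ext m (\<Sum>i\<in>I. a i) = (\<Sum>i\<in>I. hom_ext m (a i))"
  using assms
proof (induction I rule: infinite_finite_induct)
  case empty
  then show ?case using hom_ext_single[of 0 0] by (simp add: zero m_zero)
next
  case (infinite A)
  then show ?case using hom_ext_single[of 0 0] by (simp add: zero m_zero)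
next
  case (insert i I)
  then show ?case by (simp add: hom_ext_add sum_in)
qed

lemma hom_ext_point: "hom_ext m \<in> alg_points carrier"
  unfolding alg_points_def
proof (intro CollectI conjI allI ballI)
  show "hom_ext m \<in> extensional carrier" by (simp add: hom_ext_def)
  show "hom_ext m (single 0 (const_fun c)) = c" for c
    by (simp add: hom_ext_single const m_const)
  fix a b assume ab: "a \<in> carrier" "b \<in> carrier"
  show "hom_ext m (a + b) = hom_ext m a + hom_ext m b" using ab by (rule hom_ext_add)
  have "hom_ext m (a * b) = (\<Sum>u\<in>keys a. \<Sum>v\<in>keys b.
      m u (lookup a u) * m v (lookup b v))"
    unfolding mult_eq_sum using ab
    by (simp add: hom_ext_sum sum_in single_in mult lookup_in hom_ext_single m_mult)
  also have "\<dots> = hom_ext m a * hom_ext m b"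
    using ab by (simp add: hom_ext_def sum_product)
  finally show "hom_ext m (a * b) = hom_ext m a * hom_ext m b" .
qed

end

sublocale points: function_algebra "alg_points carrier" "(\<lambda>a x. x a) ` carrier"
proof unfold_locales
  show "\<exists>f\<in>(\<lambda>a x. x a) ` carrier. \<forall>x\<in>alg_points carrier. f x = c" for c
    by (rule bexI[of _ "\<lambda>x. x (single 0 (const_fun c))"]) (auto simp: point_const const_in)
  fix f g :: "('i group_ring \<Rightarrow> complex) \<Rightarrow> complex"
  assume "f \<in> (\<lambda>a x. x a) ` carrier" "g \<in> (\<lambda>a x. x a) ` carrier"
  then obtain a b where ab: "a \<in> carrier" "b \<in> carrier" "f = (\<lambda>x. x a)" "g = (\<lambda>x. x b)" by blast
  show "\<exists>h\<in>(\<lambda>a x. x a) ` carrier. \<forall>x\<in>alg_points carrier. h x = f x + g x"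
    using add_in[OF ab(1,2)] point_add[OF _ ab(1,2)] ab(3,4) by auto
  show "\<exists>h\<in>(\<lambda>a x. x a) ` carrier. \<forall>x\<in>alg_points carrier. h x = f x * g x"
    using mult_in[OF ab(1,2)] point_mult[OF _ ab(1,2)] ab(3,4) by auto
qed

lemma points_Spec: "points (Spec carrier) = alg_points carrier"
  unfolding Spec_def by (rule points.points_eq)

lemma Spec_openinE:
  assumes "openin (zariski (Spec carrier)) U" "x \<in> U"
  obtains s where "x \<in> alg_points carrier" "s \<in> carrier" "x s \<noteq> 0" "\<forall>y\<in>alg_points carrier. y s \<noteq> 0 \<longrightarrow> y \<in> U"
proof -
  from points.openinE[OF assms[unfolded Spec_def]] obtain F where *: "x \<in> alg_points carrier"
    "F \<in> (\<lambda>a x. x a) ` carrier" "F x \<noteq> 0" "\<forall>y\<in>alg_points carrier. F y \<noteq> 0 \<longrightarrow> y \<in> U"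
    by metis
  from *(2) obtain f where "f \<in> carrier" "F = (\<lambda>x. x f)" by (rule imageE) simp
  then show ?thesis using * that[of f] by simp
qed

lemma Spec_regE:
  assumes "\<phi> \<in> reg (Spec carrier) U" "x \<in> U"
  obtains f g where "x \<in> alg_points carrier" "f \<in> carrier" "g \<in> carrier" "x g \<noteq> 0"
    "\<forall>y\<in>alg_points carrier. y g \<noteq> 0 \<longrightarrow> y \<in> U" "\<forall>y\<in>alg_points carrier. y g \<noteq> 0 \<longrightarrow> \<phi> y = y f / y g"
proof -
  from points.regE[OF assms[unfolded Spec_def]] obtain F G where *: "x \<in> alg_points carrier"
    "F \<in> (\<lambda>a x. x a) ` carrier" "G \<in> (\<lambda>a x. x a) ` carrier" "G x \<noteq> 0"
    "\<forall>y\<in>alg_points carrier. G y \<noteq> 0 \<longrightarrow> y \<in> U" "\<forall>y\<in>alg_points carrier. G y \<noteq> 0 \<longrightarrow> \<phi> y = F y / G y"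
    by metis
  from *(2) obtain f where "f \<in> carrier" "F = (\<lambda>x. x f)" by (rule imageE) simp
  moreover from *(3) obtain g where "g \<in> carrier" "G = (\<lambda>x. x g)" by (rule imageE) simp
  ultimately show ?thesis using * that[of f g] by simp
qed

lemma Spec_regI:
  assumes "\<And>x. x \<in> U \<Longrightarrow> \<exists>f g. x \<in> alg_points carrier \<and> f \<in> carrier \<and> g \<in> carrier \<and> x g \<noteq> 0 \<and>
     (\<forall>y\<in>alg_points carrier. y g \<noteq> 0 \<longrightarrow> y \<in> U \<and> \<phi> y = y f / y g)"
  shows "\<phi> \<in> reg (Spec carrier) U"
  unfolding Spec_def
proof (rule points.regI)
  fix x assume "x \<in> U"
  from assms[OF this] obtain f g where *: "x \<in> alg_points carrier" "f \<in> carrier" "g \<in> carrier" "x g \<noteq> 0"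
     "\<forall>y\<in>alg_points carrier. y g \<noteq> 0 \<longrightarrow> y \<in> U \<and> \<phi> y = y f / y g" by (elim exE conjE)
  then show "\<exists>f g. x \<in> alg_points carrier \<and> f \<in> (\<lambda>a x. x a) ` carrier \<and> g \<in> (\<lambda>a x. x a) ` carrier \<and>
     g x \<noteq> 0 \<and> (\<forall>y\<in>alg_points carrier. g y \<noteq> 0 \<longrightarrow> y \<in> U \<and> \<phi> y = f y / g y)"
    by (intro exI[of _ "\<lambda>x. x f"] exI[of _ "\<lambda>x. x g"]) simp
qed

lemma Spec_openin_nonvanishing:
  assumes "s \<in> carrier"
  shows "openin (zariski (Spec carrier)) {x \<in> alg_points carrier. x s \<noteq> 0}"
  unfolding Spec_def by (rule points.openin_nonvanishing) (use assms in blast)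

text \<open>Being regular on a set includes a cover of that set by open sets inside it, so the
  domain is open automatically. Openness of the charts of a glued space is obtained in this
  way.\<close>

lemma Spec_openin_reg:
  assumes "\<phi> \<in> reg (Spec carrier) U"
  shows "openin (zariski (Spec carrier)) U"
proof -
  have "\<exists>T. openin (zariski (Spec carrier)) T \<and> x \<in> T \<and> T \<subseteq> U" if x: "x \<in> U" for x
  proof -
    from assms x obtain f g where fg: "x \<in> alg_points carrier" "f \<in> carrier" "g \<in> carrier" "x g \<noteq> 0"
      "\<forall>y\<in>alg_points carrier. y g \<noteq> 0 \<longrightarrow> y \<in> U" "\<forall>y\<in>alg_points carrier. y g \<noteq> 0 \<longrightarrow> \<phi> y = y f / y g"
      by (rule Spec_regE)
    have "openin (zariski (Spec carrier)) {x \<in> alg_points carrier. x g \<noteq> 0}"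
      by (rule Spec_openin_nonvanishing[OF fg(3)])
    then show ?thesis using fg(1,4,5) by (intro exI[of _ "{x \<in> alg_points carrier. x g \<noteq> 0}"]) auto
  qed
  then show ?thesis by (subst openin_subopen) fast
qed

end

section \<open>Algebras of polyhedral divisors\<close>

lemma rat_vec_add: "rat_vec (u + v) = rat_vec u + rat_vec v"
  by (simp add: rat_vec_def vec_eq_iff)

lemma rat_vec_0 [simp]: "rat_vec 0 = 0"
  by (simp add: rat_vec_def vec_eq_iff)

text \<open>Two values that are each taken at all but finitely many points are both taken at a
  common point, because the projective line is infinite.\<close>

lemma tail_eqI:
  assumes "finite {p. D p \<noteq> \<delta>}"
  shows "tail D = \<delta>"
  unfolding tail_def
proof (rule the_equality)
  show "finite {p. D p \<noteq> \<delta>}" by fact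
  fix \<epsilon> assume "finite {p. D p \<noteq> \<epsilon>}"
  then have "finite ({p. D p \<noteq> \<delta>} \<union> {p. D p \<noteq> \<epsilon>})" using assms by simp
  then obtain p where "p \<notin> {p. D p \<noteq> \<delta>} \<union> {p. D p \<noteq> \<epsilon>}"
    using infinite_proj_line by (metis ex_new_if_finite)
  then show "\<epsilon> = \<delta>" by simp
qed

text \<open>The clause f = 0 makes the piece zero in degrees outside the dual cone. Membership in
  the algebra thereby becomes a condition on every degree rather than on the support alone.\<close>

definition piece :: "'i::finite pdiv \<Rightarrow> int ^ 'i \<Rightarrow> ratfun set" where
  "piece D u = {f. f = 0 \<or> (rat_vec u \<in> dual_cone (tail D) \<and>
     f \<in> sections (Loc D) (pdiv_eval D (rat_vec u)))}"

lemma pdiv_eval_eq: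
  assumes "v \<in> D p" "\<forall>w\<in>D p. pairing u v \<le> pairing u w"
  shows "pdiv_eval D u p = pairing u v"
  unfolding pdiv_eval_def using assms by (intro Least_equality) auto

text \<open>The part of the definition of a polyhedral divisor that governs its algebra, in a form
  inherited by the images under \<rho>.\<close>

locale min_pdiv =
  fixes D :: "'i::finite pdiv"
  assumes finite_special: "finite {p. D p \<noteq> tail D}"
    and zero_tail: "0 \<in> tail D"
    and attains: "u \<in> dual_cone (tail D) \<Longrightarrow> D p \<noteq> {} \<Longrightarrow> \<exists>v\<in>D p. \<forall>w\<in>D p. pairing u v \<le> pairing u w"
begin

lemma pdiv_eval_attained:
  assumes "u \<in> dual_cone (tail D)" "p \<in> Loc D"
  obtains v where "v \<in> D p" "pdiv_eval D u p = pairing u v"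
  using attains[OF assms(1), of p] assms(2) pdiv_eval_eq[of _ D p u] by (auto simp: Loc_def)

lemma pdiv_eval_le:
  assumes "u \<in> dual_cone (tail D)" "w \<in> D p"
  shows "pdiv_eval D u p \<le> pairing u w"
proof -
  obtain v where "v \<in> D p" "\<forall>w\<in>D p. pairing u v \<le> pairing u w"
    using attains[OF assms(1), of p] assms(2) by blast
  then show ?thesis using pdiv_eval_eq[of v D p u] assms(2) by simp
qed

text \<open>A minimiser for u + v bounds the minima for u and for v at the same time.\<close>

lemma pdiv_eval_superadditive:
  assumes "u \<in> dual_cone (tail D)" "v \<in> dual_cone (tail D)" "u + v \<in> dual_cone (tail D)" "p \<in> Loc D"
  shows "pdiv_eval D u p + pdiv_eval D v p \<le> pdiv_eval D (u + v) p"
proof -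
  obtain w where w: "w \<in> D p" "pdiv_eval D (u + v) p = pairing (u + v) w"
    using assms(3,4) by (rule pdiv_eval_attained)
  then show ?thesis
    using pdiv_eval_le[OF assms(1) w(1)] pdiv_eval_le[OF assms(2) w(1)]
    by (simp add: pairing_add_left)
qed

lemma graded_algebra_piece: "graded_algebra (piece D)"
proof
  show "0 \<in> piece D u" for u by (simp add: piece_def)
  show "f + g \<in> piece D u" if "f \<in> piece D u" "g \<in> piece D u" for f g u
    using that sections_add[of f "Loc D" _ g] by (auto simp: piece_def)
  show "f * g \<in> piece D (u + v)" if f: "f \<in> piece D u" and g: "g \<in> piece D v" for f g u v
  proof (cases "f = 0 \<or> g = 0")
    case True
    then show ?thesis by (auto simp: piece_def)
  next
    case False
    then have u: "rat_vec u \<in> dual_cone (tail D)" and v: "rat_vec v \<in> dual_cone (tail D)"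
      and s: "f \<in> sections (Loc D) (pdiv_eval D (rat_vec u))" "g \<in> sections (Loc D) (pdiv_eval D (rat_vec v))"
      using f g by (auto simp: piece_def)
    have uv: "rat_vec (u + v) \<in> dual_cone (tail D)"
      using u v by (simp add: dual_cone_def rat_vec_add pairing_add_left)
    have "f * g \<in> sections (Loc D) (pdiv_eval D (rat_vec (u + v)))"
      using s by (rule sections_mult) (use pdiv_eval_superadditive u v uv in \<open>simp add: rat_vec_add\<close>)
    then show ?thesis using uv by (simp add: piece_def)
  qed
  show "const_fun c \<in> piece D 0" for c
  proof -
    have z: "0 \<in> dual_cone (tail D)" by (simp add: dual_cone_def)
    have "pdiv_eval D 0 p \<ge> 0" if "p \<in> Loc D" for p
      using pdiv_eval_attained[OF z that] by (metis order_refl pairing_zero(1))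
    then have "const_fun c \<in> sections (Loc D) (pdiv_eval D 0)" by (rule sections_const)
    then show ?thesis using z by (simp add: piece_def)
  qed
qed

lemma pp_algebra_eq: "graded_algebra.carrier (piece D) = pp_algebra D"
proof -
  interpret graded_algebra "piece D" by (rule graded_algebra_piece)
  show ?thesis
    unfolding carrier_def pp_algebra_def piece_def by (auto simp: in_keys_iff)
qed

sublocale graded_algebra "piece D"
  rewrites "graded_algebra.carrier (piece D) = pp_algebra D"
    and "Spec (pp_algebra D) = X_aff D"
    and "principal_space (aff_points D) ((\<lambda>a x. x a) ` pp_algebra D) = X_aff D"
  by (rule graded_algebra_piece) (simp_all add: pp_algebra_eq X_aff_def Spec_def)

text \<open>Where the coefficient is the tail cone, the origin belongs to it and bounds the minimum
  by 0, which leaves no room for a pole.\<close>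

lemma generic_section_regular:
  assumes "D p = tail D" "f \<in> piece D u"
  shows "f = 0 \<or> ord_at p f \<ge> 0"
proof (cases "f = 0")
  case False
  then have u: "rat_vec u \<in> dual_cone (tail D)" and f: "f \<in> sections (Loc D) (pdiv_eval D (rat_vec u))"
    using assms(2) by (auto simp: piece_def)
  have "pdiv_eval D (rat_vec u) p \<le> 0"
    using pdiv_eval_le[OF u, of 0 p] zero_tail assms(1) by simp
  moreover have "p \<in> Loc D" using zero_tail assms(1) by (auto simp: Loc_def)
  moreover have "ord_at p f + \<lfloor>pdiv_eval D (rat_vec u) p\<rfloor> \<ge> 0"
    using f False \<open>p \<in> Loc D\<close> by (simp add: sections_def)
  moreover have "\<lfloor>pdiv_eval D (rat_vec u) p\<rfloor> \<le> 0"
    using floor_mono[OF \<open>pdiv_eval D (rat_vec u) p \<le> 0\<close>] by simp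
  ultimately show ?thesis by linarith
qed simp

text \<open>Over a general z in the affine line, evaluating coefficients at z and monomials at t
  gives a point for every t in the torus. Vanishing at all of them is a linear relation between
  characters, so each coefficient of b has value 0 at z; but z is chosen after b, with one nonzero
  coefficient not vanishing there.\<close>

lemma reduced:
  assumes b: "b \<in> pp_algebra D" and vanish: "\<And>x. x \<in> aff_points D \<Longrightarrow> x b = 0"
  shows "b = 0"
proof (rule ccontr)
  assume "b \<noteq> 0"
  then obtain u where u: "u \<in> keys b" by (metis ex_in_conv keys_eq_empty)
  then have "lookup b u \<noteq> 0" by (simp add: in_keys_iff)
  then obtain g h where gh: "lookup b u = Fract g h" "g \<noteq> 0" "h \<noteq> 0"
    by (rule fract_nonzeroE)
  \<comment> \<open>The point z has to avoid the special coefficients of D, so that all sections are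
    regular at z, and the roots of g and h, so that the value g / h is defined and nonzero.\<close>
  have "finite (Fin -` {p. D p \<noteq> tail D})"
    by (rule finite_vimageI[OF finite_special]) (simp add: inj_def)
  then have "finite (Fin -` {p. D p \<noteq> tail D} \<union> {z. poly g z = 0} \<union> {z. poly h z = 0})"
    using gh by (simp add: poly_roots_finite)
  then obtain z where z: "z \<notin> Fin -` {p. D p \<noteq> tail D} \<union> {z. poly g z = 0} \<union> {z. poly h z = 0}"
    using infinite_UNIV_char_0 by (metis ex_new_if_finite)
  then have Dz: "D (Fin z) = tail D" by simp
  note regular = generic_section_regular[OF Dz]
  have "(\<Sum>u\<in>keys b. eval_frac z (lookup b u) * character t u) = 0"
    if t: "t \<in> torus" for t
  proof -
    define m where "m = (\<lambda>u f. eval_frac z f * character t u)"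
    have "hom_ext m \<in> aff_points D"
    proof (rule hom_ext_point)
      show "m u (f + g) = m u f + m u g" if "f \<in> piece D u" "g \<in> piece D u" for u f g
        using that regular by (simp add: m_def eval_frac_add algebra_simps)
      show "m (u + v) (f * g) = m u f * m v g" if "f \<in> piece D u" "g \<in> piece D v" for u v f g
        using that regular by (simp add: m_def eval_frac_mult character_torus_add[OF t])
      show "m 0 (const_fun c) = c" for c by (simp add: m_def eval_frac_const)
    qed
    then have "hom_ext m b = 0" by (rule vanish)
    then show ?thesis using b by (simp add: hom_ext_def m_def)
  qed
  then have "eval_frac z (lookup b u) = 0"
    using characters_independent[of "keys b" "\<lambda>u. eval_frac z (lookup b u)"] u
    by simp
  then show False using z gh by (simp add: eval_frac_Fract)
qed

end

lemma min_pdivI: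
  assumes "polyhedral_divisor D"
  shows "min_pdiv D"
proof -
  obtain \<delta> where \<delta>: "pointed_cone \<delta>" "finite {p. D p \<noteq> \<delta>}"
    "\<forall>p. D p = {} \<or> (polyhedron_rat (D p) \<and> tail_cone (D p) = \<delta>)"
    using assms unfolding polyhedral_divisor_def by blast
  have tail: "tail D = \<delta>" using \<delta>(2) by (rule tail_eqI)
  show ?thesis
  proof
    show "finite {p. D p \<noteq> tail D}" using \<delta>(2) tail by simp
    show "0 \<in> tail D" using \<delta>(1) by (auto simp: tail pointed_cone_def dual_cone_def)
  next
    fix u p assume u: "u \<in> dual_cone (tail D)" and p: "D p \<noteq> {}"
    have "polyhedron_rat (D p)" using \<delta>(3) p by blast
    then obtain F where F: "finite F" "D p = {v. \<forall>(a, c)\<in>F. pairing a v \<ge> c}"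
      unfolding polyhedron_rat_def by (elim exE conjE)
    obtain v0 where v0: "v0 \<in> D p" using p by blast
    \<comment> \<open>A direction on which all defining functionals are nonnegative preserves the
      polyhedron, hence lies in the tail cone, where u is nonnegative.\<close>
    have "pairing u w \<ge> 0" if w: "\<forall>(a, c)\<in>F. pairing a w \<ge> 0" for w
    proof -
      have "w + v \<in> D p" if "v \<in> D p" for v
        using w that unfolding F(2) by (fastforce simp: pairing_add_right)
      then have "w \<in> tail_cone (D p)" by (auto simp: tail_cone_def)
      then have "w \<in> tail D" using \<delta>(3) p tail by auto
      then show ?thesis using u by (simp add: dual_cone_def)
    qed
    then have "\<exists>v. (\<forall>(a, c)\<in>F. pairing a v \<ge> c) \<and>
        (\<forall>v'. (\<forall>(a, c)\<in>F. pairing a v' \<ge> c) \<longrightarrow> pairing u v \<le> pairing u v')"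
      using v0 F by (intro linear_form_attains_min[of F u v0]) auto
    then show "\<exists>v\<in>D p. \<forall>w\<in>D p. pairing u v \<le> pairing u w" unfolding F(2) by blast
  qed
qed

text \<open>A smaller polyhedron has a larger minimum, so more poles are allowed. The inclusion of
  the tail cones is read off at a point where both coefficients are generic.\<close>

lemma piece_antimono:
  assumes "min_pdiv D" "min_pdiv E" and sub: "\<And>p. E p \<subseteq> D p"
  shows "piece D u \<subseteq> piece E u"
proof
  interpret D: min_pdiv D by fact
  interpret E: min_pdiv E by fact
  fix f assume f: "f \<in> piece D u"
  have "finite ({p. D p \<noteq> tail D} \<union> {p. E p \<noteq> tail E})"
    using D.finite_special E.finite_special by simp
  then obtain p where "p \<notin> {p. D p \<noteq> tail D} \<union> {p. E p \<noteq> tail E}"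
    using infinite_proj_line by (metis ex_new_if_finite)
  then have "tail E \<subseteq> tail D" using sub[of p] by simp
  then have dual: "dual_cone (tail D) \<subseteq> dual_cone (tail E)" by (auto simp: dual_cone_def)
  show "f \<in> piece E u"
  proof (cases "f = 0")
    case False
    then have u: "rat_vec u \<in> dual_cone (tail D)"
      and s: "f \<in> sections (Loc D) (pdiv_eval D (rat_vec u))" using f by (auto simp: piece_def)
    have uE: "rat_vec u \<in> dual_cone (tail E)" using u dual by blast
    have "f \<in> sections (Loc E) (pdiv_eval E (rat_vec u))"
    proof (rule sections_mono[OF s])
      show "Loc E \<subseteq> Loc D" using sub by (auto simp: Loc_def)
      fix p assume "p \<in> Loc E"
      with uE obtain v where v: "v \<in> E p" "pdiv_eval E (rat_vec u) p = pairing (rat_vec u) v"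
        by (rule E.pdiv_eval_attained)
      then show "pdiv_eval D (rat_vec u) p \<le> pdiv_eval E (rat_vec u) p"
        using D.pdiv_eval_le[OF u, of v p] sub[of p] by auto
    qed
    then show ?thesis using uE by (simp add: piece_def)
  qed (simp add: piece_def)
qed

lemma pp_algebra_antimono:
  assumes "min_pdiv D" "min_pdiv E" and sub: "\<And>p. E p \<subseteq> D p"
  shows "pp_algebra D \<subseteq> pp_algebra E"
proof
  interpret D: min_pdiv D by fact
  interpret E: min_pdiv E by fact
  fix a assume "a \<in> pp_algebra D"
  then show "a \<in> pp_algebra E"
    using piece_antimono[OF assms] unfolding D.carrier_def E.carrier_def by blast
qed

lemma pp_map_apply: "a \<in> pp_algebra D \<Longrightarrow> pp_map D z a = z a"
  by (simp add: pp_map_def)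

lemma pp_map_point:
  assumes "min_pdiv D" "min_pdiv E" "\<And>p. E p \<subseteq> D p" "z \<in> aff_points E"
  shows "pp_map D z \<in> aff_points D"
proof -
  interpret D: min_pdiv D by fact
  interpret E: min_pdiv E by fact
  have sub: "pp_algebra D \<subseteq> pp_algebra E" by (rule pp_algebra_antimono) fact+
  show ?thesis
    unfolding alg_points_def
  proof (intro CollectI conjI allI ballI)
    show "pp_map D z \<in> extensional (pp_algebra D)" by (simp add: pp_map_def)
    show "pp_map D z (single 0 (const_fun c)) = c" for c
      by (simp add: pp_map_apply D.const_in E.point_const[OF assms(4)])
    fix a b assume ab: "a \<in> pp_algebra D" "b \<in> pp_algebra D"
    then have ab': "a \<in> pp_algebra E" "b \<in> pp_algebra E" using sub by auto
    show "pp_map D z (a + b) = pp_map D z a + pp_map D z b"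
      using E.point_add[OF assms(4) ab'] by (simp add: pp_map_apply D.add_in ab)
    show "pp_map D z (a * b) = pp_map D z a * pp_map D z b"
      using E.point_mult[OF assms(4) ab'] by (simp add: pp_map_apply D.mult_in ab)
  qed
qed

text \<open>
  Along a face, every function of the smaller chart is locally a fraction of functions of the
  bigger one, and by reducedness this is an identity in the group ring.
\<close>

lemma face_fraction:
  assumes D: "min_pdiv D" and E: "min_pdiv E" and face: "pp_face E D"
    and z: "z \<in> aff_points E" and b: "b \<in> pp_algebra E"
  obtains f g where "f \<in> pp_algebra D" "g \<in> pp_algebra D" "z g \<noteq> 0" "f = b * g"
    "\<forall>x\<in>aff_points D. x g \<noteq> 0 \<longrightarrow> (\<exists>z'\<in>aff_points E. x = pp_map D z')"
proof -
  interpret D: min_pdiv D by fact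
  interpret E: min_pdiv E by fact
  let ?P = "aff_points E"
  have sub: "E p \<subseteq> D p" for p using face by (auto simp: pp_face_def pdiv_subset_def)
  have alg: "pp_algebra D \<subseteq> pp_algebra E" using sub by (rule pp_algebra_antimono[OF D E])
  have emb: "inj_on (pp_map D) ?P"
    "\<And>U \<phi>. openin (zariski (X_aff E)) U \<Longrightarrow>
       \<phi> \<in> reg (X_aff D) (pp_map D ` U) \<longleftrightarrow> \<phi> \<circ> pp_map D \<in> reg (X_aff E) U"
    using face unfolding pp_face_def open_embedding_def E.points_Spec by blast+
  have P: "openin (zariski (X_aff E)) ?P" using openin_topspace E.points_Spec by metis
  \<comment> \<open>The function b transported to the image of the face; the open embedding makes it
    regular there although it need not extend to the chart of D.\<close>
  define \<phi> where "\<phi> = (\<lambda>x. inv_into ?P (pp_map D) x b)"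
  have \<phi>: "\<phi> (pp_map D z') = z' b" if "z' \<in> ?P" for z'
    using that emb(1) by (simp add: \<phi>_def)
  have "\<phi> \<circ> pp_map D \<in> reg (X_aff E) ?P"
  proof (rule E.Spec_regI)
    fix x assume "x \<in> ?P"
    then show "\<exists>f g. x \<in> ?P \<and> f \<in> pp_algebra E \<and> g \<in> pp_algebra E \<and> x g \<noteq> 0 \<and>
      (\<forall>y\<in>?P. y g \<noteq> 0 \<longrightarrow> y \<in> ?P \<and> (\<phi> \<circ> pp_map D) y = y f / y g)"
      using b by (intro exI[of _ b] exI[of _ 1]) (simp add: E.one_in E.point_one \<phi>)
  qed
  then have "\<phi> \<in> reg (X_aff D) (pp_map D ` ?P)" using emb(2)[OF P] by blast
  moreover have "pp_map D z \<in> pp_map D ` ?P" using z by blast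
  ultimately obtain f g where fg: "pp_map D z \<in> aff_points D"
    "f \<in> pp_algebra D" "g \<in> pp_algebra D" "pp_map D z g \<noteq> 0"
    "\<forall>y\<in>aff_points D. y g \<noteq> 0 \<longrightarrow> y \<in> pp_map D ` ?P"
    "\<forall>y\<in>aff_points D. y g \<noteq> 0 \<longrightarrow> \<phi> y = y f / y g"
    by (rule D.Spec_regE)
  have fgE: "f \<in> pp_algebra E" "g \<in> pp_algebra E" using fg alg by auto
  \<comment> \<open>The equation f = b * g is known only where g does not vanish. One more factor g
    makes it hold at every point of the face, and only then does reducedness apply.\<close>
  have eq: "z' (f * g) = z' (b * g * g)" if z': "z' \<in> ?P" for z'
  proof (cases "z' g = 0")
    case True
    then show ?thesis using z' fgE b by (simp add: E.point_mult E.mult_in)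
  next
    case False
    have "pp_map D z' \<in> aff_points D" using D E sub z' by (rule pp_map_point)
    then have "z' b = z' f / z' g"
      using fg(6) False \<phi>[OF z'] fg(2,3) by (metis pp_map_apply)
    then show ?thesis using z' fgE b False by (simp add: E.point_mult E.mult_in)
  qed
  let ?k = "f * g + single 0 (const_fun (-1)) * (b * g * g)"
  have "?k = 0"
  proof (rule E.reduced)
    have in1: "b * g * g \<in> pp_algebra E" "f * g \<in> pp_algebra E" using b fgE by (simp_all add: E.mult_in)
    then have in2: "single 0 (const_fun (-1)) * (b * g * g) \<in> pp_algebra E"
      by (simp add: E.mult_in E.const_in)
    show "?k \<in> pp_algebra E" using in1 in2 by (simp add: E.add_in)
    fix x assume x: "x \<in> ?P"
    show "x ?k = 0"
      using eq[OF x] E.point_add[OF x in1(2) in2] E.point_mult[OF x E.const_in in1(1), of "-1"]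
      by (simp add: E.point_const[OF x])
  qed
  moreover have "single 0 (const_fun (-1)) = (- 1 :: 'a group_ring)"
  proof -
    have "[:- 1:] = - (1 :: complex poly)" by (simp add: one_pCons)
    then have "const_fun (-1) = - 1" by (simp add: const_fun_def)
    then show ?thesis by (simp add: single_uminus)
  qed
  ultimately have "f * g = b * (g * g)" by (simp add: mult.assoc)
  moreover have "z (g * g) \<noteq> 0" using fg(3,4) fgE z by (simp add: E.point_mult pp_map_apply)
  moreover have "\<forall>x\<in>aff_points D. x (g * g) \<noteq> 0 \<longrightarrow> (\<exists>z'\<in>?P. x = pp_map D z')"
    using fg(3,5) by (auto simp: D.point_mult)
  moreover have "f * g \<in> pp_algebra D" "g * g \<in> pp_algebra D" using fg(2,3) by (simp_all add: D.mult_in)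
  ultimately show ?thesis by (intro that[of "f * g" "g * g"])
qed

section \<open>Gluing the charts of a divisorial fan\<close>

lemma pdiv_inter_commute: "pdiv_inter D D' = pdiv_inter D' D"
  by (auto simp: pdiv_inter_def)

text \<open>Overlaps are symmetric already, so in the generated equivalence relation only chains
  remain to be dealt with.\<close>

lemma fan_overlap_sym: "fan_overlap S \<union> (fan_overlap S)\<inverse> = fan_overlap S"
  unfolding fan_overlap_def by (auto simp: pdiv_inter_commute; metis pdiv_inter_commute)

lemma fan_class_eqI: "((D, x), (D', x')) \<in> (fan_overlap S)\<^sup>* \<Longrightarrow> fan_class S D x = fan_class S D' x'"
  using glue_class_eqI[of "(D, x)" "(D', x')" "fan_overlap S"] by (simp add: fan_overlap_sym)

lemma fan_class_eqD: "fan_class S D x = fan_class S D' x' \<Longrightarrow> ((D, x), (D', x')) \<in> (fan_overlap S)\<^sup>*"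
  using glue_class_eqD[of "fan_overlap S"] by (simp add: fan_overlap_sym)

locale div_fan =
  fixes S :: "'i::finite pdiv set"
  assumes fan: "divisorial_fan S"
begin

lemma min_pdiv: "D \<in> S \<Longrightarrow> min_pdiv D"
  using fan by (auto simp: divisorial_fan_def pp_divisor_def intro: min_pdivI)

lemma inter: "D \<in> S \<Longrightarrow> D' \<in> S \<Longrightarrow> pdiv_inter D D' \<in> S"
  using fan by (auto simp: divisorial_fan_def)

lemma faces: "D \<in> S \<Longrightarrow> D' \<in> S \<Longrightarrow> pp_face (pdiv_inter D D') D"
  "D \<in> S \<Longrightarrow> D' \<in> S \<Longrightarrow> pp_face (pdiv_inter D D') D'"
  using fan by (auto simp: divisorial_fan_def)

lemma points_X_aff: "D \<in> S \<Longrightarrow> points (X_aff D) = aff_points D"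
proof -
  assume "D \<in> S"
  then interpret D: min_pdiv D by (rule min_pdiv)
  show ?thesis by (rule D.points_Spec)
qed

lemma pp_map_inter:
  assumes "D \<in> S" "D' \<in> S" "z \<in> aff_points (pdiv_inter D D')"
  shows "pp_map D z \<in> aff_points D" "pp_map D' z \<in> aff_points D'"
  using assms by (auto intro!: pp_map_point[OF _ min_pdiv[OF inter[OF assms(1,2)]]] min_pdiv simp: pdiv_inter_def)

lemma fan_overlapE:
  assumes "(a, b) \<in> fan_overlap S"
  obtains D D' z where "D \<in> S" "D' \<in> S" "z \<in> aff_points (pdiv_inter D D')"
    "a = (D, pp_map D z)" "b = (D', pp_map D' z)"
  using assms points_X_aff[OF inter] unfolding fan_overlap_def by auto

lemma fan_overlapI:
  assumes "D \<in> S" "D' \<in> S" "z \<in> aff_points (pdiv_inter D D')"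
  shows "((D, pp_map D z), (D', pp_map D' z)) \<in> fan_overlap S"
  unfolding fan_overlap_def using assms points_X_aff[OF inter[OF assms(1,2)]] by blast

section \<open>Following functions along chains of overlaps\<close>

lemma chain_point:
  assumes "((D, x), b) \<in> (fan_overlap S)\<^sup>*" "D \<in> S" "x \<in> aff_points D"
  shows "fst b \<in> S \<and> snd b \<in> aff_points (fst b)"
  using assms(1)
proof (cases rule: rtranclE)
  case (step y)
  from step(2) show ?thesis by (rule fan_overlapE) (use pp_map_inter in auto)
qed (use assms in auto)

text \<open>The invariant carries a fraction f / g in the current chart that equals a in the common
  group ring. At each overlap both f and g are rewritten as fractions over the next chart and
  denominators are multiplied out. The last clause says that a whole neighbourhood of the end point
  is still reached from D; this is what makes the overlap locus open and the fraction a description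
  of a there.\<close>

lemma chart_transition_aux:
  assumes "((D, x), b) \<in> (fan_overlap S)\<^sup>*" "D \<in> S" "x \<in> aff_points D"
    and a: "a \<in> pp_algebra D"
  shows "\<exists>f\<in>pp_algebra (fst b). \<exists>g\<in>pp_algebra (fst b). snd b g \<noteq> 0 \<and> f = a * g \<and> x a * snd b g = snd b f \<and>
    (\<forall>y'\<in>aff_points (fst b). y' g \<noteq> 0 \<longrightarrow>
       (\<exists>y\<in>aff_points D. ((D, y), (fst b, y')) \<in> (fan_overlap S)\<^sup>* \<and> y a * y' g = y' f))"
  using assms(1)
proof (induction rule: rtrancl_induct)
  case base
  interpret D: min_pdiv D using min_pdiv assms(2) .
  show ?case
    unfolding fst_conv snd_conv
  proof (rule bexI[OF _ a], rule bexI[OF _ D.one_in], intro conjI ballI impI)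
    show "x 1 \<noteq> 0" "x a * x 1 = x a" using D.point_one[OF assms(3)] by simp_all
    show "a = a * 1" by simp
    fix y' assume "y' \<in> aff_points D"
    then show "\<exists>y\<in>aff_points D. ((D, y), (D, y')) \<in> (fan_overlap S)\<^sup>* \<and> y a * y' 1 = y' a"
      by (intro bexI[of _ y']) (auto simp: D.point_one)
  qed
next
  case (step b c)
  from step.hyps(2) obtain B C z where BC: "B \<in> S" "C \<in> S"
    and z: "z \<in> aff_points (pdiv_inter B C)"
    and b: "b = (B, pp_map B z)" and c: "c = (C, pp_map C z)" by (rule fan_overlapE)
  let ?E = "pdiv_inter B C"
  interpret B: min_pdiv B using min_pdiv BC(1) .
  interpret C: min_pdiv C using min_pdiv BC(2) .
  interpret E: min_pdiv ?E using min_pdiv inter[OF BC] .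
  have algs: "pp_algebra B \<subseteq> pp_algebra ?E" "pp_algebra C \<subseteq> pp_algebra ?E"
    by (rule pp_algebra_antimono; (unfold_locales)?; simp add: pdiv_inter_def)+
  from step.IH obtain f g where fg: "f \<in> pp_algebra B" "g \<in> pp_algebra B" "pp_map B z g \<noteq> 0" "f = a * g"
    "x a * pp_map B z g = pp_map B z f"
    "\<forall>y'\<in>aff_points B. y' g \<noteq> 0 \<longrightarrow>
       (\<exists>y\<in>aff_points D. ((D, y), (B, y')) \<in> (fan_overlap S)\<^sup>* \<and> y a * y' g = y' f)"
    unfolding b fst_conv snd_conv by blast
  have fgE: "f \<in> pp_algebra ?E" "g \<in> pp_algebra ?E" using fg algs by auto
  obtain f1 g1 where 1: "f1 \<in> pp_algebra C" "g1 \<in> pp_algebra C" "z g1 \<noteq> 0" "f1 = f * g1"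
    "\<forall>x\<in>aff_points C. x g1 \<noteq> 0 \<longrightarrow> (\<exists>z'\<in>aff_points ?E. x = pp_map C z')"
    by (rule face_fraction[OF C.min_pdiv_axioms E.min_pdiv_axioms faces(2)[OF BC] z fgE(1)])
  obtain f2 g2 where 2: "f2 \<in> pp_algebra C" "g2 \<in> pp_algebra C" "z g2 \<noteq> 0" "f2 = g * g2"
    "\<forall>x\<in>aff_points C. x g2 \<noteq> 0 \<longrightarrow> (\<exists>z'\<in>aff_points ?E. x = pp_map C z')"
    by (rule face_fraction[OF C.min_pdiv_axioms E.min_pdiv_axioms faces(2)[OF BC] z fgE(2)])
  have E12: "g1 \<in> pp_algebra ?E" "g2 \<in> pp_algebra ?E" using 1 2 algs by auto
  \<comment> \<open>Since f = f1 / g1 and g = f2 / g2 on the overlap, the ratio f / g has the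
    cross-multiplied numerator f1 * g2 and denominator f2 * g1.\<close>
  have f': "f1 * g2 \<in> pp_algebra C" "f2 * g1 \<in> pp_algebra C" using 1 2 by (simp_all add: C.mult_in)
  have val: "y (f1 * g2) = y f * (y g1 * y g2)" "y (f2 * g1) = y g * (y g1 * y g2)"
    if "y \<in> aff_points ?E" for y
    using that 1 2 E12 fgE by (simp_all add: E.point_mult E.mult_in)
  show ?case
    unfolding c fst_conv snd_conv
  proof (rule bexI[OF _ f'(1)], rule bexI[OF _ f'(2)], intro conjI ballI impI)
    show "pp_map C z (f2 * g1) \<noteq> 0"
      using f' val(2)[OF z] 1(3) 2(3) fg(2,3) by (simp add: pp_map_apply)
    have "x a * z g = z f" using fg(1,2,5) by (simp add: pp_map_apply)
    then have "x a * (z g * (z g1 * z g2)) = z f * (z g1 * z g2)" by (simp flip: mult.assoc)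
    then show "x a * pp_map C z (f2 * g1) = pp_map C z (f1 * g2)"
      using f' val[OF z] by (simp add: pp_map_apply)
    show "f1 * g2 = a * (f2 * g1)" by (simp add: 1(4) 2(4) fg(4) mult_ac)
    fix y' assume y': "y' \<in> aff_points C" "y' (f2 * g1) \<noteq> 0"
    then have "y' g1 \<noteq> 0" using 1 2 by (auto simp: C.point_mult)
    then obtain w where w: "w \<in> aff_points ?E" "y' = pp_map C w" using 1(5) y'(1) by blast
    have wnz: "w g * (w g1 * w g2) \<noteq> 0" using y'(2) w f'(2) val(2) by (simp add: pp_map_apply)
    then have "pp_map B w g \<noteq> 0" using fg(2) by (simp add: pp_map_apply)
    then obtain y where y: "y \<in> aff_points D" "((D, y), (B, pp_map B w)) \<in> (fan_overlap S)\<^sup>*"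
      "y a * pp_map B w g = pp_map B w f"
      using fg(6) pp_map_inter(1)[OF BC w(1)] by blast
    have "((D, y), (C, y')) \<in> (fan_overlap S)\<^sup>*"
      unfolding w(2) by (rule rtrancl_into_rtrancl[OF y(2) fan_overlapI[OF BC w(1)]])
    moreover have "y a * y' (f2 * g1) = y' (f1 * g2)"
    proof -
      have "y a * w g = w f" using y(3) fg(1,2) by (simp add: pp_map_apply)
      then have "y a * (w g * (w g1 * w g2)) = w f * (w g1 * w g2)" by (simp flip: mult.assoc)
      then show ?thesis using w f' val by (simp add: pp_map_apply)
    qed
    ultimately show "\<exists>y\<in>aff_points D. ((D, y), (C, y')) \<in> (fan_overlap S)\<^sup>* \<and>
        y a * y' (f2 * g1) = y' (f1 * g2)" using y(1) by blast
  qed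
qed

lemma chart_transition:
  assumes "fan_class S D x = fan_class S D' x'" "D \<in> S" "x \<in> aff_points D"
    and "a \<in> pp_algebra D"
  obtains f g where "f \<in> pp_algebra D'" "g \<in> pp_algebra D'" "x' g \<noteq> 0" "f = a * g" "x a * x' g = x' f"
    "\<forall>y'\<in>aff_points D'. y' g \<noteq> 0 \<longrightarrow>
       (\<exists>y\<in>aff_points D. fan_class S D y = fan_class S D' y' \<and> y a * y' g = y' f)"
proof -
  from chart_transition_aux[OF fan_class_eqD[OF assms(1)] assms(2-4)]
  obtain f g where "f \<in> pp_algebra D'" "g \<in> pp_algebra D'" "x' g \<noteq> 0" "f = a * g" "x a * x' g = x' f"
    "\<forall>y'\<in>aff_points D'. y' g \<noteq> 0 \<longrightarrow>
       (\<exists>y\<in>aff_points D. ((D, y), (D', y')) \<in> (fan_overlap S)\<^sup>* \<and> y a * y' g = y' f)"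
    unfolding fst_conv snd_conv by (elim bexE conjE)
  then show ?thesis using fan_class_eqI by (intro that[of f g]) fast+
qed

text \<open>When the chain returns to D, both sides of f = a * g lie in its algebra and x' may be
  applied. Comparison with the transported equation and cancellation of x' g leave x a = x'
  a.\<close>

lemma chart_injective:
  assumes eq: "fan_class S D x = fan_class S D x'" and D: "D \<in> S"
    and x: "x \<in> aff_points D" "x' \<in> aff_points D"
  shows "x = x'"
proof -
  interpret D: min_pdiv D using min_pdiv D .
  show ?thesis
  proof (rule extensionalityI)
    show "x \<in> extensional (pp_algebra D)" "x' \<in> extensional (pp_algebra D)"
      using x by (auto simp: alg_points_def)
    fix a assume a: "a \<in> pp_algebra D"
    from eq D x(1) a obtain f g where fg:
      "f \<in> pp_algebra D" "g \<in> pp_algebra D" "x' g \<noteq> 0" "f = a * g" "x a * x' g = x' f"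
      by (rule chart_transition)
    have "x' f = x' a * x' g" unfolding fg(4) by (rule D.point_mult[OF x(2) a fg(2)])
    then show "x a = x' a" using fg(3,5) by simp
  qed
qed

lemma points_X_fan: "points (X_fan S) = (\<Union>D\<in>S. fan_class S D ` aff_points D)"
  unfolding X_fan_def points_glue using points_X_aff by (intro SUP_cong refl) simp

section \<open>Charts as open subsets of the glued space, and their coordinate functions\<close>

definition chart :: "'i pdiv \<Rightarrow> ('i pdiv \<times> ('i group_ring \<Rightarrow> complex)) set set" where
  "chart D = fan_class S D ` aff_points D"

text \<open>The element a as a function on the glued space. Its value is meaningful on
  \<open>chart D\<close>, where injectivity of the chart makes the inverse a genuine one.\<close>

definition chart_fun :: "'i pdiv \<Rightarrow> 'i group_ring \<Rightarrow> ('i pdiv \<times> ('i group_ring \<Rightarrow> complex)) set \<Rightarrow> complex" where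
  "chart_fun D a c = inv_into (aff_points D) (fan_class S D) c a"

lemma chart_fun_class:
  assumes "D \<in> S" "x \<in> aff_points D"
  shows "chart_fun D a (fan_class S D x) = x a"
proof -
  have "inj_on (fan_class S D) (aff_points D)"
    using chart_injective[OF _ assms(1)] by (intro inj_onI)
  then show ?thesis using assms by (simp add: chart_fun_def)
qed

lemma chart_fun_reg:
  assumes D: "D \<in> S" and a: "a \<in> pp_algebra D"
  shows "chart_fun D a \<in> reg (X_fan S) (chart D)"
  unfolding X_fan_def reg_glue
proof
  fix D' assume D': "D' \<in> S"
  interpret D': min_pdiv D' using min_pdiv D' .
  show "chart_fun D a \<circ> fan_class S D' \<in> reg (X_aff D') {x \<in> points (X_aff D'). fan_class S D' x \<in> chart D}"
    unfolding points_X_aff[OF D']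
  proof (rule D'.Spec_regI)
    fix x' assume "x' \<in> {x \<in> aff_points D'. fan_class S D' x \<in> chart D}"
    then obtain x where x': "x' \<in> aff_points D'" and x: "x \<in> aff_points D"
      and eq: "fan_class S D x = fan_class S D' x'" unfolding chart_def by (metis (mono_tags, lifting) imageE mem_Collect_eq)
    from eq D x a obtain f g where fg:
      "f \<in> pp_algebra D'" "g \<in> pp_algebra D'" "x' g \<noteq> 0" "f = a * g" "x a * x' g = x' f"
      "\<forall>y'\<in>aff_points D'. y' g \<noteq> 0 \<longrightarrow>
       (\<exists>y\<in>aff_points D. fan_class S D y = fan_class S D' y' \<and> y a * y' g = y' f)"
      by (rule chart_transition)
    have "y' \<in> {x \<in> aff_points D'. fan_class S D' x \<in> chart D} \<and>
        (chart_fun D a \<circ> fan_class S D') y' = y' f / y' g"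
      if y': "y' \<in> aff_points D'" "y' g \<noteq> 0" for y'
    proof -
      from fg(6) y' obtain y where y: "y \<in> aff_points D"
        "fan_class S D y = fan_class S D' y'" "y a * y' g = y' f" by blast
      have "fan_class S D' y' \<in> chart D" unfolding chart_def using y by (metis imageI)
      moreover have "chart_fun D a (fan_class S D' y') = y a"
        unfolding y(2)[symmetric] by (rule chart_fun_class[OF D y(1)])
      ultimately show ?thesis using y' y(3) by (auto simp: field_simps)
    qed
    then show "\<exists>f g. x' \<in> aff_points D' \<and> f \<in> pp_algebra D' \<and> g \<in> pp_algebra D' \<and> x' g \<noteq> 0 \<and>
      (\<forall>y\<in>aff_points D'. y g \<noteq> 0 \<longrightarrow>
         y \<in> {x \<in> aff_points D'. fan_class S D' x \<in> chart D} \<and>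
         (chart_fun D a \<circ> fan_class S D') y = y f / y g)"
      using x' fg(1-3) by (intro exI[of _ f] exI[of _ g]) simp
  qed
qed

lemma openin_chart:
  assumes D: "D \<in> S"
  shows "openin (zariski (X_fan S)) (chart D)"
  unfolding X_fan_def openin_glue
proof (intro conjI ballI)
  show "chart D \<subseteq> (\<Union>j\<in>S. fan_class S j ` points (X_aff j))"
    using D points_X_aff unfolding chart_def by blast
  fix D' assume D': "D' \<in> S"
  interpret D: min_pdiv D using min_pdiv D .
  interpret D': min_pdiv D' using min_pdiv D' .
  \<comment> \<open>The constant function 1 on the chart is used only for its domain, which is open
    wherever a regular function lives on it.\<close>
  have "chart_fun D 1 \<in> reg (glue S X_aff (fan_overlap S)) (chart D)"
    using chart_fun_reg[OF D D.one_in] by (simp only: X_fan_def)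
  then have "chart_fun D 1 \<circ> fan_class S D' \<in> reg (X_aff D') {x \<in> points (X_aff D'). fan_class S D' x \<in> chart D}"
    unfolding reg_glue using D' by (rule bspec)
  then show "openin (zariski (X_aff D')) {x \<in> points (X_aff D'). fan_class S D' x \<in> chart D}"
    by (rule D'.Spec_openin_reg)
qed

end

section \<open>The fan of \<open>E\<close>\<close>

text \<open>The face of the nonnegative orthant spanned by the basis vectors with index in
  F.\<close>

definition coord_cone :: "'k set \<Rightarrow> (rat ^ 'k::finite) set" where
  "coord_cone F = {v. (\<forall>i. v $ i \<ge> 0) \<and> (\<forall>i. i \<notin> F \<longrightarrow> v $ i = 0)}"

lemma axis_nth_if: "axis i c $ l = (if l = i then c else 0)"
  by (simp add: axis_def)

lemma axis_in_coord_cone: "axis i 1 \<in> coord_cone F \<longleftrightarrow> i \<in> F"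
  by (auto simp: coord_cone_def axis_nth_if)

lemma zero_in_coord_cone [simp]: "0 \<in> coord_cone F"
  by (simp add: coord_cone_def)

lemma coord_cone_Int: "coord_cone F \<inter> coord_cone F' = coord_cone (F \<inter> F')"
  by (auto simp: coord_cone_def)

lemma coord_cone_mono: "F \<subseteq> F' \<Longrightarrow> coord_cone F \<subseteq> coord_cone F'"
  by (auto simp: coord_cone_def)

lemma sigma_block_eq: "sigma_block i = coord_cone (- {i})"
proof -
  let ?B = "{axis k (1::rat) | k. k \<noteq> i}"
  have B: "?B = (\<lambda>k. axis k 1) ` (- {i})" by auto
  have inj: "inj_on (\<lambda>k. axis k (1::rat)) (- {i})" by (auto simp: inj_on_def axis_eq_axis)
  have nth: "(\<Sum>b\<in>?B. c b *s b) $ l = (if l = i then 0 else c (axis l 1))" for c l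
  proof -
    have "(\<Sum>b\<in>?B. c b *s b) $ l = (\<Sum>k\<in>- {i}. c (axis k 1) * (if l = k then 1 else 0))"
      unfolding B by (simp add: sum.reindex[OF inj] axis_nth_if)
    also have "\<dots> = (\<Sum>k\<in>- {i}. if l = k then c (axis k 1) else 0)"
      by (intro sum.cong) auto
    finally show ?thesis by (simp add: sum.delta)
  qed
  show ?thesis
  proof (intro equalityI subsetI)
    fix v assume "v \<in> sigma_block i"
    then obtain c where c: "v = (\<Sum>b\<in>?B. c b *s b)" "\<forall>b\<in>?B. c b \<ge> 0"
      unfolding sigma_block_def cone_generated_def by blast
    have "v $ l = (if l = i then 0 else c (axis l 1))" for l unfolding c(1) by (rule nth)
    then show "v \<in> coord_cone (- {i})" using c(2) by (auto simp: coord_cone_def)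
  next
    fix v assume v: "v \<in> coord_cone (- {i})"
    \<comment> \<open>On the basis vector \<open>axis l 1\<close> the pairing returns the l-th
      coordinate of v, the required coefficient.\<close>
    define c where "c = (\<lambda>b. pairing b v)"
    have c: "c (axis l 1) = v $ l" for l
      by (simp add: c_def pairing_def axis_nth_if if_distrib[of "\<lambda>a. a * _"] sum.delta cong: if_cong)
    have "v $ l = (\<Sum>b\<in>?B. c b *s b) $ l" for l
      unfolding nth c using v by (simp add: coord_cone_def)
    then have "v = (\<Sum>b\<in>?B. c b *s b)" unfolding vec_eq_iff ..
    moreover have "\<forall>b\<in>?B. c b \<ge> 0" using v by (auto simp: c coord_cone_def)
    ultimately show "v \<in> sigma_block i" unfolding sigma_block_def cone_generated_def by blast
  qed
qed

lemma sigma_max_eq: "sigma_max I = coord_cone {(j, k). k \<noteq> I j}"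
  unfolding sigma_max_def sigma_block_eq coord_cone_def by auto

text \<open>On the cone all summands of the pairing are nonnegative, so it vanishes only termwise
  and a face just drops basis vectors. Conversely the functional that is 0 on F and 1 elsewhere cuts
  out the face of F.\<close>

lemma cone_face_coord_cone: "cone_face \<tau> (coord_cone G) \<longleftrightarrow> (\<exists>F\<subseteq>G. \<tau> = coord_cone F)"
proof
  assume "cone_face \<tau> (coord_cone G)"
  then obtain u where u: "u \<in> dual_cone (coord_cone G)" and \<tau>: "\<tau> = {v \<in> coord_cone G. pairing u v = 0}"
    unfolding cone_face_def by blast
  have unn: "u $ i \<ge> 0" if "i \<in> G" for i
  proof -
    have "pairing u (axis i 1) \<ge> 0" using u that by (simp add: dual_cone_def axis_in_coord_cone)
    then show ?thesis by (simp add: pairing_def axis_nth_if if_distrib[of "\<lambda>a. _ * a"] sum.delta cong: if_cong)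
  qed
  have "pairing u v = 0 \<longleftrightarrow> (\<forall>i. u $ i * v $ i = 0)" if v: "v \<in> coord_cone G" for v
  proof -
    have "u $ i * v $ i \<ge> 0" for i
      using unn[of i] v by (cases "i \<in> G") (auto simp: coord_cone_def)
    then show ?thesis unfolding pairing_def by (subst sum_nonneg_eq_0_iff) auto
  qed
  then have "\<tau> = coord_cone {i \<in> G. u $ i = 0}"
    unfolding \<tau> coord_cone_def by auto
  then show "\<exists>F\<subseteq>G. \<tau> = coord_cone F" by (intro exI[of _ "{i \<in> G. u $ i = 0}"]) simp
next
  assume "\<exists>F\<subseteq>G. \<tau> = coord_cone F"
  then obtain F where F: "F \<subseteq> G" "\<tau> = coord_cone F" by blast
  define u :: "rat ^ 'a" where "u = (\<chi> i. if i \<in> F then 0 else 1)"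
  have u: "pairing u v = (\<Sum>i\<in>- F. v $ i)" for v
  proof -
    have "pairing u v = (\<Sum>i\<in>UNIV. if i \<in> - F then v $ i else 0)"
      unfolding pairing_def u_def by (intro sum.cong) auto
    then show ?thesis by (simp add: sum.If_cases Compl_eq)
  qed
  have "u \<in> dual_cone (coord_cone G)"
    by (auto simp: dual_cone_def u coord_cone_def intro: sum_nonneg)
  moreover have "\<tau> = {v \<in> coord_cone G. pairing u v = 0}"
    using F by (auto simp: u coord_cone_def sum_nonneg_eq_0_iff)
  ultimately show "cone_face \<tau> (coord_cone G)" unfolding cone_face_def by blast
qed

text \<open>Choosing one omitted index in every block gives the tuple I of a maximal cone having the
  given cone as a face.\<close>

lemma Sigma_E_iff: "\<sigma> \<in> Sigma_E \<longleftrightarrow> (\<exists>F. (proper_support F) \<and> \<sigma> = coord_cone F)"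
proof
  assume "\<sigma> \<in> Sigma_E"
  then obtain I F where F: "F \<subseteq> {(j, k). k \<noteq> I j}" "\<sigma> = coord_cone F"
    by (auto simp: Sigma_E_def sigma_max_eq cone_face_coord_cone)
  then have "\<forall>j. (j, I j) \<notin> F" by auto
  then show "\<exists>F. (proper_support F) \<and> \<sigma> = coord_cone F" using F(2) by blast
next
  assume "\<exists>F. (proper_support F) \<and> \<sigma> = coord_cone F"
  then obtain F where F: "proper_support F" "\<sigma> = coord_cone F" by blast
  then obtain I where "\<forall>j. (j, I j) \<notin> F" by metis
  then have "F \<subseteq> {(j, k). k \<noteq> I j}" by auto
  then show "\<sigma> \<in> Sigma_E" using F(2) by (auto simp: Sigma_E_def sigma_max_eq cone_face_coord_cone)
qed

lemma points_E_space: "points E_space = {e. \<forall>j. \<exists>k. e (j, k) \<noteq> 0}"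
  unfolding E_space_def open_subspace_def closed_in_affine_space_def fspace.simps topspace_subtopology
    function_algebra.points_eq[OF function_algebra_polyfun] by auto

lemma toric_chart_coord_cone:
  "toric_chart (coord_cone F) = {e. (\<forall>j. \<exists>k. e (j, k) \<noteq> 0) \<and> (\<forall>i. i \<notin> F \<longrightarrow> e i \<noteq> 0)}"
  by (auto simp: toric_chart_def points_E_space axis_in_coord_cone)

section \<open>Charts of the quotient\<close>

lemma sum_UNIV_Plus:
  "(\<Sum>s\<in>UNIV. f s) = (\<Sum>i\<in>UNIV. f (Inl i)) + (\<Sum>i\<in>UNIV. f (Inr i))"
  for f :: "'a::finite + 'b::finite \<Rightarrow> 'c::comm_monoid_add"
  by (subst UNIV_Plus_UNIV[symmetric], subst sum.Plus) auto

lemma pairing_Plus: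
  "pairing u w = pairing (fst_part u) (fst_part w) + pairing (snd_part u) (snd_part w)"
  unfolding pairing_def sum_UNIV_Plus by (simp add: fst_part_def snd_part_def)

text \<open>Minus the transpose of J, that is, the component of u \<circ> \<rho> on L; the component
  on L_E is u itself.\<close>

definition Jdual :: "'r::ab_group_add ^ ('d::finite \<times> 'n::finite) \<Rightarrow> 'r ^ 'd" where
  "Jdual u = (\<chi> j. - (\<Sum>k\<in>UNIV. u $ (j, k)))"

lemma sum_UNIV_Times: "(\<Sum>i\<in>UNIV. f i) = (\<Sum>j\<in>UNIV. \<Sum>k\<in>UNIV. f (j, k))"
  for f :: "'a::finite \<times> 'b::finite \<Rightarrow> 'c::comm_monoid_add"
  by (simp add: sum.cartesian_product)

lemma pairing_rho: "pairing u (rho w) = pairing (Jdual u) (fst_part w) + pairing u (snd_part w)"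
proof -
  have "pairing u (J_map a) = - pairing (Jdual u) a" for a :: "'a ^ 'b"
    unfolding pairing_def sum_UNIV_Times
    by (simp add: J_map_def Jdual_def sum_distrib_right sum_negf)
  moreover have "pairing u (rho w) = pairing u (snd_part w) - pairing u (J_map (fst_part w))"
    by (simp add: pairing_def rho_def algebra_simps sum_subtractf)
  ultimately show ?thesis by simp
qed

lemma fst_part_rho_dual: "fst_part (rho_dual u) = Jdual u"
  and snd_part_rho_dual: "snd_part (rho_dual u) = u"
proof -
  have f: "fst_part (axis (Inl j) (1::int)) = axis j 1" "snd_part (axis (Inl j) (1::int)) = 0"
    "fst_part (axis (Inr i) (1::int)) = 0" "snd_part (axis (Inr i) (1::int)) = axis i 1"
    for j :: 'a and i :: "'a \<times> 'b"
    by (simp_all add: fst_part_def snd_part_def vec_eq_iff axis_nth_if)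
  have ax: "pairing v (axis i 1) = v $ i" for v :: "int ^ 'k::finite" and i
    by (simp add: pairing_def axis_nth_if if_distrib[of "\<lambda>a. _ * a"] sum.delta cong: if_cong)
  show "fst_part (rho_dual u) = Jdual u" "snd_part (rho_dual u) = u"
    by (simp_all add: rho_dual_def fst_part_def[of "\<chi> i. _ i"] snd_part_def[of "\<chi> i. _ i"] vec_eq_iff pairing_rho f ax)
qed

lemma inj_rho_dual: "inj rho_dual"
  by (rule inj_on_inverseI[of _ snd_part]) (simp add: snd_part_rho_dual)

lemma rat_vec_Jdual: "rat_vec (Jdual u) = Jdual (rat_vec u)"
  by (simp add: rat_vec_def Jdual_def vec_eq_iff)

lemma pairing_rat_rho_dual: "pairing (rat_vec (rho_dual u)) w = pairing (rat_vec u) (rho w)"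
proof -
  have "fst_part (rat_vec (rho_dual u)) = rat_vec (fst_part (rho_dual u))"
    "snd_part (rat_vec (rho_dual u)) = rat_vec (snd_part (rho_dual u))"
    by (simp_all add: fst_part_def snd_part_def rat_vec_def vec_eq_iff)
  then show ?thesis
    by (simp add: pairing_Plus pairing_rho fst_part_rho_dual snd_part_rho_dual rat_vec_Jdual)
qed

lemma Jdual_add: "Jdual (u + v) = Jdual u + Jdual v"
  by (simp add: Jdual_def vec_eq_iff sum.distrib)

lemma Jdual_0 [simp]: "Jdual 0 = 0"
  by (simp add: Jdual_def vec_eq_iff)

lemma part_pair:
  obtains w where "fst_part w = a" "snd_part w = b"
proof
  let ?w = "\<chi> s. case s of Inl j \<Rightarrow> a $ j | Inr i \<Rightarrow> b $ i"
  show "fst_part ?w = a" "snd_part ?w = b" by (simp_all add: fst_part_def snd_part_def vec_eq_iff)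
qed

lemma part_eqI: "fst_part w = fst_part w' \<Longrightarrow> snd_part w = snd_part w' \<Longrightarrow> w = w'"
  unfolding fst_part_def snd_part_def vec_eq_iff by (metis sum.exhaust vec_lambda_beta)

text \<open>On the support of the fan of \<open>E\<close> every block has minimum 0, so \<open>\<rho>\<close> determines both components.\<close>

lemma rho_injective:
  assumes w: "snd_part w \<in> coord_cone F" "proper_support F"
    and w': "snd_part w' \<in> coord_cone F'" "proper_support F'"
    and eq: "rho w = rho w'"
  shows "w = w'"
proof -
  have rho: "w $ Inr (j, k) - w $ Inl j = w' $ Inr (j, k) - w' $ Inl j" for j k
    using eq by (simp add: rho_def vec_eq_iff snd_part_def fst_part_def J_map_def)
  have nn: "w $ Inr i \<ge> 0" "w' $ Inr i \<ge> 0" "i \<notin> F \<Longrightarrow> w $ Inr i = 0" "i \<notin> F' \<Longrightarrow> w' $ Inr i = 0" for i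
    using w(1) w'(1) by (cases i; simp add: coord_cone_def snd_part_def)+
  have Inl: "w $ Inl j = w' $ Inl j" for j
  proof -
    \<comment> \<open>A coordinate omitted by F bounds the difference of the two \<open>Inl\<close>
      entries from one side, a coordinate omitted by F' from the other.\<close>
    obtain k k' where k: "(j, k) \<notin> F" "(j, k') \<notin> F'" using w(2) w'(2) by blast
    have "w $ Inr (j, k) = 0" "w' $ Inr (j, k) \<ge> 0" "w' $ Inr (j, k') = 0" "w $ Inr (j, k') \<ge> 0"
      using nn k by simp_all
    then show ?thesis using rho[of j k] rho[of j k'] by linarith
  qed
  have "w $ Inr (j, k) = w' $ Inr (j, k)" for j k using rho[of j k] Inl[of j] by linarith
  then show ?thesis
    using Inl by (intro part_eqI) (simp_all add: fst_part_def snd_part_def vec_eq_iff split_paired_all)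
qed

lemma tail_pdiv_times:
  assumes "min_pdiv D"
  shows "tail (pdiv_times D \<sigma>) = {w. fst_part w \<in> tail D \<and> snd_part w \<in> \<sigma>}"
proof (rule tail_eqI)
  interpret D: min_pdiv D by fact
  show "finite {p. pdiv_times D \<sigma> p \<noteq> {w. fst_part w \<in> tail D \<and> snd_part w \<in> \<sigma>}}"
    by (rule finite_subset[OF _ D.finite_special]) (auto simp: pdiv_times_def)
qed

lemma tail_rho_pdiv_times:
  assumes "min_pdiv D"
  shows "tail (rho_pdiv (pdiv_times D \<sigma>)) = rho ` {w. fst_part w \<in> tail D \<and> snd_part w \<in> \<sigma>}"
proof (rule tail_eqI)
  interpret D: min_pdiv D by fact
  show "finite {p. rho_pdiv (pdiv_times D \<sigma>) p \<noteq> rho ` {w. fst_part w \<in> tail D \<and> snd_part w \<in> \<sigma>}}"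
    by (rule finite_subset[OF _ D.finite_special]) (auto simp: pdiv_times_def rho_pdiv_def)
qed

text \<open>Where a coordinate vanishes the exponents must be nonnegative: a negative power of 0 is
  0 by convention, while \<open>0 powi 0 = 1\<close>, so additivity fails for opposite
  exponents.\<close>

lemma character_add:
  fixes u v :: "int ^ 'i::finite"
  assumes "\<And>i. e i \<noteq> 0 \<or> (u $ i \<ge> 0 \<and> v $ i \<ge> 0)"
  shows "character e (u + v) = character e u * character e v"
proof -
  have "e i powi (u $ i + v $ i) = e i powi (u $ i) * e i powi (v $ i)" for i
  proof (cases "e i = 0 \<and> u $ i + v $ i = 0")
    case True
    then have "u $ i = 0" "v $ i = 0" using assms[of i] by auto
    then show ?thesis by simp
  qed (simp add: power_int_add)
  then show ?thesis by (simp add: character_def prod.distrib)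
qed

lemma character_axis: "character e (axis i 1) = e i"
proof -
  have "character e (axis i 1) = (\<Prod>l\<in>UNIV. if l = i then e i else 1)"
    unfolding character_def by (intro prod.cong) (auto simp: axis_nth_if)
  then show ?thesis by simp
qed

lemma character_nonzeroI:
  fixes u :: "int ^ 'i::finite"
  shows "(\<And>i. e i \<noteq> 0 \<or> u $ i = 0) \<Longrightarrow> character e u \<noteq> 0"
  unfolding character_def by (auto simp: power_int_eq_0_iff)

lemma power_int_sum:
  fixes a :: complex
  assumes "a \<noteq> 0"
  shows "a powi (\<Sum>i\<in>I. f i) = (\<Prod>i\<in>I. a powi f i)"
  using assms by (induction I rule: infinite_finite_induct) (auto simp: power_int_add)

text \<open>The weight of t on the factor X in degree \<open>Jdual u\<close> and the weight of the
  block scaling on E in degree u are inverse to each other. Invariance of the quotient map rests on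
  this cancellation.\<close>

lemma character_fst_Jdual:
  assumes "t \<in> torus"
  shows "character t (Jdual u) * character (\<lambda>i. t (fst i)) u = 1"
proof -
  have "character (\<lambda>i. t (fst i)) u = (\<Prod>j\<in>UNIV. \<Prod>k\<in>UNIV. t j powi (u $ (j, k)))"
    unfolding character_def by (simp add: prod.cartesian_product case_prod_unfold)
  also have "\<dots> = (\<Prod>j\<in>UNIV. t j powi (\<Sum>k\<in>UNIV. u $ (j, k)))"
    using assms by (simp add: power_int_sum torus_def)
  finally show ?thesis
    using assms by (simp add: character_def Jdual_def prod.distrib[symmetric] torus_def power_int_minus)
qed

lemma coord_cone_nonneg: "v \<in> coord_cone F \<Longrightarrow> v $ i \<ge> 0"
  and coord_cone_zero: "v \<in> coord_cone F \<Longrightarrow> i \<notin> F \<Longrightarrow> v $ i = 0"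
  by (auto simp only: coord_cone_def)

lemma toric_chart_nonzero: "e \<in> toric_chart (coord_cone F) \<Longrightarrow> i \<notin> F \<Longrightarrow> e i \<noteq> 0"
  by (auto simp only: toric_chart_coord_cone)

lemma lookup_rho_hom: "lookup (rho_hom a) (rho_dual u) = lookup a u"
proof -
  have "lookup (rho_hom a) (rho_dual u) =
      (\<Sum>v\<in>keys a. if v = u then lookup a v else 0)"
    unfolding rho_hom_def lookup_sum lookup_single
    by (intro sum.cong refl) (auto simp: when_def inj_eq[OF inj_rho_dual])
  then show ?thesis by (simp add: sum.delta' in_keys_iff)
qed

lemma keys_rho_hom: "keys (rho_hom a) = rho_dual ` keys a"
proof
  have "keys (rho_hom a) \<subseteq>
      (\<Union>u\<in>keys a. keys (single (rho_dual u) (lookup a u)))"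
    unfolding rho_hom_def by (rule keys_sum)
  then show "keys (rho_hom a) \<subseteq> rho_dual ` keys a" by (auto split: if_splits)
  show "rho_dual ` keys a \<subseteq> keys (rho_hom a)"
    by (auto simp: in_keys_iff lookup_rho_hom)
qed

section \<open>The affine quotient chart attached to D and a cone of the fan of E\<close>

locale quotient_chart = D: min_pdiv D for D :: "'d::finite pdiv" +
  fixes F :: "('d \<times> 'n::finite) set"
  assumes proper: "\<exists>k. (j, k) \<notin> F"
begin

abbreviation "\<sigma> \<equiv> coord_cone F"
abbreviation "Q \<equiv> rho_pdiv (pdiv_times D \<sigma>)"

lemma pairing_cone_nonneg:
  assumes "\<forall>i\<in>F. u $ i \<ge> 0" "b \<in> \<sigma>"
  shows "pairing u b \<ge> 0"
  unfolding pairing_def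
proof (rule sum_nonneg)
  fix i :: "'d \<times> 'n"
  show "u $ i * b $ i \<ge> 0" using assms coord_cone_nonneg[OF assms(2)] coord_cone_zero[OF assms(2)] by (cases "i \<in> F") simp_all
qed

text \<open>Because u \<circ> \<rho> splits over the two factors and both cones contain 0,
  nonnegativity on the product can be tested on each factor separately.\<close>

lemma dual_tail_Q:
  "u \<in> dual_cone (tail Q) \<longleftrightarrow> (\<forall>i\<in>F. u $ i \<ge> 0) \<and> Jdual u \<in> dual_cone (tail D)"
proof
  assume u: "u \<in> dual_cone (tail Q)"
  have *: "pairing (Jdual u) (fst_part w) + pairing u (snd_part w) \<ge> 0"
    if "fst_part w \<in> tail D" "snd_part w \<in> \<sigma>" for w
    using u that by (simp add: dual_cone_def tail_rho_pdiv_times[OF D.min_pdiv_axioms] pairing_rho[symmetric])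
  have "u $ i \<ge> 0" if "i \<in> F" for i
  proof -
    obtain w :: "rat ^ ('d + 'd \<times> 'n)" where w: "fst_part w = 0" "snd_part w = axis i 1" by (rule part_pair)
    have "pairing u (axis i 1) = u $ i"
      by (simp add: pairing_def axis_nth_if if_distrib[of "\<lambda>a. _ * a"] sum.delta cong: if_cong)
    then show ?thesis using *[of w] D.zero_tail \<open>i \<in> F\<close> by (simp add: w axis_in_coord_cone)
  qed
  moreover have "pairing (Jdual u) a \<ge> 0" if "a \<in> tail D" for a
  proof -
    obtain w :: "rat ^ ('d + 'd \<times> 'n)" where w: "fst_part w = a" "snd_part w = 0" by (rule part_pair)
    show ?thesis using *[of w] \<open>a \<in> tail D\<close> by (simp add: w)
  qed
  ultimately show "(\<forall>i\<in>F. u $ i \<ge> 0) \<and> Jdual u \<in> dual_cone (tail D)" by (simp add: dual_cone_def)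
next
  assume "(\<forall>i\<in>F. u $ i \<ge> 0) \<and> Jdual u \<in> dual_cone (tail D)"
  then show "u \<in> dual_cone (tail Q)"
    by (auto simp: dual_cone_def tail_rho_pdiv_times[OF D.min_pdiv_axioms] pairing_rho
        intro!: add_nonneg_nonneg pairing_cone_nonneg)
qed

text \<open>The cone contributes at least 0, with equality at its apex, so a minimiser in D is
  lifted with second component 0.\<close>

lemma min_attained_Q:
  assumes u: "u \<in> dual_cone (tail Q)" and v: "v \<in> D p" "\<forall>w\<in>D p. pairing (Jdual u) v \<le> pairing (Jdual u) w"
  shows "\<exists>v'\<in>Q p. (\<forall>w\<in>Q p. pairing u v' \<le> pairing u w) \<and> pairing u v' = pairing (Jdual u) v"
proof -
  obtain w :: "rat ^ ('d + 'd \<times> 'n)" where w: "fst_part w = v" "snd_part w = 0" by (rule part_pair)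
  have val: "pairing u (rho w) = pairing (Jdual u) v" by (simp add: pairing_rho w)
  have "rho w \<in> Q p" using v w by (simp add: rho_pdiv_def pdiv_times_def)
  moreover have "pairing u (rho w) \<le> pairing u w'" if w': "w' \<in> Q p" for w'
  proof -
    obtain w'' where w'': "w' = rho w''" "fst_part w'' \<in> D p" "snd_part w'' \<in> \<sigma>"
      using w' by (auto simp: rho_pdiv_def pdiv_times_def)
    have "pairing u (snd_part w'') \<ge> 0" using u w''(3) by (intro pairing_cone_nonneg) (auto simp: dual_tail_Q)
    then show ?thesis using v(2) w'' val by (force simp: pairing_rho)
  qed
  ultimately show ?thesis using val by blast
qed

lemma Q_nonempty: "Q p \<noteq> {} \<longleftrightarrow> D p \<noteq> {}"
proof
  assume "D p \<noteq> {}"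
  then obtain v where v: "v \<in> D p" by blast
  obtain w :: "rat ^ ('d + 'd \<times> 'n)" where w: "fst_part w = v" "snd_part w = 0" by (rule part_pair)
  have "rho w \<in> Q p" using v w by (simp add: rho_pdiv_def pdiv_times_def)
  then show "Q p \<noteq> {}" by blast
qed (auto simp: rho_pdiv_def pdiv_times_def)

lemma min_pdiv_Q: "min_pdiv Q"
proof
  have "{p. Q p \<noteq> tail Q} \<subseteq> {p. D p \<noteq> tail D}"
    unfolding tail_rho_pdiv_times[OF D.min_pdiv_axioms] by (auto simp: rho_pdiv_def pdiv_times_def)
  then show "finite {p. Q p \<noteq> tail Q}" using D.finite_special by (rule finite_subset)
  obtain w :: "rat ^ ('d + 'd \<times> 'n)" where w: "fst_part w = 0" "snd_part w = 0" by (rule part_pair)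
  then have "rho w = 0" by (simp add: rho_def J_map_def vec_eq_iff)
  then show "0 \<in> tail Q"
    using w D.zero_tail unfolding tail_rho_pdiv_times[OF D.min_pdiv_axioms]
    by (intro image_eqI[of _ _ w]) simp_all
  fix u p assume u: "u \<in> dual_cone (tail Q)" and "Q p \<noteq> {}"
  then have "D p \<noteq> {}" by (simp add: Q_nonempty)
  moreover have "Jdual u \<in> dual_cone (tail D)" using u by (simp add: dual_tail_Q)
  ultimately obtain v where "v \<in> D p" "\<forall>w\<in>D p. pairing (Jdual u) v \<le> pairing (Jdual u) w"
    using D.attains by blast
  then show "\<exists>v\<in>Q p. \<forall>w\<in>Q p. pairing u v \<le> pairing u w"
    using min_attained_Q[OF u] by blast
qed

sublocale Q: min_pdiv Q
  by (rule min_pdiv_Q)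

lemma Loc_Q: "Loc Q = Loc D"
  unfolding Loc_def Q_nonempty ..

lemma pdiv_eval_Q:
  assumes u: "u \<in> dual_cone (tail Q)" and p: "p \<in> Loc D"
  shows "pdiv_eval Q u p = pdiv_eval D (Jdual u) p"
proof -
  have "Jdual u \<in> dual_cone (tail D)" using u by (simp add: dual_tail_Q)
  then obtain v where v: "v \<in> D p" "\<forall>w\<in>D p. pairing (Jdual u) v \<le> pairing (Jdual u) w"
    using D.attains[of "Jdual u" p] p by (auto simp: Loc_def)
  then obtain v' where v': "v' \<in> Q p" "\<forall>w\<in>Q p. pairing u v' \<le> pairing u w" "pairing u v' = pairing (Jdual u) v"
    using min_attained_Q[OF u] by blast
  show ?thesis using pdiv_eval_eq[of v D p "Jdual u", OF v] pdiv_eval_eq[of v' Q p u, OF v'(1,2)] v'(3) by simp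
qed

lemma rat_vec_nonneg: "rat_vec u $ i \<ge> 0 \<longleftrightarrow> u $ i \<ge> 0"
  by (simp add: rat_vec_def)

text \<open>The algebraic form of the product decomposition of the chart: the locus is that of D,
  and the value of the divisor at u is the value of D at \<open>Jdual u\<close>.\<close>

lemma piece_Q: "piece Q u = (if \<forall>i\<in>F. u $ i \<ge> 0 then piece D (Jdual u) else {0})"
proof (cases "rat_vec u \<in> dual_cone (tail Q)")
  case True
  then have *: "\<forall>i\<in>F. u $ i \<ge> 0" "rat_vec (Jdual u) \<in> dual_cone (tail D)"
    by (simp_all add: dual_tail_Q rat_vec_nonneg rat_vec_Jdual)
  have "sections (Loc D) (pdiv_eval Q (rat_vec u)) = sections (Loc D) (pdiv_eval D (rat_vec (Jdual u)))"
    using pdiv_eval_Q[OF True] by (auto simp: sections_def rat_vec_Jdual)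
  then show ?thesis using True * by (simp add: piece_def Loc_Q)
next
  case False
  then show ?thesis by (auto simp: piece_def dual_tail_Q rat_vec_nonneg rat_vec_Jdual)
qed

lemma piece_Q_subset: "f \<in> piece Q u \<Longrightarrow> f \<in> piece D (Jdual u)"
  unfolding piece_Q using D.zero by (auto split: if_splits)

lemma character_add_chart:
  assumes "e \<in> toric_chart \<sigma>" "\<forall>i\<in>F. u $ i \<ge> 0" "\<forall>i\<in>F. v $ i \<ge> 0"
  shows "character e (u + v) = character e u * character e v"
  using assms toric_chart_nonzero by (intro character_add) blast

text \<open>The affine quotient map written on pairs (x, e), without the detour through the chart of
  D \<times> \<sigma>; \<open>q_aff_pair_point\<close> identifies it with the map dual to
  \<open>rho_hom\<close>.\<close>

definition quot :: "('d group_ring \<Rightarrow> complex) \<Rightarrow> ('d \<times> 'n \<Rightarrow> complex) \<Rightarrow> ('d \<times> 'n) group_ring \<Rightarrow> complex" where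
  "quot x e = Q.hom_ext (\<lambda>u f. x (single (Jdual u) f) * character e u)"

context
  fixes x e
  assumes x: "x \<in> aff_points D" and e: "e \<in> toric_chart \<sigma>"
begin

lemma quot_add:
  assumes "f \<in> piece Q u" "g \<in> piece Q u"
  shows "x (single (Jdual u) (f + g)) * character e u =
    x (single (Jdual u) f) * character e u + x (single (Jdual u) g) * character e u"
  using assms[THEN piece_Q_subset] D.point_add[OF x]
  by (simp add: single_add D.single_in algebra_simps)

lemma quot_mult:
  assumes "f \<in> piece Q u" "g \<in> piece Q v"
  shows "x (single (Jdual (u + v)) (f * g)) * character e (u + v) =
    x (single (Jdual u) f) * character e u * (x (single (Jdual v) g) * character e v)"
proof (cases "f = 0 \<or> g = 0")
  case True
  then show ?thesis using D.point_zero[OF x] by auto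
next
  case False
  then have "\<forall>i\<in>F. u $ i \<ge> 0" "\<forall>i\<in>F. v $ i \<ge> 0" using assms by (auto simp: piece_Q split: if_splits)
  then have "character e (u + v) = character e u * character e v" using e by (intro character_add_chart)
  moreover have "x (single (Jdual (u + v)) (f * g)) =
      x (single (Jdual u) f) * x (single (Jdual v) g)"
    using assms[THEN piece_Q_subset] D.point_mult[OF x]
    by (simp add: Jdual_add mult_single[symmetric] D.single_in)
  ultimately show ?thesis by simp
qed

lemma quot_const: "x (single (Jdual 0) (const_fun c)) * character e (0 :: int ^ ('d \<times> 'n)) = c"
  using D.point_const[OF x] by simp

lemma quot_point: "quot x e \<in> aff_points Q"
  unfolding quot_def using quot_add quot_mult quot_const by (rule Q.hom_ext_point)

lemma quot_single: "f \<in> piece Q u \<Longrightarrow>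
    quot x e (single u f) = x (single (Jdual u) f) * character e u"
  unfolding quot_def using quot_add quot_mult quot_const by (rule Q.hom_ext_single)

end

lemma quot_apply: "a \<in> pp_algebra Q \<Longrightarrow>
    quot x e a = (\<Sum>u\<in>keys a. x (single (Jdual u) (lookup a u)) * character e u)"
  by (simp add: quot_def Q.hom_ext_def)

text \<open>By the adjunction between \<open>rho_dual\<close> and \<open>rho\<close>, loci, dual
  cone conditions and divisors agree degree by degree, so the coefficients are carried over
  unchanged.\<close>

lemma rho_hom_in:
  assumes a: "a \<in> pp_algebra Q"
  shows "rho_hom a \<in> pp_algebra (pdiv_times D \<sigma>)"
proof -
  have eval: "pdiv_eval (pdiv_times D \<sigma>) (rat_vec (rho_dual u)) = pdiv_eval Q (rat_vec u)" for u
    unfolding pdiv_eval_def rho_pdiv_def image_image pairing_rat_rho_dual ..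
  have loc: "Loc (pdiv_times D \<sigma>) = Loc Q"
    by (auto simp: Loc_def rho_pdiv_def)
  have dual: "rat_vec (rho_dual u) \<in> dual_cone (tail (pdiv_times D \<sigma>)) \<longleftrightarrow> rat_vec u \<in> dual_cone (tail Q)" for u
    by (simp add: dual_cone_def tail_pdiv_times[OF D.min_pdiv_axioms] tail_rho_pdiv_times[OF D.min_pdiv_axioms]
        pairing_rat_rho_dual)
  show ?thesis
    using a unfolding pp_algebra_def mem_Collect_eq keys_rho_hom
    by (auto simp: dual eval loc lookup_rho_hom)
qed

lemma q_aff_pair_point: "q_aff (pdiv_times D \<sigma>) (pair_point D \<sigma> x e) = quot x e"
proof (rule extensionalityI[of _ "pp_algebra Q"])
  show "q_aff (pdiv_times D \<sigma>) (pair_point D \<sigma> x e) \<in> extensional (pp_algebra Q)" by (simp add: q_aff_def)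
  show "quot x e \<in> extensional (pp_algebra Q)" by (simp add: quot_def Q.hom_ext_def)
  fix a assume a: "a \<in> pp_algebra Q"
  then have "q_aff (pdiv_times D \<sigma>) (pair_point D \<sigma> x e) a = (\<Sum>w\<in>keys (rho_hom a).
        x (single (fst_part w) (lookup (rho_hom a) w)) * character e (snd_part w))"
    by (simp add: q_aff_def pair_point_def rho_hom_in)
  also have "\<dots> = (\<Sum>u\<in>keys a.
        x (single (Jdual u) (lookup a u)) * character e u)"
    unfolding keys_rho_hom
    by (subst sum.reindex) (auto intro: inj_on_subset[OF inj_rho_dual] simp: lookup_rho_hom fst_part_rho_dual snd_part_rho_dual)
  finally show "q_aff (pdiv_times D \<sigma>) (pair_point D \<sigma> x e) a = quot x e a" using a by (simp add: quot_apply)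
qed

end

section \<open>Torus actions on the charts\<close>

context min_pdiv
begin

lemma aff_act_eq:
  assumes x: "x \<in> aff_points D"
  shows "aff_act D t x = hom_ext (\<lambda>u f. character t u * x (single u f))"
proof (rule extensionalityI[of _ "pp_algebra D"])
  show "aff_act D t x \<in> extensional (pp_algebra D)" by (simp add: aff_act_def)
  show "hom_ext (\<lambda>u f. character t u * x (single u f)) \<in> extensional (pp_algebra D)"
    by (simp add: hom_ext_def)
  fix a assume a: "a \<in> pp_algebra D"
  have "x (\<Sum>u\<in>keys a. single u (const_fun (character t u) * lookup a u)) =
      (\<Sum>u\<in>keys a. x (single u (const_fun (character t u) * lookup a u)))"
    by (rule point_sum[OF x]) (simp add: single_in scale_in lookup_in[OF a])
  also have "\<dots> = (\<Sum>u\<in>keys a. character t u * x (single u (lookup a u)))"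
    by (intro sum.cong refl point_single_scale[OF x] lookup_in[OF a])
  finally show "aff_act D t x a = hom_ext (\<lambda>u f. character t u * x (single u f)) a"
    using a by (simp add: aff_act_def hom_ext_def)
qed

context
  fixes x and t :: "'i \<Rightarrow> complex"
  assumes x: "x \<in> aff_points D" and t: "t \<in> torus"
begin

lemma act_add: "f \<in> piece D u \<Longrightarrow> g \<in> piece D u \<Longrightarrow> character t u * x (single u (f + g)) =
    character t u * x (single u f) + character t u * x (single u g)"
  using point_add[OF x] by (simp add: single_add single_in algebra_simps)

lemma act_mult:
  assumes "f \<in> piece D u" "g \<in> piece D v"
  shows "character t (u + v) * x (single (u + v) (f * g)) =
    character t u * x (single u f) * (character t v * x (single v g))"
proof -
  have "x (single (u + v) (f * g)) = x (single u f) * x (single v g)"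
    using point_mult[OF x] assms by (simp add: mult_single[symmetric] single_in)
  then show ?thesis by (simp add: character_torus_add[OF t])
qed

lemma act_const: "character t 0 * x (single 0 (const_fun c)) = c"
  using point_const[OF x] by simp

lemma aff_act_point: "aff_act D t x \<in> aff_points D"
  unfolding aff_act_eq[OF x] using act_add act_mult act_const by (rule hom_ext_point)

lemma aff_act_single: "f \<in> piece D u \<Longrightarrow>
    aff_act D t x (single u f) = character t u * x (single u f)"
  unfolding aff_act_eq[OF x] using act_add act_mult act_const by (rule hom_ext_single)

end

lemma aff_act_inverse:
  assumes x: "x \<in> aff_points D" and s: "s \<in> torus" and t: "t \<in> torus" and st: "\<And>i. s i * t i = 1"
  shows "aff_act D s (aff_act D t x) = x"
proof (rule point_eqI)
  note tx = aff_act_point[OF x t]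
  show "aff_act D s (aff_act D t x) \<in> aff_points D" using tx s by (rule aff_act_point)
  show "x \<in> aff_points D" by fact
  fix u f assume f: "f \<in> piece D u"
  have "character s u * character t u = 1"
    using st by (simp add: character_mult[symmetric]) (simp add: character_def)
  then show "aff_act D s (aff_act D t x) (single u f) = x (single u f)"
    using aff_act_single[OF tx s f] aff_act_single[OF x t f] by (metis mult.assoc mult_1)
qed

end

lemma aff_act_pp_map:
  assumes "min_pdiv D" "min_pdiv E" "\<And>p. E p \<subseteq> D p" "z \<in> aff_points E" "t \<in> torus"
  shows "aff_act D t (pp_map D z) = pp_map D (aff_act E t z)"
proof -
  interpret D: min_pdiv D by fact
  interpret E: min_pdiv E by fact
  note z = pp_map_point[OF assms(1-4)]
  show ?thesis
  proof (rule D.point_eqI)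
    show "aff_act D t (pp_map D z) \<in> aff_points D" using z assms(5) by (rule D.aff_act_point)
    have "aff_act E t z \<in> aff_points E" using assms(4,5) by (rule E.aff_act_point)
    with assms(1-3) show "pp_map D (aff_act E t z) \<in> aff_points D" by (rule pp_map_point)
    fix u f assume f: "f \<in> piece D u"
    then have fE: "f \<in> piece E u" using piece_antimono[OF assms(1-3)] by blast
    have fD: "single u f \<in> pp_algebra D" using f by (simp add: D.single_in)
    show "aff_act D t (pp_map D z) (single u f) = pp_map D (aff_act E t z) (single u f)"
      unfolding D.aff_act_single[OF z assms(5) f] pp_map_apply[OF fD] E.aff_act_single[OF assms(4,5) fE] ..
  qed
qed

section \<open>Slices and fibres\<close>

context quotient_chart
begin

lemma E_act_chart: "t \<in> torus \<Longrightarrow> e \<in> toric_chart \<sigma> \<Longrightarrow> E_act t e \<in> toric_chart \<sigma>"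
  unfolding toric_chart_coord_cone by (auto simp: E_act_def torus_def)

lemma quot_invariant:
  assumes x: "x \<in> aff_points D" and e: "e \<in> toric_chart \<sigma>" and t: "t \<in> torus"
  shows "quot (aff_act D t x) (E_act t e) = quot x e"
proof (rule Q.point_eqI)
  note tx = D.aff_act_point[OF x t] and te = E_act_chart[OF t e]
  show "quot (aff_act D t x) (E_act t e) \<in> aff_points Q" using tx te by (rule quot_point)
  show "quot x e \<in> aff_points Q" using x e by (rule quot_point)
  fix u f assume f: "f \<in> piece Q u"
  have "E_act t e = (\<lambda>i. t (fst i) * e i)" by (auto simp: E_act_def)
  then have ch: "character (E_act t e) u = character (\<lambda>i. t (fst i)) u * character e u"
    by (simp add: character_mult)
  have "quot (aff_act D t x) (E_act t e) (single u f) =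
      (character t (Jdual u) * character (\<lambda>i. t (fst i)) u) * (x (single (Jdual u) f) * character e u)"
    unfolding quot_single[OF tx te f] D.aff_act_single[OF x t piece_Q_subset[OF f]] ch by (simp add: mult_ac)
  then show "quot (aff_act D t x) (E_act t e) (single u f) = quot x e (single u f)"
    unfolding character_fst_Jdual[OF t] quot_single[OF x e f] by simp
qed

text \<open>
  \<open>kap\<close> is a section of \<open>Jdual\<close> supported on invertible coordinates, one per block, and the
  vectors \<open>eps i\<close> span its complement, the kernel of \<open>Jdual\<close>.  Normalising the chosen
  coordinates to 1 gives a slice of the torus action.
\<close>

definition free :: "'d \<Rightarrow> 'n" where
  "free j = (SOME k. (j, k) \<notin> F)"

lemma free: "(j, free j) \<notin> F"
  unfolding free_def using someI_ex[OF proper] .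

definition kap :: "int ^ 'd \<Rightarrow> int ^ ('d \<times> 'n)" where
  "kap v = (\<chi> i. if snd i = free (fst i) then - v $ fst i else 0)"

definition eps :: "'d \<times> 'n \<Rightarrow> int ^ ('d \<times> 'n)" where
  "eps i = axis i 1 - axis (fst i, free (fst i)) 1"

lemma kap_add: "kap (v + w) = kap v + kap w"
  by (simp add: kap_def vec_eq_iff)

lemma kap_0 [simp]: "kap 0 = 0"
  by (simp add: kap_def vec_eq_iff)

lemma Jdual_kap [simp]: "Jdual (kap v) = v"
proof -
  have "(\<Sum>k\<in>UNIV. kap v $ (j, k)) = - v $ j" for j
    by (simp add: kap_def sum.delta')
  then show ?thesis by (simp add: Jdual_def vec_eq_iff)
qed

lemma kap_on_F: "i \<in> F \<Longrightarrow> kap v $ i = 0"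
  using free[of "fst i"] by (cases i) (auto simp: kap_def)

lemma eps_nth: "eps i $ l = (if l = i then 1 else 0) - (if l = (fst i, free (fst i)) then 1 else 0)"
  by (simp add: eps_def axis_nth_if)

lemma eps_on_F: "l \<in> F \<Longrightarrow> eps i $ l = (if l = i then 1 else 0)"
  using free[of "fst i"] by (auto simp: eps_nth)

lemma Jdual_eps [simp]: "Jdual (eps i) = 0"
proof -
  obtain a b where i: "i = (a, b)" by (cases i)
  have "(\<Sum>k\<in>UNIV. eps i $ (j, k)) = 0" for j
    by (cases "j = a") (simp_all add: eps_nth i sum_subtractf sum.delta)
  then show ?thesis by (simp add: Jdual_def vec_eq_iff)
qed

lemma Jdual_scale: "Jdual (c *s u) = c *s Jdual u" for u :: "int ^ ('d \<times> 'n)"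
  by (simp add: Jdual_def vec_eq_iff sum_distrib_left)

text \<open>Replacing u by the combination of the \<open>eps\<close> subtracts the block sums at the
  chosen coordinates, and \<open>kap (Jdual u)\<close> restores them. The coefficient of
  \<open>eps i\<close> is u $ i itself, so nonnegativity on F is inherited by the
  coefficients.\<close>

lemma exponent_decomp: "u = kap (Jdual u) + (\<Sum>i\<in>UNIV. u $ i *s eps i)"
proof -
  have "(\<Sum>i\<in>UNIV. u $ i *s eps i) $ (j, l) = u $ (j, l) - (if l = free j then \<Sum>k\<in>UNIV. u $ (j, k) else 0)" for j l
  proof -
    have "(\<Sum>i\<in>UNIV. u $ i *s eps i) $ (j, l) =
        (\<Sum>i\<in>UNIV. (if i = (j, l) then u $ i else 0) - (if fst i = j \<and> l = free j then u $ i else 0))"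
      by (simp add: eps_nth, intro sum.cong) auto
    also have "\<dots> = u $ (j, l) - (\<Sum>i\<in>UNIV. if fst i = j \<and> l = free j then u $ i else 0)"
      by (simp add: sum_subtractf sum.delta)
    also have "(\<Sum>i\<in>UNIV. if fst i = j \<and> l = free j then u $ i else 0) =
        (\<Sum>a\<in>UNIV. if a = j then (if l = free j then \<Sum>k\<in>UNIV. u $ (a, k) else 0) else 0)"
      unfolding sum_UNIV_Times by (intro sum.cong) auto
    finally show ?thesis by (simp add: sum.delta)
  qed
  moreover have "kap (Jdual u) $ (j, l) = (if l = free j then \<Sum>k\<in>UNIV. u $ (j, k) else 0)" for j l
    by (simp add: kap_def Jdual_def)
  ultimately show ?thesis by (simp add: vec_eq_iff split_paired_all)
qed

lemma piece_QI: "(\<And>i. i \<in> F \<Longrightarrow> u $ i \<ge> 0) \<Longrightarrow> f \<in> piece D (Jdual u) \<Longrightarrow> f \<in> piece Q u"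
  by (simp add: piece_Q)

lemma piece_Q_kap: "f \<in> piece D v \<Longrightarrow> f \<in> piece Q (kap v)"
  by (rule piece_QI) (simp_all add: kap_on_F)

lemma one_piece: "1 \<in> piece D 0"
  using D.const[of 1] by simp

lemma one_piece_Q: "(\<And>i. i \<in> F \<Longrightarrow> u $ i \<ge> 0) \<Longrightarrow> Jdual u = 0 \<Longrightarrow> 1 \<in> piece Q u"
  using one_piece by (intro piece_QI) auto

lemma one_piece_eps: "1 \<in> piece Q (eps i)"
  by (rule one_piece_Q) (auto simp: eps_on_F)

definition slice_x :: "(('d \<times> 'n) group_ring \<Rightarrow> complex) \<Rightarrow> 'd group_ring \<Rightarrow> complex" where
  "slice_x y = D.hom_ext (\<lambda>v f. y (single (kap v) f))"

text \<open>For a chosen index i = (j, free j) the vector \<open>eps i\<close> is 0, so this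
  coordinate is y 1 = 1: the normalisation of the slice.\<close>

definition slice_e :: "(('d \<times> 'n) group_ring \<Rightarrow> complex) \<Rightarrow> 'd \<times> 'n \<Rightarrow> complex" where
  "slice_e y i = y (single (eps i) 1)"

context
  fixes y
  assumes y: "y \<in> aff_points Q"
begin

lemma slice_add: "f \<in> piece D v \<Longrightarrow> g \<in> piece D v \<Longrightarrow> y (single (kap v) (f + g)) =
    y (single (kap v) f) + y (single (kap v) g)"
  using Q.point_add[OF y] by (simp add: single_add Q.single_in piece_Q_kap)

lemma slice_mult:
  assumes "f \<in> piece D v" "g \<in> piece D w"
  shows "y (single (kap (v + w)) (f * g)) =
     y (single (kap v) f) * y (single (kap w) g)"
  using Q.point_mult[OF y] assms by (simp add: kap_add mult_single[symmetric] Q.single_in piece_Q_kap)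

lemma slice_const: "y (single (kap 0) (const_fun c)) = c"
  using Q.point_const[OF y] by simp

lemma slice_x_point: "slice_x y \<in> aff_points D"
  unfolding slice_x_def using slice_add slice_mult slice_const by (rule D.hom_ext_point)

lemma slice_x_single: "f \<in> piece D v \<Longrightarrow> slice_x y (single v f) = y (single (kap v) f)"
  unfolding slice_x_def using slice_add slice_mult slice_const by (rule D.hom_ext_single)

lemma monomial_mult:
  assumes "1 \<in> piece Q u" "1 \<in> piece Q w"
  shows "y (single (u + w) 1) = y (single u 1) * y (single w 1)"
  using Q.point_mult[OF y, of "single u 1" "single w 1"] assms
  by (simp add: mult_single Q.single_in)

lemma monomial_power:
  "1 \<in> piece Q (int n *s eps i) \<and> y (single (int n *s eps i) 1) = slice_e y i ^ n"
proof (induction n)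
  case 0
  show ?case using Q.point_one[OF y] one_piece_Q[of 0] by simp
next
  case (Suc n)
  have "int (Suc n) *s eps i = eps i + int n *s eps i" by (simp add: vec_eq_iff algebra_simps)
  moreover have "1 \<in> piece Q (eps i + int n *s eps i)"
    using Q.mult[OF one_piece_eps[of i] conjunct1[OF Suc.IH]] by simp
  ultimately show ?case
    using Suc.IH monomial_mult[OF one_piece_eps[of i] conjunct1[OF Suc.IH]] by (simp add: slice_e_def)
qed

text \<open>Off F no sign condition restricts the exponent, so the monomial of degree
  \<open>eps i\<close> is a unit of the algebra and its negative powers have the inverse
  values.\<close>

lemma monomial_powi:
  assumes "c \<ge> 0 \<or> i \<notin> F"
  shows "1 \<in> piece Q (c *s eps i) \<and> y (single (c *s eps i) 1) = slice_e y i powi c"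
proof (cases "c \<ge> 0")
  case True
  then obtain n where "c = int n" by (metis nonneg_int_cases)
  then show ?thesis using monomial_power[of n i] by simp
next
  case False
  then obtain n where n: "c = - int n" by (metis int_cases2 nle_le of_nat_0_le_iff)
  have i: "i \<notin> F" using False assms by simp
  have 1: "1 \<in> piece Q (c *s eps i)"
    by (rule one_piece_Q) (use i in \<open>auto simp: eps_on_F Jdual_scale\<close>)
  have "c *s eps i + int n *s eps i = 0" by (simp add: n vec_eq_iff)
  then have "y (single (c *s eps i) 1) * slice_e y i ^ n = 1"
    using monomial_mult[OF 1 conjunct1[OF monomial_power[of n i]]] monomial_power[of n i] Q.point_one[OF y] by simp
  then have "y (single (c *s eps i) 1) = inverse (slice_e y i ^ n)"
    by (metis inverse_unique mult.commute)
  then show ?thesis using 1 by (simp add: n power_int_minus)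
qed

lemma monomial_sum:
  assumes "finite I" "\<And>i. i \<in> I \<Longrightarrow> c i \<ge> 0 \<or> i \<notin> F"
  shows "1 \<in> piece Q (\<Sum>i\<in>I. c i *s eps i) \<and>
     y (single (\<Sum>i\<in>I. c i *s eps i) 1) = (\<Prod>i\<in>I. slice_e y i powi c i)"
  using assms
proof (induction I rule: finite_induct)
  case empty
  show ?case using Q.point_one[OF y] one_piece_Q[of 0] by simp
next
  case (insert i I)
  have I: "1 \<in> piece Q (\<Sum>i\<in>I. c i *s eps i)"
     "y (single (\<Sum>i\<in>I. c i *s eps i) 1) = (\<Prod>i\<in>I. slice_e y i powi c i)"
    using insert by auto
  have i: "1 \<in> piece Q (c i *s eps i)" "y (single (c i *s eps i) 1) = slice_e y i powi c i"
    using monomial_powi[of "c i" i] insert.prems[of i] by auto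
  have "1 \<in> piece Q (c i *s eps i + (\<Sum>i\<in>I. c i *s eps i))"
    using Q.mult[OF i(1) I(1)] by simp
  then show ?case using insert.hyps monomial_mult[OF i(1) I(1)] i(2) I(2) by simp
qed

lemma slice_e_chart: "slice_e y \<in> toric_chart \<sigma>"
proof -
  have nz: "slice_e y i \<noteq> 0" if i: "i \<notin> F" for i
  proof
    assume 0: "slice_e y i = 0"
    have "y (single ((-1) *s eps i) 1) * y (single (1 *s eps i) 1) =
        y (single ((-1) *s eps i + 1 *s eps i) 1)"
      using monomial_powi[of "-1" i] monomial_powi[of 1 i] i by (intro monomial_mult[symmetric]) auto
    also have "(-1) *s eps i + 1 *s eps i = 0" by (simp add: vec_eq_iff)
    finally show False using 0 Q.point_one[OF y] by (simp add: slice_e_def)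
  qed
  have "slice_e y (j, free j) \<noteq> 0" for j using nz free by blast
  then have "\<forall>j. \<exists>k. slice_e y (j, k) \<noteq> 0" by blast
  then show ?thesis using nz unfolding toric_chart_coord_cone by blast
qed

text \<open>A monomial of degree u factors inside the algebra into one of degree
  \<open>kap (Jdual u)\<close> carrying the coefficient and a pure monomial in the
  \<open>eps\<close>. \<open>slice_x\<close> records the values of y on the first kind,
  \<open>slice_e\<close> on the second.\<close>

lemma quot_slice: "quot (slice_x y) (slice_e y) = y"
proof (rule Q.point_eqI)
  note sx = slice_x_point and se = slice_e_chart
  show "quot (slice_x y) (slice_e y) \<in> aff_points Q" using sx se by (rule quot_point)
  show "y \<in> aff_points Q" by (rule y)
  fix u f assume f: "f \<in> piece Q u"
  show "quot (slice_x y) (slice_e y) (single u f) = y (single u f)"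
  proof (cases "f = 0")
    case True
    then show ?thesis using Q.point_zero[OF y] Q.point_zero[OF quot_point[OF sx se]] by simp
  next
    case False
    then have u: "u $ i \<ge> 0 \<or> i \<notin> F" for i using f by (auto simp: piece_Q split: if_splits)
    note fD = piece_Q_subset[OF f]
    let ?w = "\<Sum>i\<in>UNIV. u $ i *s eps i"
    have w: "1 \<in> piece Q ?w" "y (single ?w 1) = character (slice_e y) u"
      using monomial_sum[of UNIV "\<lambda>i. u $ i"] u by (auto simp: character_def)
    have "quot (slice_x y) (slice_e y) (single u f) =
        y (single (kap (Jdual u)) f) * y (single ?w 1)"
      by (simp add: quot_single[OF sx se f] slice_x_single[OF fD] w)
    also have "\<dots> = y (single (kap (Jdual u)) f * single ?w 1)"
      by (rule Q.point_mult[OF y, symmetric]) (simp_all add: Q.single_in piece_Q_kap[OF fD] w)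
    also have "\<dots> = y (single u f)"
      using exponent_decomp[of u] by (simp add: mult_single)
    finally show ?thesis .
  qed
qed

end

text \<open>Together with the next lemma: functions pulled back along the slice come from the
  quotient algebra, so the slice is a morphism and not merely a choice of preimages.\<close>

lemma slice_x_algebra:
  assumes a: "a \<in> pp_algebra D"
  shows "\<exists>b\<in>pp_algebra Q. \<forall>y\<in>aff_points Q. y b = slice_x y a"
proof
  let ?b = "\<Sum>v\<in>keys a. single (kap v) (lookup a v)"
  have in_Q: "single (kap v) (lookup a v) \<in> pp_algebra Q" for v
    using D.lookup_in[OF a] by (simp add: Q.single_in piece_Q_kap)
  then show "?b \<in> pp_algebra Q" by (rule Q.sum_in)
  show "\<forall>y\<in>aff_points Q. y ?b = slice_x y a"
  proof
    fix y assume y: "y \<in> aff_points Q"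
    show "y ?b = slice_x y a"
      by (subst Q.point_sum[OF y in_Q]) (simp add: slice_x_def D.hom_ext_def a)
  qed
qed

lemma slice_e_algebra:
  assumes "f \<in> polyfun UNIV"
  shows "\<exists>b\<in>pp_algebra Q. \<forall>y\<in>aff_points Q. y b = f (slice_e y)"
  using assms
proof induction
  case (const c)
  then show ?case using Q.const_in[of c] Q.point_const by (intro bexI[OF _ Q.const_in[of c]]) simp
next
  case (coord i)
  then show ?case
    by (intro bexI[of _ "single (eps i) 1"]) (simp_all add: slice_e_def Q.single_in one_piece_eps)
next
  case (add f g)
  then obtain a b where ab: "a \<in> pp_algebra Q" "b \<in> pp_algebra Q"
    "\<forall>y\<in>aff_points Q. y a = f (slice_e y)" "\<forall>y\<in>aff_points Q. y b = g (slice_e y)"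
    by blast
  show ?case by (rule bexI[OF _ Q.add_in[OF ab(1,2)]]) (use ab Q.point_add in simp)
next
  case (mult f g)
  then obtain a b where ab: "a \<in> pp_algebra Q" "b \<in> pp_algebra Q"
    "\<forall>y\<in>aff_points Q. y a = f (slice_e y)" "\<forall>y\<in>aff_points Q. y b = g (slice_e y)"
    by blast
  show ?case by (rule bexI[OF _ Q.mult_in[OF ab(1,2)]]) (use ab Q.point_mult in simp)
qed

text \<open>The monomial of degree \<open>eps i\<close> is the ratio of coordinate i to the chosen
  coordinate of its block. Those ratios are the invariants of the block scaling.\<close>

lemma character_eps:
  assumes "e \<in> toric_chart \<sigma>"
  shows "character e (eps i) * e (fst i, free (fst i)) = e i"
proof -
  let ?a = "axis (fst i, free (fst i)) (1 :: int)"
  have "character e (eps i + ?a) = character e (eps i) * character e ?a"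
  proof (rule character_add)
    fix l
    show "e l \<noteq> 0 \<or> 0 \<le> eps i $ l \<and> 0 \<le> ?a $ l"
      using toric_chart_nonzero[OF assms, of l] by (cases "l \<in> F") (auto simp: eps_on_F axis_nth_if)
  qed
  then show ?thesis by (simp add: character_axis eps_def)
qed

text \<open>The torus element is read off from the chosen coordinates. Equal ratios then give e' = t
  e, and after translating x by t both points of X(D) are compared over the same e'.\<close>

lemma quot_fibre:
  assumes x: "x \<in> aff_points D" "x' \<in> aff_points D"
    and e: "e \<in> toric_chart \<sigma>" "e' \<in> toric_chart \<sigma>" and eq: "quot x e = quot x' e'"
  obtains t where "t \<in> torus" "x' = aff_act D t x" "e' = E_act t e"
proof -
  define t where "t = (\<lambda>j. e' (j, free j) / e (j, free j))"
  have nz: "e (j, free j) \<noteq> 0" "e' (j, free j) \<noteq> 0" for j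
    using toric_chart_nonzero[OF e(1) free] toric_chart_nonzero[OF e(2) free] by auto
  have t: "t \<in> torus" using nz by (simp add: t_def torus_def)
  have "character e (eps i) = character e' (eps i)" for i
    using quot_single[OF x(1) e(1) one_piece_eps[of i]] quot_single[OF x(2) e(2) one_piece_eps[of i]]
      D.point_one[OF x(1)] D.point_one[OF x(2)] by (simp add: eq)
  then have coord: "e i = character e (eps i) * e (fst i, free (fst i))"
     "e' i = character e (eps i) * e' (fst i, free (fst i))" for i
    using character_eps[OF e(1), of i] character_eps[OF e(2), of i] by simp_all
  have "e' i = t (fst i) * e i" for i
  proof -
    obtain c a a' where "e i = c * a" "e' i = c * a'" "a \<noteq> 0" "t (fst i) = a' / a"
      using coord[of i] nz(1)[of "fst i"] t_def by metis
    then show ?thesis by simp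
  qed
  then have e': "e' = E_act t e" by (auto simp: E_act_def)
  note tx = D.aff_act_point[OF x(1) t]
  have eq': "quot (aff_act D t x) e' = quot x' e'"
    using quot_invariant[OF x(1) e(1) t] by (simp only: eq e'[symmetric])
  have "x' = aff_act D t x"
  proof (rule D.point_eqI[OF x(2) tx])
    fix v f assume f: "f \<in> piece D v"
    \<comment> \<open>\<open>kap v\<close> is supported on coordinates off F, where e' does not
      vanish, so its monomial can be cancelled.\<close>
    have "character e' (kap v) \<noteq> 0"
      using toric_chart_nonzero[OF e(2)] kap_on_F by (intro character_nonzeroI) blast
    then show "x' (single v f) = aff_act D t x (single v f)"
      using quot_single[OF x(2) e(2) piece_Q_kap[OF f]] quot_single[OF tx e(2) piece_Q_kap[OF f]]
      by (simp add: eq')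
  qed
  from t this e' show ?thesis by (rule that)
qed

end

section \<open>Functions on \<open>E\<close>\<close>

abbreviation affine_E :: "('d::finite \<times> 'n::finite \<Rightarrow> complex) fspace" where
  "affine_E \<equiv> principal_space UNIV (polyfun UNIV)"

interpretation affine_E: function_algebra UNIV "polyfun UNIV"
  by (rule function_algebra_polyfun)

lemma polyfun_prod:
  assumes "finite A" "A \<subseteq> I"
  shows "(\<lambda>x. \<Prod>i\<in>A. x i) \<in> polyfun I"
  using assms by (induction A rule: finite_induct) (auto intro: polyfun.intros)

text \<open>Since F omits an index in every block, invertibility off F already implies the block
  condition. The chart is thus the nonvanishing locus of one polynomial, the product of the
  coordinates off F.\<close>

lemma openin_toric_chart_affine:
  fixes F :: "('d::finite \<times> 'n::finite) set"
  assumes "proper_support F"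
  shows "openin (zariski affine_E) (toric_chart (coord_cone F))"
proof -
  have "(\<Prod>i\<in>- F. e i) \<noteq> 0 \<longleftrightarrow> (\<forall>i. i \<notin> F \<longrightarrow> e i \<noteq> 0)" for e :: "'d \<times> 'n \<Rightarrow> complex"
    by (simp add: Ball_def)
  moreover have "\<forall>j. \<exists>k. e (j, k) \<noteq> 0" if "\<forall>i. i \<notin> F \<longrightarrow> e i \<noteq> 0" for e :: "'d \<times> 'n \<Rightarrow> complex"
    using that assms by blast
  ultimately have "toric_chart (coord_cone F) = {e \<in> UNIV. (\<Prod>i\<in>- F. e i) \<noteq> 0}"
    unfolding toric_chart_coord_cone by blast
  then show ?thesis
    using affine_E.openin_nonvanishing[OF polyfun_prod[of "- F" UNIV]] by simp
qed

text \<open>The zero set of e is a proper support, and its chart contains e.\<close>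

lemma toric_chart_cover:
  assumes "e \<in> points E_space"
  obtains F where "proper_support F" "e \<in> toric_chart (coord_cone F)"
  using assms that[of "{i. e i = 0}"] by (auto simp: points_E_space toric_chart_coord_cone)

lemma toric_chart_subset: "toric_chart \<sigma> \<subseteq> points E_space"
  by (auto simp: toric_chart_def)

lemma E_space_eq: "E_space = open_subspace affine_E (points E_space)"
  unfolding points_E_space by (simp add: E_space_def closed_in_affine_space_def)

lemma openin_points_E_space: "openin (zariski affine_E) (points E_space)"
proof -
  have "\<exists>T. openin (zariski affine_E) T \<and> e \<in> T \<and> T \<subseteq> points E_space" if "e \<in> points E_space" for e
    using toric_chart_cover[OF that] openin_toric_chart_affine toric_chart_subset by metis
  then show ?thesis by (subst openin_subopen) blast
qed

lemma openin_E_space: "openin (zariski E_space) V \<longleftrightarrow> openin (zariski affine_E) V \<and> V \<subseteq> points E_space"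
proof -
  have "zariski E_space = subtopology (zariski affine_E) (points E_space)"
    by (subst E_space_eq) (simp add: open_subspace_def)
  then show ?thesis using openin_open_subtopology[OF openin_points_E_space] by metis
qed

lemma reg_E_space: "reg E_space = reg affine_E"
  by (subst E_space_eq) (simp add: open_subspace_def)

lemma openin_toric_chart:
  "proper_support F \<Longrightarrow> openin (zariski E_space) (toric_chart (coord_cone F))"
  by (simp add: openin_E_space openin_toric_chart_affine toric_chart_subset)

lemma character_reg:
  fixes u :: "int ^ ('d::finite \<times> 'n::finite)"
  assumes F: "proper_support F" and u: "\<forall>i\<in>F. u $ i \<ge> 0"
  shows "(\<lambda>e. character e u) \<in> reg E_space (toric_chart (coord_cone F))"
  unfolding character_def reg_E_space
proof (rule affine_E.reg_prod)
  show op: "openin (zariski affine_E) (toric_chart (coord_cone F))" by (rule openin_toric_chart_affine[OF F])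
  show "finite (UNIV :: ('d \<times> 'n) set)" by simp
  fix i :: "'d \<times> 'n"
  have coord: "(\<lambda>e. e i) \<in> reg affine_E (toric_chart (coord_cone F))"
    by (rule affine_E.reg_of[OF _ op]) (simp add: polyfun.coord)
  have pow: "(\<lambda>e. e i ^ n) \<in> reg affine_E (toric_chart (coord_cone F))" for n
    using affine_E.reg_prod[OF op, of "{..<n}" "\<lambda>_ e. e i"] coord by simp
  show "(\<lambda>e. e i powi u $ i) \<in> reg affine_E (toric_chart (coord_cone F))"
  proof (cases "u $ i \<ge> 0")
    case True
    then show ?thesis using pow[of "nat (u $ i)"] by (simp add: power_int_def)
  next
    case False
    then have "i \<notin> F" using u by auto
    then have "(\<lambda>e. inverse (e i ^ nat (- u $ i))) \<in> reg affine_E (toric_chart (coord_cone F))"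
      using toric_chart_nonzero[of _ F i] by (intro affine_E.reg_inverse[OF pow _ op]) simp
    then show ?thesis using False by (simp add: power_int_def power_inverse)
  qed
qed

section \<open>The fan of the quotient\<close>

abbreviation quotient_pdiv :: "'d::finite pdiv \<Rightarrow> ('d \<times> 'n::finite) set \<Rightarrow> ('d \<times> 'n) pdiv" where
  "quotient_pdiv D F \<equiv> rho_pdiv (pdiv_times D (coord_cone F))"

lemma quotient_chartI: "min_pdiv D \<Longrightarrow> proper_support F \<Longrightarrow> quotient_chart D F"
  by (simp add: quotient_chart_def quotient_chart_axioms_def)

lemma quotient_pdiv_inter:
  assumes F: "proper_support F" and F': "proper_support F'"
  shows "pdiv_inter (quotient_pdiv D F) (quotient_pdiv D' F') = quotient_pdiv (pdiv_inter D D') (F \<inter> F')"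
proof
  fix p
  show "pdiv_inter (quotient_pdiv D F) (quotient_pdiv D' F') p = quotient_pdiv (pdiv_inter D D') (F \<inter> F') p"
  proof (intro equalityI subsetI)
    fix v assume "v \<in> pdiv_inter (quotient_pdiv D F) (quotient_pdiv D' F') p"
    then have v: "v \<in> quotient_pdiv D F p" "v \<in> quotient_pdiv D' F' p" by (simp_all add: pdiv_inter_def)
    from v(1) obtain w where w: "v = rho w" "fst_part w \<in> D p" "snd_part w \<in> coord_cone F"
      by (auto simp: rho_pdiv_def pdiv_times_def)
    from v(2) obtain w' where w': "v = rho w'" "fst_part w' \<in> D' p" "snd_part w' \<in> coord_cone F'"
      by (auto simp: rho_pdiv_def pdiv_times_def)
    have "w = w'" using rho_injective[OF w(3) F w'(3) F'] w(1) w'(1) by simp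
    then show "v \<in> quotient_pdiv (pdiv_inter D D') (F \<inter> F') p"
      using w w' by (auto simp: pdiv_inter_def rho_pdiv_def pdiv_times_def coord_cone_Int[symmetric])
  qed (auto simp: pdiv_inter_def rho_pdiv_def pdiv_times_def coord_cone_Int[symmetric])
qed

lemma quotient_pdiv_mono:
  assumes "\<And>p. E p \<subseteq> D p" "F' \<subseteq> F"
  shows "quotient_pdiv E F' p \<subseteq> quotient_pdiv D F p"
  unfolding rho_pdiv_def pdiv_times_def
  by (intro image_mono) (use assms(1) coord_cone_mono[OF assms(2)] in blast)

abbreviation chart_quot where "chart_quot \<equiv> quotient_chart.quot"

lemma toric_chart_mono: "F' \<subseteq> F \<Longrightarrow> toric_chart (coord_cone F') \<subseteq> toric_chart (coord_cone F)"
  by (auto simp: toric_chart_coord_cone)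

lemma toric_chart_Int:
  "toric_chart (coord_cone F) \<inter> toric_chart (coord_cone F') \<subseteq> toric_chart (coord_cone (F \<inter> F'))"
  by (auto simp: toric_chart_coord_cone)

text \<open>Every monomial of the larger quotient chart uses only coefficients from the algebra of
  D, where w and its restriction agree. Hence the affine quotient maps are compatible with passing
  to a face.\<close>

lemma chart_quot_restrict:
  assumes D: "min_pdiv D" and E: "min_pdiv E" and sub: "\<And>p. E p \<subseteq> D p" "F' \<subseteq> F"
    and F: "proper_support F"
    and w: "w \<in> aff_points E" and e: "e \<in> toric_chart (coord_cone F')"
  shows "pp_map (quotient_pdiv D F) (chart_quot E F' w e) = chart_quot D F (pp_map D w) e"
proof -
  have F': "proper_support F'" using F sub(2) by blast
  interpret D: quotient_chart D F using D F by (rule quotient_chartI)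
  interpret E: quotient_chart E F' using E F' by (rule quotient_chartI)
  have alg: "pp_algebra (quotient_pdiv D F) \<subseteq> pp_algebra (quotient_pdiv E F')"
    by (rule pp_algebra_antimono[OF D.min_pdiv_Q E.min_pdiv_Q]) (rule quotient_pdiv_mono[OF sub])
  show ?thesis
  proof (rule extensionalityI[of _ "pp_algebra (quotient_pdiv D F)"])
    show "pp_map (quotient_pdiv D F) (chart_quot E F' w e) \<in> extensional (pp_algebra (quotient_pdiv D F))"
      by (simp add: pp_map_def)
    show "chart_quot D F (pp_map D w) e \<in> extensional (pp_algebra (quotient_pdiv D F))"
      by (simp add: D.quot_def D.Q.hom_ext_def)
    fix a assume a: "a \<in> pp_algebra (quotient_pdiv D F)"
    have "single (Jdual u) (lookup a u) \<in> pp_algebra D" for u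
      using D.piece_Q_subset[OF D.Q.lookup_in[OF a]] by (simp add: D.D.single_in)
    then show "pp_map (quotient_pdiv D F) (chart_quot E F' w e) a = chart_quot D F (pp_map D w) e a"
      using a alg by (simp add: pp_map_apply D.quot_apply E.quot_apply subset_iff)
  qed
qed

context div_fan
begin

lemma S_YC_iff: "Y \<in> S_YC S \<longleftrightarrow> (\<exists>D\<in>S. \<exists>F. (proper_support F) \<and> Y = quotient_pdiv D F)"
  unfolding S_YC_def Sigma_E_iff by blast

lemma quotient_chart_of_fan: "D \<in> S \<Longrightarrow> proper_support F \<Longrightarrow> quotient_chart D F"
  using min_pdiv by (rule quotient_chartI)

lemma points_quotient_pdiv:
  assumes "D \<in> S" "proper_support F"
  shows "points (X_aff (quotient_pdiv D F)) = aff_points (quotient_pdiv D F)"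
proof -
  interpret quotient_chart D F using assms by (rule quotient_chart_of_fan)
  show ?thesis by (rule Q.points_Spec)
qed

lemma points_X_YC: "points (X_fan (S_YC S)) =
   {fan_class (S_YC S) (quotient_pdiv D F) y | D F y. D \<in> S \<and> (proper_support F) \<and>
      y \<in> aff_points (quotient_pdiv D F)}"
  unfolding X_fan_def points_glue
proof (intro equalityI subsetI)
  fix c assume "c \<in> (\<Union>Y\<in>S_YC S. fan_class (S_YC S) Y ` points (X_aff Y))"
  then obtain Y y where Y: "Y \<in> S_YC S" "y \<in> points (X_aff Y)" "c = fan_class (S_YC S) Y y" by blast
  then obtain D F where "D \<in> S" "proper_support F" "Y = quotient_pdiv D F"
    unfolding S_YC_iff by blast
  then show "c \<in> {fan_class (S_YC S) (quotient_pdiv D F) y | D F y. D \<in> S \<and> (proper_support F) \<and>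
      y \<in> aff_points (quotient_pdiv D F)}"
    using Y points_quotient_pdiv by blast
next
  fix c assume "c \<in> {fan_class (S_YC S) (quotient_pdiv D F) y | D F y. D \<in> S \<and> (proper_support F) \<and>
      y \<in> aff_points (quotient_pdiv D F)}"
  then obtain D F y where *: "D \<in> S" "proper_support F" "y \<in> aff_points (quotient_pdiv D F)"
    "c = fan_class (S_YC S) (quotient_pdiv D F) y" by blast
  then have "quotient_pdiv D F \<in> S_YC S" using S_YC_iff by blast
  then show "c \<in> (\<Union>Y\<in>S_YC S. fan_class (S_YC S) Y ` points (X_aff Y))"
    using * points_quotient_pdiv by blast
qed

text \<open>The witness is the quotient of z and e formed over D \<inter> D' and F \<inter> F'. It
  exists because a point lying in two toric charts lies in the chart of the common face.\<close>

lemma quotient_overlap: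
  assumes D: "D \<in> S" "D' \<in> S" and F: "proper_support F" "proper_support F'"
    and z: "z \<in> aff_points (pdiv_inter D D')"
    and e: "e \<in> toric_chart (coord_cone F)" "e \<in> toric_chart (coord_cone F')"
  shows "((quotient_pdiv D F, chart_quot D F (pp_map D z) e),
          (quotient_pdiv D' F', chart_quot D' F' (pp_map D' z) e)) \<in> fan_overlap (S_YC S)"
proof -
  let ?E = "pdiv_inter D D'" and ?G = "F \<inter> F'"
  have E: "?E \<in> S" using D by (rule inter)
  have G: "proper_support ?G" using F(1) by blast
  interpret E: quotient_chart ?E ?G using E G by (rule quotient_chart_of_fan)
  have eG: "e \<in> toric_chart (coord_cone ?G)" using e toric_chart_Int by blast
  let ?y = "chart_quot ?E ?G z e"
  have "?y \<in> aff_points (quotient_pdiv ?E ?G)" using z eG by (rule E.quot_point)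
  then have "?y \<in> points (X_aff (pdiv_inter (quotient_pdiv D F) (quotient_pdiv D' F')))"
    unfolding quotient_pdiv_inter[OF F] points_quotient_pdiv[OF E G] .
  moreover have "quotient_pdiv D F \<in> S_YC S" "quotient_pdiv D' F' \<in> S_YC S"
    using D F unfolding S_YC_iff by blast+
  moreover have "pp_map (quotient_pdiv D F) ?y = chart_quot D F (pp_map D z) e"
    by (rule chart_quot_restrict[OF min_pdiv[OF D(1)] min_pdiv[OF E] _ _ F(1) z eG]) (auto simp: pdiv_inter_def)
  moreover have "pp_map (quotient_pdiv D' F') ?y = chart_quot D' F' (pp_map D' z) e"
    by (rule chart_quot_restrict[OF min_pdiv[OF D(2)] min_pdiv[OF E] _ _ F(2) z eG]) (auto simp: pdiv_inter_def)
  ultimately show ?thesis unfolding fan_overlap_def by (intro CollectI) metis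
qed

lemma pp_map_self:
  assumes "x \<in> aff_points D"
  shows "pp_map D x = x"
  using assms by (auto simp: pp_map_def alg_points_def extensional_restrict)

lemma pdiv_inter_self: "pdiv_inter D D = D"
  by (simp add: pdiv_inter_def)

section \<open>The quotient map on the glued spaces is well defined\<close>

definition quot_class where
  "quot_class D F x e = fan_class (S_YC S) (quotient_pdiv D F) (chart_quot D F x e)"

lemma quot_class_chain:
  assumes "((D, x), b) \<in> (fan_overlap S)\<^sup>*" and F: "proper_support F" and e: "e \<in> toric_chart (coord_cone F)"
  shows "quot_class D F x e = quot_class (fst b) F (snd b) e"
  using assms(1)
proof (induction rule: rtrancl_induct)
  case (step b c)
  from step.hyps(2) obtain B C z where *: "B \<in> S" "C \<in> S" "z \<in> aff_points (pdiv_inter B C)"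
    "b = (B, pp_map B z)" "c = (C, pp_map C z)" by (rule fan_overlapE)
  have "quot_class B F (pp_map B z) e = quot_class C F (pp_map C z) e"
    unfolding quot_class_def using quotient_overlap[OF *(1,2) F F *(3) e e] by (intro fan_class_eqI r_into_rtrancl)
  then show ?case using step.IH *(4,5) by simp
qed simp

text \<open>The two choices are changed one at a time: first the chart of X along a chain with the
  cone fixed, then the cone with the divisor fixed, the latter through the overlap of D' with
  itself.\<close>

lemma quot_class_cong:
  assumes eq: "fan_class S D x = fan_class S D' x'" and D: "D \<in> S" "D' \<in> S"
    and x: "x \<in> aff_points D" "x' \<in> aff_points D'"
    and F: "proper_support F" "proper_support F'"
    and e: "e \<in> toric_chart (coord_cone F)" "e \<in> toric_chart (coord_cone F')"
  shows "quot_class D F x e = quot_class D' F' x' e"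
proof -
  have "quot_class D F x e = quot_class D' F x' e"
    using quot_class_chain[OF fan_class_eqD[OF eq] F(1) e(1)] by simp
  also have "\<dots> = quot_class D' F' x' e"
    unfolding quot_class_def
    using quotient_overlap[OF D(2) D(2) F _ e, of x'] x(2) pp_map_self[OF x(2)]
    by (intro fan_class_eqI r_into_rtrancl) (simp add: pdiv_inter_self)
  finally show ?thesis .
qed

lemma q_chart_eq:
  assumes "D \<in> S" "proper_support F"
  shows "q_chart S D (coord_cone F) x e = quot_class D F x e"
proof -
  interpret quotient_chart D F using assms by (rule quotient_chart_of_fan)
  show ?thesis unfolding q_chart_def quot_class_def q_aff_pair_point ..
qed

text \<open>The description in \<open>q_map\<close> ranges over all representations of a point by
  charts; independence of the representation gives uniqueness.\<close>

lemma q_map_eq: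
  assumes D: "D \<in> S" and F: "proper_support F"
    and x: "x \<in> aff_points D" and e: "e \<in> toric_chart (coord_cone F)"
  shows "q_map S (fan_class S D x, e) = quot_class D F x e"
  unfolding q_map_def prod.case
proof (rule the_equality)
  have "coord_cone F \<in> Sigma_E" using F Sigma_E_iff by blast
  moreover have "x \<in> points (X_aff D)" using x points_X_aff[OF D] by simp
  ultimately show "\<exists>D'\<in>S. \<exists>\<sigma>\<in>Sigma_E. \<exists>x'\<in>points (X_aff D'). fan_class S D x = fan_class S D' x' \<and>
      e \<in> toric_chart \<sigma> \<and> quot_class D F x e = q_chart S D' \<sigma> x' e"
    using D e q_chart_eq[OF D F] by metis
  fix y assume "\<exists>D'\<in>S. \<exists>\<sigma>\<in>Sigma_E. \<exists>x'\<in>points (X_aff D'). fan_class S D x = fan_class S D' x' \<and>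
      e \<in> toric_chart \<sigma> \<and> y = q_chart S D' \<sigma> x' e"
  then obtain D' \<sigma> x' where *: "D' \<in> S" "\<sigma> \<in> Sigma_E" "x' \<in> points (X_aff D')"
    "fan_class S D x = fan_class S D' x'" "e \<in> toric_chart \<sigma>" "y = q_chart S D' \<sigma> x' e" by blast
  from *(2) obtain F' where F': "proper_support F'" "\<sigma> = coord_cone F'" unfolding Sigma_E_iff by blast
  have x': "x' \<in> aff_points D'" using *(3) points_X_aff[OF *(1)] by simp
  have "quot_class D F x e = quot_class D' F' x' e"
    using *(5) F'(2) by (intro quot_class_cong[OF *(4) D *(1) x x' F F'(1) e]) simp
  then show "y = quot_class D F x e" using *(6) q_chart_eq[OF *(1) F'(1)] F'(2) by simp
qed

end

section \<open>The geometric quotient\<close>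

context quotient_chart
begin

lemma openin_slice_x:
  assumes "openin (zariski (X_aff D)) U"
  shows "openin (zariski (X_aff Q)) {y \<in> aff_points Q. slice_x y \<in> U}"
  by (rule Q.points.openin_pullback[OF D.points.function_algebra_axioms slice_x_point _ assms[unfolded X_aff_def Spec_def]])
    (use slice_x_algebra in fast)+

lemma reg_slice_x:
  assumes "\<phi> \<in> reg (X_aff D) U"
  shows "(\<lambda>y. \<phi> (slice_x y)) \<in> reg (X_aff Q) {y \<in> aff_points Q. slice_x y \<in> U}"
  by (rule Q.points.reg_pullback[OF D.points.function_algebra_axioms slice_x_point _ assms[unfolded X_aff_def Spec_def]])
    (use slice_x_algebra in fast)+

lemma openin_slice_e:
  assumes "openin (zariski E_space) V"
  shows "openin (zariski (X_aff Q)) {y \<in> aff_points Q. slice_e y \<in> V}"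
  by (rule Q.points.openin_pullback[OF function_algebra_polyfun[of UNIV UNIV]])
    (use slice_e_algebra assms openin_E_space in fast)+

lemma reg_slice_e:
  assumes "\<phi> \<in> reg E_space V"
  shows "(\<lambda>y. \<phi> (slice_e y)) \<in> reg (X_aff Q) {y \<in> aff_points Q. slice_e y \<in> V}"
  by (rule Q.points.reg_pullback[OF function_algebra_polyfun[of UNIV UNIV] _ _ assms[unfolded reg_E_space]])
    (use slice_e_algebra in fast)+

end

section \<open>The torus action on the glued space\<close>

context div_fan
begin

lemma overlap_act:
  assumes "(a, b) \<in> fan_overlap S" "t \<in> torus"
  shows "((fst a, aff_act (fst a) t (snd a)), (fst b, aff_act (fst b) t (snd b))) \<in> fan_overlap S"
proof -
  from assms(1) obtain D D' z where *: "D \<in> S" "D' \<in> S" "z \<in> aff_points (pdiv_inter D D')"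
    "a = (D, pp_map D z)" "b = (D', pp_map D' z)" by (rule fan_overlapE)
  let ?E = "pdiv_inter D D'"
  note E = min_pdiv[OF inter[OF *(1,2)]]
  interpret E: min_pdiv ?E by (rule E)
  have "aff_act D t (pp_map D z) = pp_map D (aff_act ?E t z)"
    by (rule aff_act_pp_map[OF min_pdiv[OF *(1)] E _ *(3) assms(2)]) (simp add: pdiv_inter_def)
  moreover have "aff_act D' t (pp_map D' z) = pp_map D' (aff_act ?E t z)"
    by (rule aff_act_pp_map[OF min_pdiv[OF *(2)] E _ *(3) assms(2)]) (simp add: pdiv_inter_def)
  ultimately show ?thesis
    using fan_overlapI[OF *(1,2) E.aff_act_point[OF *(3) assms(2)]] *(4,5) by simp
qed

lemma chain_act:
  assumes "(a, b) \<in> (fan_overlap S)\<^sup>*" "t \<in> torus"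
  shows "((fst a, aff_act (fst a) t (snd a)), (fst b, aff_act (fst b) t (snd b))) \<in> (fan_overlap S)\<^sup>*"
  using assms(1)
proof (induction rule: rtrancl_induct)
  case (step b c)
  then show ?case using overlap_act[OF step.hyps(2) assms(2)] by (blast intro: rtrancl_into_rtrancl)
qed simp

lemma fan_class_eq: "fan_class S D x = (fan_overlap S)\<^sup>* `` {(D, x)}"
  by (simp add: glue_class_def fan_overlap_sym)

text \<open>The action moves a class as a set of representatives. Translating chains by t gives one
  inclusion, translating by the inverse gives the other.\<close>

lemma fan_act_class:
  assumes D: "D \<in> S" and x: "x \<in> aff_points D" and t: "t \<in> torus"
  shows "fan_act t (fan_class S D x) = fan_class S D (aff_act D t x)"
proof (intro equalityI subsetI)
  fix p assume "p \<in> fan_act t (fan_class S D x)"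
  then obtain D' x' where p: "p = (D', aff_act D' t x')" and chain: "((D, x), (D', x')) \<in> (fan_overlap S)\<^sup>*"
    unfolding fan_act_def fan_class_eq by auto
  show "p \<in> fan_class S D (aff_act D t x)"
    using chain_act[OF chain t] unfolding p fan_class_eq by simp
next
  fix p assume p: "p \<in> fan_class S D (aff_act D t x)"
  interpret D: min_pdiv D using D by (rule min_pdiv)
  obtain D' x' where p': "p = (D', x')" by (cases p)
  have chain: "((D, aff_act D t x), (D', x')) \<in> (fan_overlap S)\<^sup>*" using p unfolding p' fan_class_eq by simp
  have D': "D' \<in> S" "x' \<in> aff_points D'"
    using chain_point[OF chain D D.aff_act_point[OF x t]] by simp_all
  interpret D': min_pdiv D' using D'(1) by (rule min_pdiv)
  define s where "s = (\<lambda>i. inverse (t i))"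
  have s: "s \<in> torus" "s i * t i = 1" "t i * s i = 1" for i using t by (simp_all add: s_def torus_def)
  have "((D, x), (D', aff_act D' s x')) \<in> (fan_overlap S)\<^sup>*"
    using chain_act[OF chain s(1)] D.aff_act_inverse[OF x s(1) t s(2)] by simp
  then have "(D', aff_act D' s x') \<in> fan_class S D x" unfolding fan_class_eq by simp
  moreover have "p = (\<lambda>(D, x). (D, aff_act D t x)) (D', aff_act D' s x')"
    using D'.aff_act_inverse[OF D'(2) t s(1) s(3)] p' by simp
  ultimately show "p \<in> fan_act t (fan_class S D x)" unfolding fan_act_def by (rule rev_image_eqI)
qed

section \<open>The product of X and E, and regularity of q\<close>

abbreviation XE :: "(('i pdiv \<times> ('i group_ring \<Rightarrow> complex)) set \<times> ('i \<times> 'n::finite \<Rightarrow> complex)) fspace" where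
  "XE \<equiv> fs_prod (X_fan S) E_space"

abbreviation YC :: "(('i \<times> 'n::finite) pdiv \<times> (('i \<times> 'n) group_ring \<Rightarrow> complex)) set fspace" where
  "YC \<equiv> X_fan (S_YC S)"

lemma points_XE: "points XE = points (X_fan S) \<times> points E_space"
proof (rule points_fs_prod)
  show "(\<lambda>y. 1) \<in> reg E_space (points E_space)"
    unfolding reg_E_space by (rule affine_E.reg_const[OF openin_points_E_space])
  show "(\<lambda>x. 1) \<in> reg (X_fan S) (points (X_fan S))"
    unfolding X_fan_def reg_glue
  proof
    fix D assume D: "D \<in> S"
    interpret D: min_pdiv D using D by (rule min_pdiv)
    show "(\<lambda>x. 1) \<circ> fan_class S D \<in> reg (X_aff D)
        {x \<in> points (X_aff D). fan_class S D x \<in> points (glue S X_aff (fan_overlap S))}"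
    proof (rule D.Spec_regI)
      fix x assume "x \<in> {x \<in> points (X_aff D). fan_class S D x \<in> points (glue S X_aff (fan_overlap S))}"
      then have x: "x \<in> aff_points D" using points_X_aff[OF D] by simp
      have "fan_class S D y \<in> points (glue S X_aff (fan_overlap S))" if "y \<in> aff_points D" for y
        using points_X_fan that D unfolding X_fan_def by blast
      then show "\<exists>f g. x \<in> aff_points D \<and> f \<in> pp_algebra D \<and> g \<in> pp_algebra D \<and> x g \<noteq> 0 \<and>
         (\<forall>y\<in>aff_points D. y g \<noteq> 0 \<longrightarrow>
            y \<in> {x \<in> points (X_aff D). fan_class S D x \<in> points (glue S X_aff (fan_overlap S))} \<and>
            ((\<lambda>x. 1) \<circ> fan_class S D) y = y f / y g)"
        using x by (intro exI[of _ 1]) (simp add: D.one_in D.point_one points_X_aff[OF D])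
    qed
  qed
qed

lemma XE_pointE:
  assumes "z \<in> points XE"
  obtains D F x e where "D \<in> S" "proper_support F" "x \<in> aff_points D"
    "e \<in> toric_chart (coord_cone F)" "z = (fan_class S D x, e)"
proof -
  obtain c e where z: "z = (c, e)" "c \<in> points (X_fan S)" "e \<in> points E_space"
    using assms unfolding points_XE by blast
  from z(2) obtain D x where "D \<in> S" "x \<in> aff_points D" "c = fan_class S D x"
    unfolding points_X_fan by blast
  moreover from z(3) obtain F where "proper_support F" "e \<in> toric_chart (coord_cone F)"
    by (rule toric_chart_cover)
  ultimately show ?thesis using that z(1) by blast
qed

lemma XE_pointI:
  "D \<in> S \<Longrightarrow> x \<in> aff_points D \<Longrightarrow> e \<in> toric_chart \<sigma> \<Longrightarrow> (fan_class S D x, e) \<in> points XE"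
  unfolding points_XE points_X_fan using toric_chart_subset by blast

lemma quot_class_point:
  assumes "D \<in> S" "proper_support F" "x \<in> aff_points D" "e \<in> toric_chart (coord_cone F)"
  shows "quot_class D F x e \<in> points YC"
proof -
  interpret quotient_chart D F using assms(1,2) by (rule quotient_chart_of_fan)
  show ?thesis unfolding points_X_YC quot_class_def using assms quot_point[OF assms(3,4)] by blast
qed

text \<open>The pullback of a under q, written as a sum of products of a function on X and a
  monomial on E. This is the form in which the product space admits functions.\<close>

definition chart_tensor where
  "chart_tensor D a = (\<lambda>(c, e). \<Sum>u\<in>keys a.
     chart_fun D (single (Jdual u) (lookup a u)) c * character e u)"

lemma chart_tensor_in:
  assumes D: "D \<in> S" and F: "proper_support F" and a: "a \<in> pp_algebra (quotient_pdiv D F)"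
  shows "chart_tensor D a \<in> tensor_functions (X_fan S) E_space (chart D) (toric_chart (coord_cone F))"
proof -
  interpret quotient_chart D F using D F by (rule quotient_chart_of_fan)
  show ?thesis
    unfolding chart_tensor_def
  proof (rule tensor_functionsI)
    fix u assume u: "u \<in> keys a"
    have piece: "lookup a u \<in> piece Q u" by (rule Q.lookup_in[OF a])
    show "chart_fun D (single (Jdual u) (lookup a u)) \<in> reg (X_fan S) (chart D)"
      by (rule chart_fun_reg[OF D]) (simp add: D.single_in piece_Q_subset[OF piece])
    have "\<forall>i\<in>F. u $ i \<ge> 0" using piece u by (auto simp: piece_Q in_keys_iff split: if_splits)
    then show "(\<lambda>e. character e u) \<in> reg E_space (toric_chart (coord_cone F))" by (rule character_reg[OF F])
  qed simp
qed

lemma chart_tensor_eq: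
  assumes D: "D \<in> S" and F: "proper_support F" and a: "a \<in> pp_algebra (quotient_pdiv D F)"
    and x: "x \<in> aff_points D"
  shows "chart_tensor D a (fan_class S D x, e) = chart_quot D F x e a"
proof -
  interpret quotient_chart D F using D F by (rule quotient_chart_of_fan)
  show ?thesis unfolding chart_tensor_def prod.case quot_apply[OF a] chart_fun_class[OF D x] ..
qed

text \<open>Nonvanishing loci of pulled back functions are basic open sets of the product. They
  serve as neighbourhoods both for continuity of q and for pulling back regular functions.\<close>

lemma quotient_nbhd:
  assumes D: "D \<in> S" and F: "proper_support F" and g: "g \<in> pp_algebra (quotient_pdiv D F)"
    and V: "\<forall>y\<in>aff_points (quotient_pdiv D F). y g \<noteq> 0 \<longrightarrow> fan_class (S_YC S) (quotient_pdiv D F) y \<in> V"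
  defines "W \<equiv> {z \<in> chart D \<times> toric_chart (coord_cone F). chart_tensor D g z \<noteq> 0}"
  shows "openin (zariski XE) W" and "W \<subseteq> {z \<in> points XE. q_map S z \<in> V}"
    and "z \<in> W \<Longrightarrow> \<exists>x\<in>aff_points D. \<exists>e\<in>toric_chart (coord_cone F).
       z = (fan_class S D x, e) \<and> chart_quot D F x e g \<noteq> 0"
proof -
  interpret quotient_chart D F using D F by (rule quotient_chart_of_fan)
  show "openin (zariski XE) W"
    unfolding W_def using openin_chart[OF D] openin_toric_chart[OF F] chart_tensor_in[OF D F g]
    by (rule openin_fs_prod_basis)
  have W: "\<exists>x\<in>aff_points D. \<exists>e\<in>toric_chart (coord_cone F).
       z = (fan_class S D x, e) \<and> chart_quot D F x e g \<noteq> 0" if "z \<in> W" for z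
  proof -
    obtain c e where ce: "z = (c, e)" "c \<in> chart D" "e \<in> toric_chart (coord_cone F)" "chart_tensor D g z \<noteq> 0"
      using \<open>z \<in> W\<close> unfolding W_def by blast
    obtain x where x: "x \<in> aff_points D" "c = fan_class S D x" using ce(2) unfolding chart_def by blast
    have "chart_quot D F x e g \<noteq> 0" using ce(4) chart_tensor_eq[OF D F g x(1)] by (simp add: ce(1) x(2))
    then show ?thesis using x ce by blast
  qed
  then show "z \<in> W \<Longrightarrow> \<exists>x\<in>aff_points D. \<exists>e\<in>toric_chart (coord_cone F).
       z = (fan_class S D x, e) \<and> chart_quot D F x e g \<noteq> 0" .
  show "W \<subseteq> {z \<in> points XE. q_map S z \<in> V}"
  proof
    fix z assume "z \<in> W"
    from W[OF this] obtain x e where z: "x \<in> aff_points D" "e \<in> toric_chart (coord_cone F)"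
      "z = (fan_class S D x, e)" "chart_quot D F x e g \<noteq> 0" by blast
    have "quot_class D F x e \<in> V" unfolding quot_class_def using V quot_point[OF z(1,2)] z(4) by blast
    then show "z \<in> {z \<in> points XE. q_map S z \<in> V}"
      using q_map_eq[OF D F z(1,2)] XE_pointI[OF D z(1,2)] z(3) by simp
  qed
qed

lemma quotient_pdiv_S_YC: "D \<in> S \<Longrightarrow> proper_support F \<Longrightarrow> quotient_pdiv D F \<in> S_YC S"
  unfolding S_YC_iff by blast

lemma openin_YC_chart:
  assumes "openin (zariski YC) V" "D \<in> S" "proper_support F"
  shows "openin (zariski (X_aff (quotient_pdiv D F)))
    {y \<in> aff_points (quotient_pdiv D F). fan_class (S_YC S) (quotient_pdiv D F) y \<in> V}"
  using assms(1) quotient_pdiv_S_YC[OF assms(2,3)]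
  unfolding X_fan_def openin_glue points_quotient_pdiv[OF assms(2,3), symmetric] by blast

lemma openin_q_preimage:
  assumes V: "openin (zariski YC) V"
  shows "openin (zariski XE) {z \<in> points XE. q_map S z \<in> V}"
proof -
  have "\<exists>W. openin (zariski XE) W \<and> z \<in> W \<and> W \<subseteq> {z \<in> points XE. q_map S z \<in> V}"
    if z: "z \<in> points XE" "q_map S z \<in> V" for z
  proof -
    from z(1) obtain D F x e where DF: "D \<in> S" "proper_support F"
      and x: "x \<in> aff_points D" and e: "e \<in> toric_chart (coord_cone F)"
      and zxe: "z = (fan_class S D x, e)" by (rule XE_pointE)
    interpret quotient_chart D F using DF by (rule quotient_chart_of_fan)
    let ?y = "quot x e"
    have "?y \<in> {y \<in> aff_points Q. fan_class (S_YC S) Q y \<in> V}"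
      using quot_point[OF x e] z(2) q_map_eq[OF DF x e] by (simp add: zxe quot_class_def)
    with openin_YC_chart[OF V DF] obtain s where s: "?y \<in> aff_points Q" "s \<in> pp_algebra Q" "?y s \<noteq> 0"
      "\<forall>y\<in>aff_points Q. y s \<noteq> 0 \<longrightarrow> y \<in> {y \<in> aff_points Q. fan_class (S_YC S) Q y \<in> V}"
      by (rule Q.Spec_openinE)
    have sV: "\<forall>y\<in>aff_points Q. y s \<noteq> 0 \<longrightarrow> fan_class (S_YC S) Q y \<in> V" using s(4) by blast
    have "z \<in> {z \<in> chart D \<times> toric_chart (coord_cone F). chart_tensor D s z \<noteq> 0}"
      using s(3) chart_tensor_eq[OF DF s(2) x] x e by (simp add: zxe chart_def)
    then show ?thesis using quotient_nbhd(1,2)[OF DF s(2) sV] by blast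
  qed
  then show ?thesis by (subst openin_subopen) blast
qed

lemma q_pullback_reg:
  assumes \<phi>: "\<phi> \<in> reg YC V"
  shows "\<phi> \<circ> q_map S \<in> reg XE {z \<in> points XE. q_map S z \<in> V}"
  unfolding reg_fs_prod
proof
  fix z assume "z \<in> {z \<in> points XE. q_map S z \<in> V}"
  then have z: "z \<in> points XE" "q_map S z \<in> V" by auto
  from z(1) obtain D F x e where DF: "D \<in> S" "proper_support F"
    and x: "x \<in> aff_points D" and e: "e \<in> toric_chart (coord_cone F)"
    and zxe: "z = (fan_class S D x, e)" by (rule XE_pointE)
  interpret quotient_chart D F using DF by (rule quotient_chart_of_fan)
  let ?y = "quot x e"
  have y: "?y \<in> {y \<in> points (X_aff Q). fan_class (S_YC S) Q y \<in> V}"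
    using quot_point[OF x e] z(2) q_map_eq[OF DF x e] points_quotient_pdiv[OF DF] by (simp add: zxe quot_class_def)
  have "\<phi> \<circ> fan_class (S_YC S) Q \<in> reg (X_aff Q) {y \<in> points (X_aff Q). fan_class (S_YC S) Q y \<in> V}"
    using \<phi> quotient_pdiv_S_YC[OF DF] unfolding X_fan_def reg_glue by blast
  from this y obtain f g where fg: "?y \<in> aff_points Q" "f \<in> pp_algebra Q" "g \<in> pp_algebra Q" "?y g \<noteq> 0"
    "\<forall>y\<in>aff_points Q. y g \<noteq> 0 \<longrightarrow> y \<in> {y \<in> points (X_aff Q). fan_class (S_YC S) Q y \<in> V}"
    "\<forall>y\<in>aff_points Q. y g \<noteq> 0 \<longrightarrow> (\<phi> \<circ> fan_class (S_YC S) Q) y = y f / y g"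
    by (rule Q.Spec_regE)
  have gV: "\<forall>y\<in>aff_points Q. y g \<noteq> 0 \<longrightarrow> fan_class (S_YC S) Q y \<in> V" using fg(5) by blast
  let ?W = "{z \<in> chart D \<times> toric_chart (coord_cone F). chart_tensor D g z \<noteq> 0}"
  note W = quotient_nbhd[OF DF fg(3) gV]
  have zW: "z \<in> ?W"
    using fg(4) chart_tensor_eq[OF DF fg(3) x] x e by (simp add: zxe chart_def)
  have "\<forall>w\<in>?W. chart_tensor D g w \<noteq> 0 \<and> (\<phi> \<circ> q_map S) w = chart_tensor D f w / chart_tensor D g w"
  proof
    fix w assume w: "w \<in> ?W"
    from W(3)[OF w] obtain x' e' where x': "x' \<in> aff_points D" and e': "e' \<in> toric_chart (coord_cone F)"
      and w': "w = (fan_class S D x', e')" "quot x' e' g \<noteq> 0" by blast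
    have "(\<phi> \<circ> q_map S) w = \<phi> (fan_class (S_YC S) Q (quot x' e'))"
      using q_map_eq[OF DF x' e'] by (simp add: w'(1) quot_class_def)
    also have "\<dots> = quot x' e' f / quot x' e' g" using fg(6) quot_point[OF x' e'] w'(2) by simp
    finally show "chart_tensor D g w \<noteq> 0 \<and> (\<phi> \<circ> q_map S) w = chart_tensor D f w / chart_tensor D g w"
      using w'(2) by (simp add: w'(1) chart_tensor_eq[OF DF _ x'] fg(2,3))
  qed
  then have "\<exists>h\<in>tensor_functions (X_fan S) E_space (chart D) (toric_chart (coord_cone F)).
      \<exists>k\<in>tensor_functions (X_fan S) E_space (chart D) (toric_chart (coord_cone F)).
         \<forall>w\<in>?W. k w \<noteq> 0 \<and> (\<phi> \<circ> q_map S) w = h w / k w"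
    by (rule bexI[OF bexI[OF _ chart_tensor_in[OF DF fg(3)]] chart_tensor_in[OF DF fg(2)]])
  moreover have "?W \<subseteq> chart D \<times> toric_chart (coord_cone F)" by blast
  ultimately show "\<exists>W U Va. openin (zariski XE) W \<and> z \<in> W \<and> W \<subseteq> {z \<in> points XE. q_map S z \<in> V} \<and> W \<subseteq> U \<times> Va \<and>
      openin (zariski (X_fan S)) U \<and> openin (zariski E_space) Va \<and>
      (\<exists>h\<in>tensor_functions (X_fan S) E_space U Va. \<exists>k\<in>tensor_functions (X_fan S) E_space U Va.
         \<forall>w\<in>W. k w \<noteq> 0 \<and> (\<phi> \<circ> q_map S) w = h w / k w)"
    using W(1,2) zW openin_chart[OF DF(1)] openin_toric_chart[OF DF(2)]
    by (intro exI[of _ ?W] exI[of _ "chart D"] exI[of _ "toric_chart (coord_cone F)"] conjI)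
qed

end

section \<open>Fibres of q are torus orbits\<close>

context div_fan
begin

lemma S_YC_overlapE:
  assumes "(a, b) \<in> fan_overlap (S_YC S)"
  obtains E E' z where "E \<in> S_YC S" "E' \<in> S_YC S" "z \<in> points (X_aff (pdiv_inter E E'))"
    "a = (E, pp_map E z)" "b = (E', pp_map E' z)"
  using assms unfolding fan_overlap_def by blast

text \<open>The slice lifts the overlap point to some pair (w, e0) over the intersection, which need
  not restrict to the given (x, e). Both pairs have the same image in the first chart, so they
  differ there by a torus element t; translating w by t corrects the lift without changing its image
  in the second chart.\<close>

lemma lift_step:
  assumes ov: "((quotient_pdiv D F, chart_quot D F x e), (quotient_pdiv D' F', y')) \<in> fan_overlap (S_YC S)"
    and D: "D \<in> S" "D' \<in> S" and F: "proper_support F" "proper_support F'"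
    and x: "x \<in> aff_points D" and e: "e \<in> toric_chart (coord_cone F)"
  shows "\<exists>x'\<in>aff_points D'. fan_class S D x = fan_class S D' x' \<and>
     e \<in> toric_chart (coord_cone F') \<and> y' = chart_quot D' F' x' e"
proof -
  let ?E = "pdiv_inter D D'" and ?G = "F \<inter> F'"
  have ES: "?E \<in> S" using D by (rule inter)
  have G: "proper_support ?G" using F(1) by blast
  interpret D: quotient_chart D F using D(1) F(1) by (rule quotient_chart_of_fan)
  interpret D': quotient_chart D' F' using D(2) F(2) by (rule quotient_chart_of_fan)
  interpret E: quotient_chart ?E ?G using ES G by (rule quotient_chart_of_fan)
  have sub: "?E p \<subseteq> D p" "?E p \<subseteq> D' p" for p by (auto simp: pdiv_inter_def)
  from ov obtain z where z: "z \<in> points (X_aff (pdiv_inter (quotient_pdiv D F) (quotient_pdiv D' F')))"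
    "chart_quot D F x e = pp_map (quotient_pdiv D F) z" "y' = pp_map (quotient_pdiv D' F') z"
    by (rule S_YC_overlapE) auto
  have z': "z \<in> aff_points (quotient_pdiv ?E ?G)"
    using z(1) unfolding quotient_pdiv_inter[OF F] points_quotient_pdiv[OF ES G] .
  define w where "w = E.slice_x z"
  define e0 where "e0 = E.slice_e z"
  have w: "w \<in> aff_points ?E" unfolding w_def using z' by (rule E.slice_x_point)
  have e0: "e0 \<in> toric_chart (coord_cone ?G)" unfolding e0_def using z' by (rule E.slice_e_chart)
  then have e0F: "e0 \<in> toric_chart (coord_cone F)" "e0 \<in> toric_chart (coord_cone F')"
    using toric_chart_mono[of ?G F] toric_chart_mono[of ?G F'] by auto
  have zq: "z = chart_quot ?E ?G w e0" unfolding w_def e0_def using E.quot_slice[OF z'] by simp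
  note wD = pp_map_inter[OF D w]
  have "chart_quot D F (pp_map D w) e0 = chart_quot D F x e"
    unfolding z(2) zq by (rule chart_quot_restrict[OF D.D.min_pdiv_axioms E.D.min_pdiv_axioms sub(1) _ F(1) w e0, symmetric]) simp
  from wD(1) x e0F(1) e this obtain t where t: "t \<in> torus" "x = aff_act D t (pp_map D w)" "e = E_act t e0"
    by (rule D.quot_fibre)
  let ?tw = "aff_act ?E t w"
  have tw: "?tw \<in> aff_points ?E" using w t(1) by (rule E.D.aff_act_point)
  have act: "aff_act D t (pp_map D w) = pp_map D ?tw" "aff_act D' t (pp_map D' w) = pp_map D' ?tw"
    by (rule aff_act_pp_map[OF D.D.min_pdiv_axioms E.D.min_pdiv_axioms sub(1) w t(1)],
        rule aff_act_pp_map[OF D'.D.min_pdiv_axioms E.D.min_pdiv_axioms sub(2) w t(1)])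
  have "y' = chart_quot D' F' (pp_map D' w) e0"
    unfolding z(3) zq by (rule chart_quot_restrict[OF D'.D.min_pdiv_axioms E.D.min_pdiv_axioms sub(2) _ F(2) w e0]) simp
  also have "\<dots> = chart_quot D' F' (pp_map D' ?tw) e"
    unfolding act(2)[symmetric] t(3) by (rule D'.quot_invariant[OF wD(2) e0F(2) t(1), symmetric])
  finally have "y' = chart_quot D' F' (pp_map D' ?tw) e" .
  moreover have "fan_class S D x = fan_class S D' (pp_map D' ?tw)"
    unfolding t(2) act(1) by (intro fan_class_eqI r_into_rtrancl fan_overlapI D tw)
  moreover have "e \<in> toric_chart (coord_cone F')"
    unfolding t(3) using t(1) e0F(2) by (rule D'.E_act_chart)
  ultimately show ?thesis using pp_map_inter(2)[OF D tw] by blast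
qed

text \<open>After correction by the torus the E-coordinate is the same e at every stage, so the
  lifted steps compose to a statement about classes in X(S) alone.\<close>

lemma lift_chain:
  assumes "((quotient_pdiv D F, chart_quot D F x e), b) \<in> (fan_overlap (S_YC S))\<^sup>*"
    and D: "D \<in> S" and F: "proper_support F"
    and x: "x \<in> aff_points D" and e: "e \<in> toric_chart (coord_cone F)"
  shows "\<exists>D'\<in>S. \<exists>F'. (proper_support F') \<and> (\<exists>x'\<in>aff_points D'.
     b = (quotient_pdiv D' F', chart_quot D' F' x' e) \<and> fan_class S D x = fan_class S D' x' \<and>
     e \<in> toric_chart (coord_cone F'))"
  using assms(1)
proof (induction rule: rtrancl_induct)
  case base
  then show ?case using D F x e by blast
next
  case (step b c)
  then obtain D' F' x' where D': "D' \<in> S" "proper_support F'" "x' \<in> aff_points D'"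
    "b = (quotient_pdiv D' F', chart_quot D' F' x' e)" "fan_class S D x = fan_class S D' x'"
    "e \<in> toric_chart (coord_cone F')" by blast
  obtain E y where c: "c = (E, y)" by (cases c)
  have "E \<in> S_YC S" using step.hyps(2) unfolding c by (rule S_YC_overlapE) auto
  then obtain D'' F'' where D'': "D'' \<in> S" "proper_support F''" "E = quotient_pdiv D'' F''"
    unfolding S_YC_iff by blast
  have "\<exists>x''\<in>aff_points D''. fan_class S D' x' = fan_class S D'' x'' \<and>
     e \<in> toric_chart (coord_cone F'') \<and> y = chart_quot D'' F'' x'' e"
    using step.hyps(2) D'(1) D''(1) D'(2) D''(2) D'(3,6) unfolding c D'(4) D''(3) by (rule lift_step)
  then show ?case using D'' D'(5) c by auto
qed

lemma quot_class_fibre: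
  assumes eq: "quot_class D F x e = quot_class D' F' x' e'"
    and D: "D \<in> S" "D' \<in> S" and F: "proper_support F" "proper_support F'"
    and x: "x \<in> aff_points D" "x' \<in> aff_points D'"
    and e: "e \<in> toric_chart (coord_cone F)" "e' \<in> toric_chart (coord_cone F')"
  shows "\<exists>t\<in>torus. (fan_class S D' x', e') = diagonal_act t (fan_class S D x, e)"
proof -
  interpret D': quotient_chart D' F' using D(2) F(2) by (rule quotient_chart_of_fan)
  let ?E = "quotient_pdiv D' F'" and ?y = "chart_quot D' F' x' e'"
  have chain: "((quotient_pdiv D F, chart_quot D F x e), (?E, ?y)) \<in> (fan_overlap (S_YC S))\<^sup>*"
    using fan_class_eqD[OF eq[unfolded quot_class_def]] .
  have "\<exists>D2\<in>S. \<exists>F2. (proper_support F2) \<and> (\<exists>x2\<in>aff_points D2.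
     (?E, ?y) = (quotient_pdiv D2 F2, chart_quot D2 F2 x2 e) \<and> fan_class S D x = fan_class S D2 x2 \<and>
     e \<in> toric_chart (coord_cone F2))"
    using chain D(1) F(1) x(1) e(1) by (rule lift_chain)
  then obtain D2 F2 x2 where D2: "D2 \<in> S" "proper_support F2" "x2 \<in> aff_points D2"
    "?E = quotient_pdiv D2 F2" "?y = chart_quot D2 F2 x2 e" "fan_class S D x = fan_class S D2 x2"
    "e \<in> toric_chart (coord_cone F2)" by blast
  have y: "?y \<in> aff_points ?E" using x(2) e(2) by (rule D'.quot_point)
  \<comment> \<open>The chain ends at the correct quotient divisor, but possibly presented by
    another pair (D2, F2). The self-overlap of that divisor is read as one more step, from (D2, F2)
    to (D', F'), and lifted like the others.\<close>
  have "((?E, ?y), (?E, ?y)) \<in> fan_overlap (S_YC S)"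
    unfolding fan_overlap_def
    using quotient_pdiv_S_YC[OF D(2) F(2)] y points_quotient_pdiv[OF D(2) F(2)] pp_map_self[OF y]
    by (intro CollectI exI[of _ ?E] exI[of _ ?y]) (simp add: pdiv_inter_def)
  then have "((quotient_pdiv D2 F2, chart_quot D2 F2 x2 e), (?E, ?y)) \<in> fan_overlap (S_YC S)"
    by (simp only: D2(4)[symmetric] D2(5)[symmetric])
  from lift_step[OF this D2(1) D(2) D2(2) F(2) D2(3,7)] obtain x3 where x3: "x3 \<in> aff_points D'"
    "fan_class S D2 x2 = fan_class S D' x3" "e \<in> toric_chart (coord_cone F')" "?y = chart_quot D' F' x3 e" by blast
  from x3(1) x(2) x3(3) e(2) x3(4)[symmetric] obtain t where t: "t \<in> torus" "x' = aff_act D' t x3" "e' = E_act t e"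
    by (rule D'.quot_fibre)
  have "fan_class S D' x' = fan_act t (fan_class S D x)"
    unfolding t(2) D2(6) x3(2) by (rule fan_act_class[OF D(2) x3(1) t(1), symmetric])
  then show ?thesis using t(1,3) by (intro bexI[of _ t]) (simp_all add: diagonal_act_def)
qed

lemma diagonal_act_point:
  assumes t: "t \<in> torus" and D: "D \<in> S" and F: "proper_support F"
    and x: "x \<in> aff_points D" and e: "e \<in> toric_chart (coord_cone F)"
  shows "diagonal_act t (fan_class S D x, e) \<in> points XE"
    and "q_map S (diagonal_act t (fan_class S D x, e)) = q_map S (fan_class S D x, e)"
proof -
  interpret quotient_chart D F using D F by (rule quotient_chart_of_fan)
  have act: "diagonal_act t (fan_class S D x, e) = (fan_class S D (aff_act D t x), E_act t e)"
    by (simp add: diagonal_act_def fan_act_class[OF D x t])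
  note tx = D.aff_act_point[OF x t] and te = E_act_chart[OF t e]
  show "diagonal_act t (fan_class S D x, e) \<in> points XE" unfolding act by (rule XE_pointI[OF D tx te])
  show "q_map S (diagonal_act t (fan_class S D x, e)) = q_map S (fan_class S D x, e)"
    unfolding act q_map_eq[OF D F tx te] q_map_eq[OF D F x e] quot_class_def quot_invariant[OF x e t] ..
qed

lemma q_fibre:
  assumes z: "z \<in> points XE"
  shows "{z' \<in> points XE. q_map S z' = q_map S z} = (\<lambda>t. diagonal_act t z) ` torus"
proof -
  from z obtain D F x e where D: "D \<in> S" "proper_support F" "x \<in> aff_points D"
    "e \<in> toric_chart (coord_cone F)" and z_eq: "z = (fan_class S D x, e)" by (rule XE_pointE)
  show ?thesis
  proof (intro equalityI subsetI)
    fix z' assume "z' \<in> {z' \<in> points XE. q_map S z' = q_map S z}"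
    then have z': "z' \<in> points XE" "q_map S z' = q_map S z" by auto
    from z'(1) obtain D' F' x' e' where D': "D' \<in> S" "proper_support F'" "x' \<in> aff_points D'"
      "e' \<in> toric_chart (coord_cone F')" and z'_eq: "z' = (fan_class S D' x', e')" by (rule XE_pointE)
    have "quot_class D F x e = quot_class D' F' x' e'"
      using z'(2) unfolding z'_eq z_eq q_map_eq[OF D] q_map_eq[OF D'] by simp
    from quot_class_fibre[OF this D(1) D'(1) D(2) D'(2) D(3) D'(3) D(4) D'(4)]
    show "z' \<in> (\<lambda>t. diagonal_act t z) ` torus" unfolding z_eq z'_eq by blast
  next
    fix z' assume "z' \<in> (\<lambda>t. diagonal_act t z) ` torus"
    then show "z' \<in> {z' \<in> points XE. q_map S z' = q_map S z}"
      unfolding z_eq using diagonal_act_point[OF _ D] by auto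
  qed
qed

end

section \<open>Local sections of q\<close>

locale fan_chart = div_fan S + quotient_chart D F
  for S :: "'d::finite pdiv set" and D and F :: "('d \<times> 'n::finite) set" +
  assumes D_in: "D \<in> S"
begin

lemma proper_all: "proper_support F"
  using proper by blast

text \<open>A section of q over the chart of Q, with values in the slice.\<close>

definition lift where
  "lift y = (fan_class S D (slice_x y), slice_e y)"

lemma lift_point: "y \<in> aff_points Q \<Longrightarrow> lift y \<in> points XE"
  unfolding lift_def using slice_x_point slice_e_chart by (intro XE_pointI[OF D_in])

lemma q_lift: "y \<in> aff_points Q \<Longrightarrow> q_map S (lift y) = fan_class (S_YC S) Q y"
  unfolding lift_def using q_map_eq[OF D_in proper_all slice_x_point slice_e_chart]
  by (simp add: quot_class_def quot_slice)

lemma slice_x_class: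
  "{y \<in> aff_points Q. fan_class S D (slice_x y) \<in> U} =
   {y \<in> aff_points Q. slice_x y \<in> {x \<in> points (X_aff D). fan_class S D x \<in> U}}"
  using slice_x_point points_X_aff[OF D_in] by auto

lemma openin_lift_fst:
  assumes "openin (zariski (X_fan S)) U"
  shows "openin (zariski (X_aff Q)) {y \<in> aff_points Q. fan_class S D (slice_x y) \<in> U}"
  unfolding slice_x_class using assms D_in unfolding X_fan_def openin_glue by (intro openin_slice_x) blast

lemma reg_lift_fst:
  assumes "\<phi> \<in> reg (X_fan S) U"
  shows "(\<lambda>y. \<phi> (fan_class S D (slice_x y))) \<in>
    reg (X_aff Q) {y \<in> aff_points Q. fan_class S D (slice_x y) \<in> U}"
proof -
  have "\<phi> \<circ> fan_class S D \<in> reg (X_aff D) {x \<in> points (X_aff D). fan_class S D x \<in> U}"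
    using assms D_in unfolding X_fan_def reg_glue by blast
  from reg_slice_x[OF this] show ?thesis unfolding slice_x_class by simp
qed

lemma openin_lift_Times:
  assumes "openin (zariski (X_fan S)) U" "openin (zariski E_space) V"
  shows "openin (zariski (X_aff Q)) {y \<in> aff_points Q. lift y \<in> U \<times> V}"
proof -
  have "{y \<in> aff_points Q. lift y \<in> U \<times> V} =
     {y \<in> aff_points Q. fan_class S D (slice_x y) \<in> U} \<inter>
     {y \<in> aff_points Q. slice_e y \<in> V}"
    by (auto simp: lift_def)
  then show ?thesis using openin_lift_fst[OF assms(1)] openin_slice_e[OF assms(2)] by (simp add: openin_Int)
qed

lemma tensor_lift:
  assumes U: "openin (zariski (X_fan S)) U" and V: "openin (zariski E_space) V"
    and h: "h \<in> tensor_functions (X_fan S) E_space U V"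
  shows "(\<lambda>y. h (lift y)) \<in> reg (X_aff Q) {y \<in> aff_points Q. lift y \<in> U \<times> V}"
proof -
  obtain n :: nat and f g where fg: "\<forall>i<n. f i \<in> reg (X_fan S) U \<and> g i \<in> reg E_space V"
    "h = (\<lambda>(x, y). \<Sum>i<n. f i x * g i y)" using h unfolding tensor_functions_def by blast
  note op = openin_lift_Times[OF U V]
  have "(\<lambda>y. f i (fan_class S D (slice_x y)) * g i (slice_e y)) \<in>
      reg (X_aff Q) {y \<in> aff_points Q. lift y \<in> U \<times> V}" if i: "i < n" for i
    proof (rule Q.points.reg_mult)
    have f: "f i \<in> reg (X_fan S) U" and g: "g i \<in> reg E_space V" using fg(1) i by auto
    show "(\<lambda>y. f i (fan_class S D (slice_x y))) \<in>
      reg (X_aff Q) {y \<in> aff_points Q. lift y \<in> U \<times> V}"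
      using reg_lift_fst[OF f] by (rule Q.points.reg_subset[OF op, rotated]) (auto simp: lift_def)
    show "(\<lambda>y. g i (slice_e y)) \<in>
      reg (X_aff Q) {y \<in> aff_points Q. lift y \<in> U \<times> V}"
      using reg_slice_e[OF g] by (rule Q.points.reg_subset[OF op, rotated]) (auto simp: lift_def)
  qed
  then have "(\<lambda>y. \<Sum>i<n. f i (fan_class S D (slice_x y)) * g i (slice_e y)) \<in>
      reg (X_aff Q) {y \<in> aff_points Q. lift y \<in> U \<times> V}"
    by (intro Q.points.reg_sum[OF op]) simp_all
  moreover have "(\<lambda>y. h (lift y)) = (\<lambda>y. \<Sum>i<n. f i (fan_class S D (slice_x y)) * g i (slice_e y))"
    by (simp add: fg(2) lift_def)
  ultimately show ?thesis by simp
qed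

text \<open>The topology of the product is finer than the product topology, so continuity of the two
  components does not suffice. It is tested on the generating sets, where a tensor composed with the
  section is a regular function.\<close>

lemma openin_lift:
  assumes "openin (zariski XE) W"
  shows "openin (zariski (X_aff Q)) {y \<in> aff_points Q. lift y \<in> W}"
proof -
  let ?B = "{{z \<in> U \<times> V. h z \<noteq> 0} | U V h. openin (zariski (X_fan S)) U \<and>
      openin (zariski (E_space :: ('d \<times> 'n \<Rightarrow> complex) fspace)) V \<and>
      h \<in> tensor_functions (X_fan S) E_space U V}"
  have XE: "zariski (XE :: (_ \<times> ('d \<times> 'n \<Rightarrow> complex)) fspace) = topology_generated_by ?B" unfolding fs_prod_def Let_def fspace.simps ..
  have "continuous_map (zariski (X_aff Q)) (topology_generated_by ?B) lift"
    unfolding continuous_on_generated_topo_iff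
  proof (intro conjI allI impI)
    fix W assume "W \<in> ?B"
    then obtain U V h where W: "W = {z \<in> U \<times> V. h z \<noteq> 0}" and UV: "openin (zariski (X_fan S)) U" "openin (zariski E_space) V"
      "h \<in> tensor_functions (X_fan S) E_space U V" by blast
    have "openin (zariski (X_aff Q)) {y \<in> {y \<in> aff_points Q. lift y \<in> U \<times> V}. h (lift y) \<noteq> 0}"
      using tensor_lift[OF UV] by (rule Q.points.openin_reg_nonvanishing)
    moreover have "lift -` W \<inter> points (X_aff Q) = {y \<in> {y \<in> aff_points Q. lift y \<in> U \<times> V}. h (lift y) \<noteq> 0}"
      unfolding W Q.points_Spec by auto
    ultimately show "openin (zariski (X_aff Q)) (lift -` W \<inter> points (X_aff Q))" by simp
  next
    have "lift ` points (X_aff Q) \<subseteq> points XE" using lift_point unfolding Q.points_Spec by blast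
    then show "lift ` points (X_aff Q) \<subseteq> \<Union>?B" unfolding XE topology_generated_by_topspace .
  qed
  then show ?thesis
    using openin_continuous_map_preimage[of "zariski (X_aff Q)" "zariski XE" lift W] assms
    unfolding XE[symmetric] Q.points_Spec by blast
qed

lemma reg_lift:
  assumes \<psi>: "\<psi> \<in> reg XE W"
  shows "(\<lambda>y. \<psi> (lift y)) \<in> reg (X_aff Q) {y \<in> aff_points Q. lift y \<in> W}"
proof (rule Q.points.reg_divide_local)
  fix y assume "y \<in> {y \<in> aff_points Q. lift y \<in> W}"
  then have y: "y \<in> aff_points Q" "lift y \<in> W" by auto
  from bspec[OF \<psi>[unfolded reg_fs_prod] y(2)] obtain W' U V h k where W': "openin (zariski XE) W'" "lift y \<in> W'" "W' \<subseteq> W" "W' \<subseteq> U \<times> V"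
    and UV: "openin (zariski (X_fan S)) U" "openin (zariski E_space) V"
    and hk: "h \<in> tensor_functions (X_fan S) E_space U V" "k \<in> tensor_functions (X_fan S) E_space U V"
      "\<forall>w\<in>W'. k w \<noteq> 0 \<and> \<psi> w = h w / k w"
    by (elim exE conjE bexE)
  let ?O = "{y \<in> aff_points Q. lift y \<in> W'}"
  have sub: "?O \<subseteq> {y \<in> aff_points Q. lift y \<in> U \<times> V}" using W'(4) by blast
  note op = openin_lift[OF W'(1)]
  show "\<exists>U \<phi> \<theta>. y \<in> U \<and> U \<subseteq> {y \<in> aff_points Q. lift y \<in> W} \<and>
      \<phi> \<in> reg (X_aff Q) U \<and>
      \<theta> \<in> reg (X_aff Q) U \<and>
      (\<forall>z\<in>U. \<theta> z \<noteq> 0 \<and> \<psi> (lift z) = \<phi> z / \<theta> z)"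
  proof (rule exI[of _ ?O], rule exI[of _ "\<lambda>y. h (lift y)"], rule exI[of _ "\<lambda>y. k (lift y)"], intro conjI)
    show "y \<in> ?O" using y W'(2) by blast
    show "?O \<subseteq> {y \<in> aff_points Q. lift y \<in> W}" using W'(3) by blast
    show "(\<lambda>y. h (lift y)) \<in> reg (X_aff Q) ?O"
      using tensor_lift[OF UV hk(1)] by (rule Q.points.reg_subset[OF op sub])
    show "(\<lambda>y. k (lift y)) \<in> reg (X_aff Q) ?O"
      using tensor_lift[OF UV hk(2)] by (rule Q.points.reg_subset[OF op sub])
    show "\<forall>z\<in>?O. k (lift z) \<noteq> 0 \<and> \<psi> (lift z) = h (lift z) / k (lift z)" using hk(3) by blast
  qed
qed

end

section \<open>Descent along the local sections and the quotient property\<close>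

context div_fan
begin

lemma fan_chartI: "D \<in> S \<Longrightarrow> proper_support F \<Longrightarrow> fan_chart S D F"
  using quotient_chart_of_fan[of D F] by (simp add: fan_chart_def fan_chart_axioms_def div_fan_axioms)

lemma q_surj: "q_map S ` points XE = points YC"
proof (intro equalityI subsetI)
  fix y assume "y \<in> q_map S ` points XE"
  then obtain z where z: "z \<in> points XE" "y = q_map S z" by blast
  from z(1) obtain D F x e where D: "D \<in> S" "proper_support F" "x \<in> aff_points D"
    "e \<in> toric_chart (coord_cone F)" and "z = (fan_class S D x, e)" by (rule XE_pointE)
  then show "y \<in> points YC" using quot_class_point[OF D] q_map_eq[OF D] z(2) by simp
next
  fix y assume "y \<in> points YC"
  then obtain D F y' where D: "D \<in> S" "proper_support F" "y' \<in> aff_points (quotient_pdiv D F)"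
    and y: "y = fan_class (S_YC S) (quotient_pdiv D F) y'" unfolding points_X_YC by blast
  interpret fan_chart S D F using D(1,2) by (rule fan_chartI)
  show "y \<in> q_map S ` points XE" using q_lift[OF D(3)] lift_point[OF D(3)] y by (metis imageI)
qed

text \<open>Since \<open>lift\<close> is a section of q, the trace of V on a chart is the preimage
  under \<open>lift\<close> of the preimage of V under q. Openness and regularity upstairs therefore
  restrict to the quotient.\<close>

lemma preimage_lift:
  assumes "fan_chart S D F"
  shows "{y \<in> points (X_aff (quotient_pdiv D F)). fan_class (S_YC S) (quotient_pdiv D F) y \<in> V} =
    {y \<in> aff_points (quotient_pdiv D F). fan_chart.lift S D F y \<in> {z \<in> points XE. q_map S z \<in> V}}"
proof -
  interpret fan_chart S D F by fact
  show ?thesis using q_lift lift_point unfolding Q.points_Spec by auto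
qed

lemma openin_YC_if:
  fixes V :: "(('i \<times> 'n::finite) pdiv \<times> (('i \<times> 'n) group_ring \<Rightarrow> complex)) set set"
  assumes V: "V \<subseteq> points YC" and W: "openin (zariski XE) {z \<in> points XE. q_map S z \<in> V}"
  shows "openin (zariski YC) V"
  unfolding X_fan_def openin_glue
proof (intro conjI ballI)
  show "V \<subseteq> (\<Union>E\<in>S_YC S. fan_class (S_YC S) E ` points (X_aff E))"
    using V unfolding X_fan_def points_glue .
  fix E :: "('i \<times> 'n) pdiv" assume "E \<in> S_YC S"
  then obtain D and F :: "('i \<times> 'n) set" where D: "D \<in> S" "proper_support F" and E: "E = quotient_pdiv D F"
    unfolding S_YC_iff by blast
  interpret fan_chart S D F using D by (rule fan_chartI)
  show "openin (zariski (X_aff E)) {y \<in> points (X_aff E). fan_class (S_YC S) E y \<in> V}"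
    unfolding E preimage_lift[OF fan_chart_axioms] using W by (rule openin_lift)
qed

lemma invariant_descends:
  fixes V :: "(('i \<times> 'n::finite) pdiv \<times> (('i \<times> 'n) group_ring \<Rightarrow> complex)) set set"
  assumes V: "openin (zariski YC) V" and \<psi>: "\<psi> \<in> reg XE {z \<in> points XE. q_map S z \<in> V}"
    and inv: "\<forall>t\<in>torus. \<forall>z\<in>points XE. q_map S z \<in> V \<longrightarrow> \<psi> (diagonal_act t z) = \<psi> z"
  shows "\<exists>\<phi>\<in>reg YC V. \<forall>z\<in>points XE. q_map S z \<in> V \<longrightarrow> \<psi> z = \<phi> (q_map S z)"
proof -
  \<comment> \<open>Any preimage may be chosen: the fibres are orbits and \<psi> is invariant.
    Regularity is checked with the section \<open>lift\<close> instead of this choice.\<close>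
  define \<phi> where "\<phi> y = \<psi> (SOME z. z \<in> points XE \<and> q_map S z = y)" for y
  have \<phi>: "\<phi> (q_map S z) = \<psi> z" if z: "z \<in> points XE" "q_map S z \<in> V" for z
  proof -
    let ?z = "SOME z'. z' \<in> points XE \<and> q_map S z' = q_map S z"
    have "?z \<in> points XE \<and> q_map S ?z = q_map S z" by (rule someI[of _ z]) (use z in simp)
    then obtain t where "t \<in> torus" "?z = diagonal_act t z" using q_fibre[OF z(1)] by blast
    then show ?thesis using inv z unfolding \<phi>_def by simp
  qed
  have "\<phi> \<in> reg YC V"
    unfolding X_fan_def reg_glue
  proof
    fix E :: "('i \<times> 'n) pdiv" assume "E \<in> S_YC S"
    then obtain D and F :: "('i \<times> 'n) set" where D: "D \<in> S" "proper_support F" and E: "E = quotient_pdiv D F"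
      unfolding S_YC_iff by blast
    interpret fan_chart S D F using D by (rule fan_chartI)
    let ?U = "{y \<in> aff_points Q. lift y \<in> {z \<in> points XE. q_map S z \<in> V}}"
    have "(\<phi> \<circ> fan_class (S_YC S) Q) \<in> reg (X_aff Q) ?U"
        proof (rule Q.points.reg_cong)
      show "(\<lambda>y. \<psi> (lift y)) \<in> reg (X_aff Q) ?U"
        using reg_lift[OF \<psi>] .
      fix y assume "y \<in> ?U"
      then show "\<psi> (lift y) = (\<phi> \<circ> fan_class (S_YC S) Q) y" using \<phi>[of "lift y"] q_lift[of y] by simp
    qed
    then show "\<phi> \<circ> fan_class (S_YC S) E \<in> reg (X_aff E) {y \<in> points (X_aff E). fan_class (S_YC S) E y \<in> V}"
      unfolding E preimage_lift[OF fan_chart_axioms] .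
  qed
  then show ?thesis using \<phi> by (intro bexI[of _ \<phi>]) auto
qed

theorem geometric_quotient_q_map:
  "geometric_quotient torus diagonal_act (XE :: (_ \<times> ('i \<times> 'n::finite \<Rightarrow> complex)) fspace) YC (q_map S)"
proof -
  have cont: "continuous_map (zariski (XE :: (_ \<times> ('i \<times> 'n \<Rightarrow> complex)) fspace)) (zariski YC) (q_map S)"
    unfolding continuous_map_def using q_surj openin_q_preimage by blast
  moreover have "quotient_map (zariski (XE :: (_ \<times> ('i \<times> 'n \<Rightarrow> complex)) fspace)) (zariski YC) (q_map S)"
    unfolding quotient_map_def using q_surj openin_q_preimage openin_YC_if by blast
  ultimately show ?thesis
    unfolding geometric_quotient_def fs_morphism_def
    using q_pullback_reg q_surj q_fibre invariant_descends by blast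
qed

end

text \<open>The first conjunct ties the definite description in \<open>q_map\<close> to the
  morphisms on the charts, so that the quotient statement concerns the map glued from them.\<close>

theorem proposition3p3p12:
  fixes S :: "'d::finite pdiv set"
  assumes "divisorial_fan S" and "complete_fan S"
  shows "(\<forall>D\<in>S. \<forall>\<sigma>\<in>Sigma_E. \<forall>x\<in>points (X_aff D).
            \<forall>e\<in>(toric_chart \<sigma> :: ('d \<times> 'n::finite \<Rightarrow> complex) set).
              q_map S (fan_class S D x, e) = q_chart S D \<sigma> x e) \<and>
         geometric_quotient torus diagonal_act
           (fs_prod (X_fan S) (E_space :: ('d \<times> 'n \<Rightarrow> complex) fspace)) (X_fan (S_YC S))
           (q_map S)"
proof (intro conjI ballI)
  interpret div_fan S using assms(1) by (rule div_fan.intro)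
  show "geometric_quotient torus diagonal_act
           (fs_prod (X_fan S) (E_space :: ('d \<times> 'n \<Rightarrow> complex) fspace)) (X_fan (S_YC S))
           (q_map S)"
    by (rule geometric_quotient_q_map)
  fix D \<sigma> x and e :: "'d \<times> 'n \<Rightarrow> complex"
  assume D: "D \<in> S" and \<sigma>: "\<sigma> \<in> Sigma_E" and x: "x \<in> points (X_aff D)" and e: "e \<in> toric_chart \<sigma>"
  from \<sigma> obtain F where F: "proper_support F" "\<sigma> = coord_cone F" unfolding Sigma_E_iff by blast
  have x': "x \<in> aff_points D" using x points_X_aff[OF D] by simp
  show "q_map S (fan_class S D x, e) = q_chart S D \<sigma> x e"
    using q_map_eq[OF D F(1) x'] e q_chart_eq[OF D F(1)] by (simp add: F(2))
qed

end
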